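(* Let $M(t)$ be the $N\times N$ non-Hermitian matrix-valued Brownian motion started from a deterministic matrix $M(0)$ with simple spectrum. For $w\in\mathbb{C}\setminus\{0\}$ and $t\ge0$ let $\mu^\Lambda_w(t,\cdot)$, $\mu^{\mathcal O}_w(t,\cdot)$, $\Xi(t,\cdot)$, $\Theta(t,\cdot)$ be the random measures on $\mathbb{C}$ defined in the context. Then for any $\phi\in\mathcal{B}_{\rm c}(\mathbb{C})$, the set of all bounded measurable complex functions on $\mathbb{C}$ with compact support, $$\lim_{w\to0}\langle\mu^\Lambda_w(t,\cdot),\phi(\cdot)\rangle=\langle\Xi(t,\cdot),\phi(\cdot)\rangle,\qquad \lim_{w\to0}\langle\mu^{\mathcal O}_w(t,\cdot),\phi(\cdot)\rangle=\langle\Theta(t,\cdot),\phi(\cdot)\rangle,\qquad t\ge0,$$ where $\langle\mu,\phi\rangle:=\int_{\mathbb C}\phi(z)\,\mu(dz)$.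
   Context: Let $(B^{\rm R}_{jk}),(B^{\rm I}_{jk})$, $1\le j,k\le N$, be independent one-dimensional standard Brownian motions. $M(t)$ starts from the deterministic matrix $M(0)$ and has increments $dM_{jk}(t)=(dB^{\rm R}_{jk}(t)+i\,dB^{\rm I}_{jk}(t))/\sqrt{2N}$. Since the spectrum of $M(0)$ is simple, almost surely the eigenvalues $\Lambda_1(t),\dots,\Lambda_N(t)$ of $M(t)$ are distinct for all $t\ge0$. Let $S(t)$ be a matrix whose $j$-th column is a right eigenvector of $M(t)$ for $\Lambda_j(t)$ (so $M(t)=S(t)\,\mathrm{diag}(\Lambda_1(t),\dots,\Lambda_N(t))S^{-1}(t)$), $A(t)=S^\dagger(t)S(t)$ with $S^\dagger$ the Hermitian conjugate, and $\mathcal{O}_{jj}(t)=A^{-1}_{jj}(t)A_{jj}(t)$, where $A^{-1}_{jj}(t)$ is the $(j,j)$ entry of the inverse matrix of $A(t)$ (diagonal eigenvector overlap; independent of the choice of eigenvectors). With $\delta_\zeta$ the Dirac measure at $\zeta$, $$\Xi(t,\cdot)=\frac1N\sum_{j=1}^N\delta_{\Lambda_j(t)}(\cdot),\qquad \Theta(t,\cdot)=\frac1{N^2}\sum_{j=1}^N\mathcal{O}_{jj}(t)\,\delta_{\Lambda_j(t)}(\cdot).$$ For $(z,w)\in\mathbb{C}\times(\mathbb{C}\setminus\{0\})$ put $$\Psi(z,w;t)=\frac{1}{2N}\log\det\{(M^\dagger(t)-\overline z I)(M(t)-zI)+|w|^2I\},$$ and, with $m$ the Lebesgue measure on $\mathbb{C}$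 and Wirtinger derivatives, $$\mu^\Lambda_w(t,dz)=\frac2\pi\frac{\partial^2\Psi(z,w;t)}{\partial z\,\partial\overline z}\,m(dz),\qquad \mu^{\mathcal O}_w(t,dz)=\frac4\pi\left|\frac{\partial\Psi(z,w;t)}{\partial w}\right|^2m(dz).$$
   Formalization: The limits are proved almost surely for each fixed t and φ; at t=0 only, φ is also assumed continuous at the eigenvalues of M(0), since for φ the indicator of one eigenvalue of M(0) both left-hand limits are 0 while the right-hand sides are positive. *)

theory Defs
  imports "HOL-Probability.Probability"
begin

section \<open>Matrix-valued Brownian motion\<close>

definition std_brownian_motion :: "'w measure \<Rightarrow> (real \<Rightarrow> 'w \<Rightarrow> real) \<Rightarrow> bool" where
  "std_brownian_motion P B \<longleftrightarrow>
     (\<forall>t\<ge>0. B t \<in> borel_measurable P) \<and>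
     (AE \<omega> in P. B 0 \<omega> = 0) \<and>
     (\<forall>s t. 0 \<le> s \<and> s < t \<longrightarrow>
        distributed P lborel (\<lambda>\<omega>. B t \<omega> - B s \<omega>) (normal_density 0 (sqrt (t - s)))) \<and>
     (\<forall>(n::nat) (u::nat \<Rightarrow> real). 0 \<le> u 0 \<and> strict_mono_on {..n} u \<longrightarrow>
        prob_space.indep_vars P (\<lambda>_. borel) (\<lambda>i \<omega>. B (u (Suc i)) \<omega> - B (u i) \<omega>) {..<n}) \<and>
     (AE \<omega> in P. continuous_on {0..} (\<lambda>t. B t \<omega>))"

text \<open>Independence is that of whole paths: each process is a random element of the product
  space of real functions on \<open>[0, \<infinity>)\<close>.\<close>

definition indep_processes :: "'w measure \<Rightarrow> ('i \<Rightarrow> real \<Rightarrow> 'w \<Rightarrow> real) \<Rightarrow> bool" where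
  "indep_processes P X \<longleftrightarrow>
     prob_space.indep_vars P (\<lambda>_. Pi\<^sub>M {0..} (\<lambda>_. borel)) (\<lambda>i \<omega>. \<lambda>t\<in>{0..}. X i t \<omega>) UNIV"

definition indep_brownian_family ::
  "'w measure \<Rightarrow> ('n \<Rightarrow> 'n \<Rightarrow> real \<Rightarrow> 'w \<Rightarrow> real) \<Rightarrow> ('n \<Rightarrow> 'n \<Rightarrow> real \<Rightarrow> 'w \<Rightarrow> real) \<Rightarrow> bool" where
  "indep_brownian_family P BR BI \<longleftrightarrow>
     (\<forall>j k. std_brownian_motion P (BR j k) \<and> std_brownian_motion P (BI j k)) \<and>
     indep_processes P (case_sum (\<lambda>(j, k). BR j k) (\<lambda>(j, k). BI j k))"

definition matrix_bm ::
  "complex^'n^'n \<Rightarrow> ('n \<Rightarrow> 'n \<Rightarrow> real \<Rightarrow> 'w \<Rightarrow> real) \<Rightarrow> ('n \<Rightarrow> 'n \<Rightarrow> real \<Rightarrow> 'w \<Rightarrow> real)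
    \<Rightarrow> real \<Rightarrow> 'w \<Rightarrow> complex^'n^'n" where
  "matrix_bm M0 BR BI t \<omega> =
     (\<chi> j k. M0 $ j $ k
        + Complex (BR j k t \<omega>) (BI j k t \<omega>) / complex_of_real (sqrt (2 * real CARD('n))))"

section \<open>Eigenvalues and eigenvector overlaps\<close>

definition eigenvector :: "complex^'n^'n \<Rightarrow> complex^'n \<Rightarrow> complex \<Rightarrow> bool" where
  "eigenvector M v l \<longleftrightarrow> v \<noteq> 0 \<and> M *v v = l *s v"

definition eigenvalues :: "complex^'n^'n \<Rightarrow> complex set" where
  "eigenvalues M = {l. \<exists>v. eigenvector M v l}"

definition simple_spectrum :: "complex^'n^'n \<Rightarrow> bool" where
  "simple_spectrum M \<longleftrightarrow> card (eigenvalues M) = CARD('n)"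

definition eigensystem :: "complex^'n^'n \<Rightarrow> ('n \<Rightarrow> complex) \<Rightarrow> complex^'n^'n \<Rightarrow> bool" where
  "eigensystem M L S \<longleftrightarrow>
     bij_betw L UNIV (eigenvalues M) \<and> (\<forall>j. eigenvector M (column j S) (L j))"

definition adjoint_matrix :: "complex^'n^'n \<Rightarrow> complex^'n^'n" where
  "adjoint_matrix A = (\<chi> i j. cnj (A $ j $ i))"

text \<open>The overlap is complex by type only: for invertible \<open>S\<close> it is real and at least 1,
  because \<open>adjoint_matrix S ** S\<close> is then positive definite.\<close>

definition overlap :: "complex^'n^'n \<Rightarrow> 'n \<Rightarrow> complex" where
  "overlap S j =
     (let A = adjoint_matrix S ** S in matrix_inv A $ j $ j * A $ j $ j)"

section \<open>The random measures\<close>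

text \<open>The measure with atoms of weight \<open>c j\<close> at \<open>x j\<close>; points that coincide add up.\<close>

definition atomic_measure :: "('n::finite \<Rightarrow> real) \<Rightarrow> ('n \<Rightarrow> complex) \<Rightarrow> complex measure" where
  "atomic_measure c x = distr (point_measure UNIV (\<lambda>j. ennreal (c j))) borel x"

lemma emeasure_atomic_measure:
  assumes "A \<in> sets borel"
  shows "emeasure (atomic_measure c x) A
           = (\<Sum>j\<in>UNIV. ennreal (c j) * emeasure (return borel (x j)) A)"
proof -
  have "emeasure (atomic_measure c x) A
      = emeasure (point_measure UNIV (\<lambda>j. ennreal (c j))) (x -` A)"
    using assms unfolding atomic_measure_def
    by (subst emeasure_distr) (auto simp: space_point_measure)
  also have "\<dots> = (\<Sum>j\<in>x -` A. ennreal (c j))"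
    by (rule emeasure_point_measure_finite) auto
  also have "\<dots> = (\<Sum>j\<in>UNIV. ennreal (c j) * emeasure (return borel (x j)) A)"
    using assms by (intro sum.mono_neutral_cong_left) (auto simp: indicator_def)
  finally show ?thesis .
qed

definition Xi_measure :: "('n::finite \<Rightarrow> complex) \<Rightarrow> complex measure" where
  "Xi_measure L = atomic_measure (\<lambda>_. 1 / real CARD('n)) L"

definition Theta_measure :: "complex^'n^'n \<Rightarrow> ('n::finite \<Rightarrow> complex) \<Rightarrow> complex measure" where
  "Theta_measure S L = atomic_measure (\<lambda>j. Re (overlap S j) / (real CARD('n))\<^sup>2) L"

text \<open>For \<open>w \<noteq> 0\<close> the determinant is that of a positive definite Hermitian matrix, hence real
  and positive.\<close>

definition Psi :: "complex^'n^'n \<Rightarrow> complex \<Rightarrow> complex \<Rightarrow> real" where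
  "Psi M z w =
     ln (Re (det ((adjoint_matrix M - mat (cnj z)) ** (M - mat z) + mat (of_real ((cmod w)\<^sup>2)))))
       / (2 * real CARD('n))"

definition partial_x :: "(complex \<Rightarrow> complex) \<Rightarrow> complex \<Rightarrow> complex" where
  "partial_x f z = vector_derivative (\<lambda>s::real. f (z + of_real s)) (at 0)"

definition partial_y :: "(complex \<Rightarrow> complex) \<Rightarrow> complex \<Rightarrow> complex" where
  "partial_y f z = vector_derivative (\<lambda>s::real. f (z + \<i> * of_real s)) (at 0)"

definition wirtinger :: "(complex \<Rightarrow> complex) \<Rightarrow> complex \<Rightarrow> complex" where
  "wirtinger f z = (partial_x f z - \<i> * partial_y f z) / 2"

definition wirtinger_cnj :: "(complex \<Rightarrow> complex) \<Rightarrow> complex \<Rightarrow> complex" where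
  "wirtinger_cnj f z = (partial_x f z + \<i> * partial_y f z) / 2"

text \<open>For \<open>w \<noteq> 0\<close> the mixed derivative of \<^const>\<open>Psi\<close> in \<open>z\<close> is a quarter of a Laplacian, hence
  real, and it is nonnegative. So neither \<^const>\<open>Re\<close> nor \<^const>\<open>ennreal\<close> discards anything below.\<close>

definition mu_Lambda :: "complex^'n^'n \<Rightarrow> complex \<Rightarrow> complex measure" where
  "mu_Lambda M w = density lborel (\<lambda>z. ennreal (2 / pi *
     Re (wirtinger (wirtinger_cnj (\<lambda>z'. complex_of_real (Psi M z' w))) z)))"

definition mu_O :: "complex^'n^'n \<Rightarrow> complex \<Rightarrow> complex measure" where
  "mu_O M w = density lborel (\<lambda>z. ennreal (4 / pi *
     (cmod (wirtinger (\<lambda>w'. complex_of_real (Psi M z w')) w))\<^sup>2))"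

section \<open>Test functions\<close>

definition B_c :: "(complex \<Rightarrow> complex) set" where
  "B_c = {\<phi>. \<phi> \<in> borel_measurable borel \<and> bounded (range \<phi>) \<and> compact (closure {z. \<phi> z \<noteq> 0})}"

end

theory Submission
  imports Defs "HOL-Real_Asymp.Real_Asymp" "HOL-Computational_Algebra.Fundamental_Theorem_Algebra"
begin

text \<open>
  Fix \<open>t\<close> and write \<open>N\<close> for the size of \<open>M = M(t)\<close>, \<open>r\<close> for \<open>|w|\<^sup>2\<close>, \<open>Y\<close> for \<open>M - z\<close>,
  \<open>Y'\<close> for its adjoint, \<open>H = Y' Y + r\<close>, \<open>K = Y Y' + r\<close> and \<open>p(z, r) = det H = det K\<close>.
  Differentiating \<open>log p\<close> gives \<open>r (tr H\<^sup>-\<^sup>1)\<^sup>2 / (\<pi> N\<^sup>2)\<close> for the density of \<^const>\<open>mu_O\<close> and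
  \<open>r tr (K\<^sup>-\<^sup>1 H\<^sup>-\<^sup>1) / (\<pi> N)\<close> for that of \<^const>\<open>mu_Lambda\<close>; the second formula rests on
  \<open>Y H\<^sup>-\<^sup>1 Y' = 1 - r K\<^sup>-\<^sup>1\<close>. With adjugates in place of inverses both densities take the form
  \<open>r h(z, r) / p(z, r)\<^sup>2\<close> with \<open>h\<close> continuous up to \<open>r = 0\<close>.

  The function \<open>p(z, 0) = |det Y|\<^sup>2\<close> vanishes exactly at the eigenvalues. Near a simple eigenvalue
  \<open>\<lambda>\<^sub>j\<close> one has \<open>p(z, r) \<approx> g (|z - \<lambda>\<^sub>j|\<^sup>2 + O r)\<close>, where \<open>g\<close> is the squared modulus of the
  derivative of the characteristic polynomial at \<open>\<lambda>\<^sub>j\<close> and \<open>O\<close> is the overlap. The overlap appears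
  because the \<open>r\<close>-derivative of \<open>p\<close> is the trace of the adjugate of \<open>H\<close>, and the adjugate of
  \<open>M - \<lambda>\<^sub>j\<close> is a multiple of the rank-one spectral projection, whose Hilbert-Schmidt norm squared is
  \<open>O\<close> (\<open>trace_adjugate_gram_at_eigenvalue\<close>). After the substitution \<open>z = \<lambda>\<^sub>j + |w| u\<close> the densities
  therefore converge to a multiple of \<open>1 / (|u|\<^sup>2 + O)\<^sup>2\<close>, with integral \<open>1 / N\<close> in one case and
  \<open>O / N\<^sup>2\<close> in the other (\<open>integral_kernel\<close>), while they tend to zero uniformly on compact sets
  without eigenvalues. So they are approximate identities at the eigenvalues, and
  \<open>concentration_for_fixed_matrix\<close> gives both limits whenever every eigenvalue is a Lebesgue point
  of the test function: the integrable decay of the kernel lets small mean oscillation take the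
  place of continuity.

  It remains to see that, for \<open>t > 0\<close>, almost surely the spectrum is simple and all eigenvalues are
  Lebesgue points of the given bounded function. Almost every point of the plane is a Lebesgue
  point, by the Vitali covering lemma. The law of \<open>M(t)\<close> has a density with respect to Lebesgue measure
  on matrices, which is invariant under translation along any line \<open>c \<mapsto> M + c D\<close>. By Fubini, a Borel
  set of matrices that meets every translate of such a complex line in a null set has probability zero
  (\<open>AE_matrix_bm_avoids\<close>). For matrices having an eigenvalue in a null set one takes \<open>D = 1\<close>, which
  just shifts the spectrum. For matrices with a multiple eigenvalue one takes \<open>D\<close> diagonal with
  distinct entries: on each line these matrices are zeros of a nonzero polynomial, because
  \<open>det (\<chi>'(A)) = 0\<close> whenever the characteristic polynomial \<open>\<chi>\<close> of \<open>A\<close> has a multiple root.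
  At \<open>t = 0\<close> the matrix is deterministic, and the assumed continuity of the test function at its
  eigenvalues supplies the Lebesgue points.
\<close>

section \<open>A kernel on the plane and its mass\<close>

lemma emeasure_lborel_cball_complex:
  assumes "0 \<le> r" shows "emeasure lborel (cball (x::complex) r) = ennreal (pi * r\<^sup>2)"
  using emeasure_cball[OF assms, of x] by (simp add: unit_ball_vol_2)

lemma emeasure_lborel_ball_complex:
  assumes "0 \<le> r" shows "emeasure lborel (ball (x::complex) r) = ennreal (pi * r\<^sup>2)"
  using emeasure_ball[OF assms, of x] by (simp add: unit_ball_vol_2)

lemma nn_integral_tail_power_3:
  assumes "0 \<le> a"
  shows "(\<integral>\<^sup>+s. ennreal (2 / (1 + s) ^ 3) * indicator {a..} s \<partial>lborel) = ennreal (1 / (1 + a)\<^sup>2)"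
proof -
  have "(\<integral>\<^sup>+s. ennreal (2 / (1 + s) ^ 3) * indicator {a..} s \<partial>lborel) = ennreal (0 - (- (1 / (1 + a)\<^sup>2)))"
  proof (rule nn_integral_FTC_atLeast)
    fix s :: real assume "a \<le> s"
    then have "1 + s > 0" using assms by simp
    then show "DERIV (\<lambda>s. - (1 / (1 + s)\<^sup>2)) s :> 2 / (1 + s) ^ 3"
      by (auto intro!: derivative_eq_intros simp: divide_simps) (simp add: algebra_simps eval_nat_numeral)
    show "0 \<le> 2 / (1 + s) ^ 3" using \<open>1 + s > 0\<close> by simp
  next
    show "((\<lambda>s::real. - (1 / (1 + s)\<^sup>2)) \<longlongrightarrow> 0) at_top"
      by real_asymp
  qed measurable
  then show ?thesis by simp
qed

lemma nn_integral_power_3_linear: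
  "(\<integral>\<^sup>+s. ennreal (2 * s / (1 + s) ^ 3) * indicator {0..} s \<partial>lborel) = 1"
proof -
  have "(\<integral>\<^sup>+s. ennreal (2 * s / (1 + s) ^ 3) * indicator {0..} s \<partial>lborel)
      = ennreal (1 - (0::real)\<^sup>2 / (1 + 0)\<^sup>2)"
  proof (rule nn_integral_FTC_atLeast)
    fix s :: real assume "0 \<le> s"
    then have "1 + s > 0" by simp
    then show "DERIV (\<lambda>s. s\<^sup>2 / (1 + s)\<^sup>2) s :> 2 * s / (1 + s) ^ 3"
      by (auto intro!: derivative_eq_intros simp: divide_simps) (simp add: algebra_simps eval_nat_numeral)
    show "0 \<le> 2 * s / (1 + s) ^ 3" using \<open>0 \<le> s\<close> by simp
  next
    show "((\<lambda>s::real. s\<^sup>2 / (1 + s)\<^sup>2) \<longlongrightarrow> 1) at_top"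
      by real_asymp
  qed measurable
  then show ?thesis by simp
qed

text \<open>Layer cake: the integrand is \<open>\<integral> 2 / (1 + s)\<^sup>3 ds\<close> over \<open>s \<ge> |u|\<^sup>2\<close>, and for fixed \<open>s\<close>
  the admissible \<open>u\<close> form a disc of area \<open>\<pi> s\<close>.\<close>

lemma nn_integral_kernel:
  "(\<integral>\<^sup>+u. ennreal (1 / (1 + (cmod u)\<^sup>2)\<^sup>2) \<partial>lborel) = ennreal pi"
proof -
  have "(\<integral>\<^sup>+u. ennreal (1 / (1 + (cmod u)\<^sup>2)\<^sup>2) \<partial>lborel)
     = (\<integral>\<^sup>+(u::complex). \<integral>\<^sup>+(s::real). ennreal (2 / (1 + s) ^ 3) * indicator {(cmod u)\<^sup>2..} s \<partial>lborel \<partial>lborel)"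
    by (simp add: nn_integral_tail_power_3)
  also have "\<dots> = (\<integral>\<^sup>+(s::real). \<integral>\<^sup>+(u::complex). ennreal (2 / (1 + s) ^ 3) * indicator {(cmod u)\<^sup>2..} s \<partial>lborel \<partial>lborel)"
    by (rule lborel_pair.Fubini') (simp add: indicator_def; measurable)
  also have "\<dots> = (\<integral>\<^sup>+(s::real). ennreal pi * (ennreal (2 * s / (1 + s) ^ 3) * indicator {0..} s) \<partial>lborel)"
  proof (rule nn_integral_cong)
    fix s :: real
    show "(\<integral>\<^sup>+(u::complex). ennreal (2 / (1 + s) ^ 3) * indicator {(cmod u)\<^sup>2..} s \<partial>lborel)
      = ennreal pi * (ennreal (2 * s / (1 + s) ^ 3) * indicator {0..} s)"
    proof (cases "s \<ge> 0")
      case True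
      have "(\<integral>\<^sup>+(u::complex). ennreal (2 / (1 + s) ^ 3) * indicator {(cmod u)\<^sup>2..} s \<partial>lborel)
        = (\<integral>\<^sup>+(u::complex). ennreal (2 / (1 + s) ^ 3) * indicator (cball 0 (sqrt s)) u \<partial>lborel)"
        using True by (intro nn_integral_cong) (auto simp: indicator_def real_le_rsqrt
            dest: real_sqrt_le_mono intro: sqrt_ge_absD)
      also have "\<dots> = ennreal (2 / (1 + s) ^ 3) * ennreal (pi * (sqrt s)\<^sup>2)"
        using True by (subst nn_integral_cmult_indicator) (auto simp: emeasure_lborel_cball_complex)
      also have "\<dots> = ennreal pi * (ennreal (2 * s / (1 + s) ^ 3) * indicator {0..} s)"
        using True by (simp add: ennreal_mult[symmetric] mult_ac)
      finally show ?thesis .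
    next
      case False
      then have "\<not> (cmod u)\<^sup>2 \<le> s" for u
        by (meson linorder_not_le order_trans zero_le_power2)
      then show ?thesis using False by simp
    qed
  qed
  also have "\<dots> = ennreal pi"
    by (subst nn_integral_cmult) (auto simp: nn_integral_power_3_linear)
  finally show ?thesis .
qed

lemma has_bochner_integral_kernel:
  "has_bochner_integral lborel (\<lambda>u::complex. 1 / (1 + (cmod u)\<^sup>2)\<^sup>2) pi"
  by (rule has_bochner_integral_nn_integral) (auto simp: nn_integral_kernel)

lemma lborel_integral_complex_affine:
  fixes f :: "complex \<Rightarrow> 'b::{banach, second_countable_topology}"
  assumes "c > 0" and f: "f \<in> borel_measurable borel"
  shows "(\<integral>z. f z \<partial>lborel) = (\<integral>u. c\<^sup>2 *\<^sub>R f (x + c *\<^sub>R u) \<partial>lborel)"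
proof -
  have "(\<integral>z. f z \<partial>lborel) = integral\<^sup>L (density (distr lborel borel (\<lambda>u. x + c *\<^sub>R u)) (\<lambda>_. ennreal (c\<^sup>2))) f"
    using lborel_affine[of c x] \<open>c > 0\<close> by simp
  also have "\<dots> = integral\<^sup>L (distr lborel borel (\<lambda>u. x + c *\<^sub>R u)) (\<lambda>u. c\<^sup>2 *\<^sub>R f u)"
    using f by (subst integral_density) auto
  also have "\<dots> = (\<integral>u. c\<^sup>2 *\<^sub>R f (x + c *\<^sub>R u) \<partial>lborel)"
    using f by (subst integral_distr) auto
  finally show ?thesis .
qed

lemma lborel_integrable_complex_affine:
  fixes f :: "complex \<Rightarrow> 'b::{banach, second_countable_topology}"
  assumes "c > 0" and f: "integrable lborel f"
  shows "integrable lborel (\<lambda>u. f (x + c *\<^sub>R u))"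
proof -
  have fm: "f \<in> borel_measurable borel" using f by auto
  have "integrable (density (distr lborel borel (\<lambda>u. x + c *\<^sub>R u)) (\<lambda>_. ennreal (c\<^sup>2))) f"
    using lborel_affine[of c x] \<open>c > 0\<close> f by simp
  then have "integrable (distr lborel borel (\<lambda>u. x + c *\<^sub>R u)) (\<lambda>u. c\<^sup>2 *\<^sub>R f u)"
    using fm by (subst (asm) integrable_density) auto
  then have "integrable lborel (\<lambda>u. c\<^sup>2 *\<^sub>R f (x + c *\<^sub>R u))"
    using fm by (subst (asm) integrable_distr_eq) auto
  then have "integrable lborel (\<lambda>u. (1 / c\<^sup>2) *\<^sub>R (c\<^sup>2 *\<^sub>R f (x + c *\<^sub>R u)))"
    by (rule integrable_scaleR_right)
  then show ?thesis using \<open>c > 0\<close> by simp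
qed

lemma integral_kernel:
  assumes "a > 0" "b > 0"
  shows "(\<integral>(u::complex). 1 / (a * (cmod u)\<^sup>2 + b)\<^sup>2 \<partial>lborel) = pi / (a * b)"
proof -
  define c where "c = sqrt (b / a)"
  have c: "c > 0" "c\<^sup>2 = b / a" using assms by (auto simp: c_def)
  have "(\<integral>(u::complex). 1 / (a * (cmod u)\<^sup>2 + b)\<^sup>2 \<partial>lborel)
      = (\<integral>(u::complex). c\<^sup>2 *\<^sub>R (1 / (a * (cmod (0 + c *\<^sub>R u))\<^sup>2 + b)\<^sup>2) \<partial>lborel)"
    by (rule lborel_integral_complex_affine) (use c in auto)
  also have "\<dots> = (\<integral>(u::complex). 1 / (a * b) * (1 / (1 + (cmod u)\<^sup>2)\<^sup>2) \<partial>lborel)"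
  proof (rule Bochner_Integration.integral_cong)
    fix u :: complex
    have "a * (cmod (0 + c *\<^sub>R u))\<^sup>2 + b = b * (1 + (cmod u)\<^sup>2)"
      using c assms by (simp add: power_mult_distrib field_simps)
    then show "c\<^sup>2 *\<^sub>R (1 / (a * (cmod (0 + c *\<^sub>R u))\<^sup>2 + b)\<^sup>2) = 1 / (a * b) * (1 / (1 + (cmod u)\<^sup>2)\<^sup>2)"
      using c assms by (simp add: power_mult_distrib power2_eq_square)
  qed simp
  also have "\<dots> = 1 / (a * b) * pi"
    by (simp only: integral_mult_right_zero has_bochner_integral_integral_eq[OF has_bochner_integral_kernel])
  finally show ?thesis by simp
qed



section \<open>Approximate identities at Lebesgue points\<close>

lemma tendsto_kernel_tail:
  "((\<lambda>R. \<integral>u. indicator (- ball 0 R) u / (1 + (cmod u)\<^sup>2)\<^sup>2 \<partial>lborel) \<longlongrightarrow> 0) at_top"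
proof -
  have "((\<lambda>R. \<integral>u. indicator (- ball 0 R) u / (1 + (cmod u)\<^sup>2)\<^sup>2 \<partial>lborel)
      \<longlongrightarrow> (\<integral>(u::complex). 0 \<partial>lborel)) at_top"
  proof (rule integral_dominated_convergence_at_top)
    show "integrable lborel (\<lambda>u::complex. 1 / (1 + (cmod u)\<^sup>2)\<^sup>2)"
      using has_bochner_integral_kernel by (simp add: has_bochner_integral_iff)
    have "((\<lambda>R. indicator (- ball 0 R) u / (1 + (cmod u)\<^sup>2)\<^sup>2) \<longlongrightarrow> (0::real)) at_top" for u :: complex
      by (rule tendsto_eventually)
         (use eventually_gt_at_top[of "cmod u"] in eventually_elim, auto)
    then show "AE u in lborel. ((\<lambda>R. indicator (- ball 0 R) (u::complex) / (1 + (cmod u)\<^sup>2)\<^sup>2) \<longlongrightarrow> (0::real)) at_top"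
      by simp
  qed (auto simp: indicator_def)
  then show ?thesis by simp
qed

abbreviation mean_oscillation :: "(complex \<Rightarrow> complex) \<Rightarrow> complex \<Rightarrow> real \<Rightarrow> real" where
  "mean_oscillation \<phi> x e \<equiv> (\<integral>z. indicator (ball x e) z * cmod (\<phi> z - \<phi> x) \<partial>lborel) / e\<^sup>2"

text \<open>The average is taken against the square of the radius instead of the area of the disc, which
  only drops the factor \<open>\<pi>\<close>.\<close>

definition lebesgue_point :: "(complex \<Rightarrow> complex) \<Rightarrow> complex \<Rightarrow> bool" where
  "lebesgue_point \<phi> x \<longleftrightarrow>
     ((\<lambda>e. mean_oscillation \<phi> x e) \<longlongrightarrow> 0) (at_right 0)"

abbreviation kernel :: "complex \<Rightarrow> real \<Rightarrow> complex \<Rightarrow> real" where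
  "kernel x e z \<equiv> e\<^sup>2 / ((cmod (z - x))\<^sup>2 + e\<^sup>2)\<^sup>2"

lemma integrable_kernel_scaled:
  assumes "e > 0"
  shows "integrable lborel (\<lambda>z::complex. kernel x e z)"
proof -
  have "integrable lborel (\<lambda>u::complex. 1 / (1 + (cmod u)\<^sup>2)\<^sup>2)"
    using has_bochner_integral_kernel by (simp add: has_bochner_integral_iff)
  from lborel_integrable_complex_affine[OF _ this, of "1/e" "- (x /\<^sub>R e)"] assms
  have "integrable lborel (\<lambda>z::complex. 1 / e\<^sup>2 * (1 / (1 + (cmod (- (x /\<^sub>R e) + (1/e) *\<^sub>R z))\<^sup>2)\<^sup>2))"
    by (intro integrable_mult_right) auto
  also have "(\<lambda>z::complex. 1 / e\<^sup>2 * (1 / (1 + (cmod (- (x /\<^sub>R e) + (1/e) *\<^sub>R z))\<^sup>2)\<^sup>2)) =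
      (\<lambda>z::complex. kernel x e z)"
  proof
    fix z :: complex
    have "- (x /\<^sub>R e) + (1/e) *\<^sub>R z = (1/e) *\<^sub>R (z - x)"
      by (simp add: algebra_simps divide_inverse)
    then have "1 + (cmod (- (x /\<^sub>R e) + (1/e) *\<^sub>R z))\<^sup>2 = ((cmod (z - x))\<^sup>2 + e\<^sup>2) / e\<^sup>2"
      unfolding \<open>_ = (1/e) *\<^sub>R (z - x)\<close> norm_scaleR using assms by (simp add: power_mult_distrib power_divide field_simps)
    then show "1 / e\<^sup>2 * (1 / (1 + (cmod (- (x /\<^sub>R e) + (1/e) *\<^sub>R z))\<^sup>2)\<^sup>2) = kernel x e z"
      using assms by (simp add: power_divide power2_eq_square)
  qed
  finally show ?thesis .
qed

text \<open>Inside the ball of radius \<open>R e\<close> the kernel is at most \<open>1 / e\<^sup>2\<close>, so that part is controlled by the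
  mean oscillation. Outside, \<open>\<phi>\<close> is bounded and the mass of the kernel is a tail that does not depend
  on \<open>e\<close>. Hence \<open>R\<close> is chosen first and \<open>e\<close> afterwards.\<close>

lemma kernel_average_tendsto_0:
  assumes [measurable]: "\<phi> \<in> borel_measurable borel" and B: "\<And>z. cmod (\<phi> z) \<le> B"
    and lp: "lebesgue_point \<phi> x"
  shows "((\<lambda>e. \<integral>z. kernel x e z * cmod (\<phi> z - \<phi> x) \<partial>lborel) \<longlongrightarrow> 0) (at_right 0)"
    (is "(?T \<longlongrightarrow> 0) _")
proof -
  have [measurable]: "ball y r \<in> sets borel" for y :: complex and r by simp
  let ?tail = "\<lambda>R. \<integral>u. indicator (- ball 0 R) u / (1 + (cmod u)\<^sup>2)\<^sup>2 \<partial>lborel"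
  let ?I = "\<lambda>e. \<integral>z. indicator (ball x e) z * cmod (\<phi> z - \<phi> x) \<partial>lborel"
  have B0: "B \<ge> 0" using B[of 0] norm_ge_zero order_trans by blast
  have dB: "cmod (\<phi> z - \<phi> x) \<le> 2 * B" for z
    using B[of z] B[of x] norm_triangle_ineq4[of "\<phi> z" "\<phi> x"] by linarith
  have Tnn: "?T e \<ge> 0" for e by (intro integral_nonneg_AE) auto
  have bound: "?T e \<le> ?I (R * e) / e\<^sup>2 + 2 * B * ?tail R" if e: "e > 0" and R: "R > 0" for e R
  proof -
    let ?k = "\<lambda>z. kernel x e z"
    let ?U = "- ball x (R * e)"
    have ik: "integrable lborel ?k" by (rule integrable_kernel_scaled[OF e])
    have ik2: "integrable lborel (\<lambda>z. indicator ?U z * ?k z)"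
      by (rule Bochner_Integration.integrable_bound[OF ik]) (auto simp: indicator_def)
    have ib: "integrable lborel (\<lambda>z. indicator (ball x (R * e)) z * cmod (\<phi> z - \<phi> x))"
    proof (rule Bochner_Integration.integrable_bound)
      show "integrable lborel (\<lambda>z. indicator (ball x (R * e)) z * (2 * B))"
        using e R by (intro integrable_mult_left integrable_real_indicator)
            (auto simp: emeasure_lborel_ball_complex)
      show "AE z in lborel. norm (indicator (ball x (R * e)) z * cmod (\<phi> z - \<phi> x)) \<le> norm (indicator (ball x (R * e)) z * (2 * B))"
        using dB B0 by (auto simp: indicator_def)
    qed simp_all
    have iT: "integrable lborel (\<lambda>z. ?k z * cmod (\<phi> z - \<phi> x))"
    proof (rule Bochner_Integration.integrable_bound)
      show "integrable lborel (\<lambda>z. ?k z * (2 * B))" using ik by (rule integrable_mult_left)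
      show "AE z in lborel. norm (?k z * cmod (\<phi> z - \<phi> x)) \<le> norm (?k z * (2 * B))"
        using dB B0 by (intro AE_I2) (auto simp: abs_mult intro!: mult_left_mono divide_right_mono)
    qed simp_all
    have "?T e \<le> (\<integral>z. 1 / e\<^sup>2 * (indicator (ball x (R * e)) z * cmod (\<phi> z - \<phi> x)) + 2 * B * (indicator ?U z * ?k z) \<partial>lborel)"
    proof (rule integral_mono[OF iT])
      show "integrable lborel (\<lambda>z. 1 / e\<^sup>2 * (indicator (ball x (R * e)) z * cmod (\<phi> z - \<phi> x)) + 2 * B * (indicator ?U z * ?k z))"
        using ib ik2 by (intro Bochner_Integration.integrable_add integrable_mult_right)
      fix z
      show "?k z * cmod (\<phi> z - \<phi> x) \<le> 1 / e\<^sup>2 * (indicator (ball x (R * e)) z * cmod (\<phi> z - \<phi> x)) + 2 * B * (indicator ?U z * ?k z)"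
      proof (cases "z \<in> ball x (R * e)")
        case True
        have "?k z \<le> e\<^sup>2 / (e\<^sup>2)\<^sup>2"
          using e by (intro divide_left_mono power_mono) auto
        also have "\<dots> = 1 / e\<^sup>2" using e by (simp add: power2_eq_square)
        finally have "?k z * cmod (\<phi> z - \<phi> x) \<le> 1 / e\<^sup>2 * cmod (\<phi> z - \<phi> x)"
          by (rule mult_right_mono) simp
        then show ?thesis using True by simp
      next
        case False
        have "?k z * cmod (\<phi> z - \<phi> x) \<le> ?k z * (2 * B)"
          using dB by (intro mult_left_mono) auto
        then show ?thesis using False by (simp add: mult_ac)
      qed
    qed
    also have "\<dots> = 1 / e\<^sup>2 * ?I (R * e) + 2 * B * (\<integral>z. indicator ?U z * ?k z \<partial>lborel)"
      using ib ik2 by (subst Bochner_Integration.integral_add) (auto simp del: times_divide_eq_right times_divide_eq_left)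
    also have "(\<integral>z. indicator ?U z * ?k z \<partial>lborel) = ?tail R"
    proof -
      have "(\<integral>z. indicator ?U z * ?k z \<partial>lborel)
          = (\<integral>u. e\<^sup>2 *\<^sub>R (indicator ?U (x + e *\<^sub>R u) * ?k (x + e *\<^sub>R u)) \<partial>lborel)"
        by (rule lborel_integral_complex_affine[OF e]) measurable
      also have "\<dots> = ?tail R"
      proof (rule Bochner_Integration.integral_cong)
        fix u :: complex
        have 1: "indicator ?U (x + e *\<^sub>R u) = (indicator (- ball 0 R) u :: real)"
          using e by (auto simp: indicator_def dist_norm)
        have "(cmod (e *\<^sub>R u))\<^sup>2 + e\<^sup>2 = e\<^sup>2 * (1 + (cmod u)\<^sup>2)"
          using e by (simp add: power_mult_distrib algebra_simps)
        then have "e\<^sup>2 * ?k (x + e *\<^sub>R u) = 1 / (1 + (cmod u)\<^sup>2)\<^sup>2"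
          using e by (simp add: power_mult_distrib power2_eq_square)
        then show "e\<^sup>2 *\<^sub>R (indicator ?U (x + e *\<^sub>R u) * ?k (x + e *\<^sub>R u)) = indicator (- ball 0 R) u / (1 + (cmod u)\<^sup>2)\<^sup>2"
          unfolding 1 by (simp add: indicator_def)
      qed simp
      finally show ?thesis .
    qed
    finally show ?thesis by simp
  qed
  show ?thesis
  proof (rule tendstoI)
    fix \<eta> :: real assume \<eta>: "\<eta> > 0"
    have "((\<lambda>R. 2 * B * ?tail R) \<longlongrightarrow> 2 * B * 0) at_top"
      by (intro tendsto_mult_left tendsto_kernel_tail)
    then have "eventually (\<lambda>R. 2 * B * ?tail R < \<eta> / 2) at_top"
      using \<eta> by (intro order_tendstoD(2)[where a="\<eta>/2"]) auto
    then have "eventually (\<lambda>R. R > 0 \<and> 2 * B * ?tail R < \<eta> / 2) at_top"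
      using eventually_gt_at_top[of "0::real"] by eventually_elim auto
    then obtain R where R: "R > 0" "2 * B * ?tail R < \<eta> / 2"
      by (auto dest!: eventually_happens)
    have "filterlim (\<lambda>e. R * e) (at_right 0) (at_right 0)"
      using R(1) by real_asymp
    from filterlim_compose[OF lp[unfolded lebesgue_point_def] this]
    have "((\<lambda>e. R\<^sup>2 * (?I (R * e) / (R * e)\<^sup>2)) \<longlongrightarrow> R\<^sup>2 * 0) (at_right 0)"
      by (intro tendsto_mult_left)
    then have "eventually (\<lambda>e. R\<^sup>2 * (?I (R * e) / (R * e)\<^sup>2) < \<eta> / 2) (at_right 0)"
      using \<eta> by (intro order_tendstoD(2)[where a="\<eta>/2"]) auto
    moreover have "eventually (\<lambda>e::real. e > 0) (at_right 0)"
      by (simp add: eventually_at_right_less)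
    ultimately show "eventually (\<lambda>e. dist (?T e) 0 < \<eta>) (at_right 0)"
    proof eventually_elim
      case (elim e)
      have "?T e \<le> ?I (R * e) / e\<^sup>2 + 2 * B * ?tail R" using bound elim R by blast
      also have "?I (R * e) / e\<^sup>2 = R\<^sup>2 * (?I (R * e) / (R * e)\<^sup>2)"
        using R elim by (simp add: power_mult_distrib)
      finally have "?T e < \<eta>" using elim(1) R(2) by linarith
      then show ?case using Tnn[of e] by (simp add: dist_real_def)
    qed
  qed
qed

text \<open>Split \<open>\<phi> z = \<phi> x + (\<phi> z - \<phi> x)\<close>. The constant part converges by dominated convergence in the
  rescaled variable \<open>u = (z - x) / e\<close>, and the domination by the kernel reduces the other part to
  \<open>kernel_average_tendsto_0\<close>.\<close>

lemma approximate_identity_at_lebesgue_point: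
  fixes f :: "real \<Rightarrow> complex \<Rightarrow> real" and k :: "complex \<Rightarrow> real"
  assumes [measurable]: "\<phi> \<in> borel_measurable borel" and B: "\<And>z. cmod (\<phi> z) \<le> B"
    and lp: "lebesgue_point \<phi> x" and "d > 0" "e0 > 0"
    and [measurable]: "\<And>e. f e \<in> borel_measurable borel"
    and fb: "\<And>e z. 0 < e \<Longrightarrow> e < e0 \<Longrightarrow> z \<in> ball x d \<Longrightarrow> \<bar>f e z\<bar> \<le> C * (kernel x e z)"
    and k: "\<And>u. ((\<lambda>e. e\<^sup>2 * f e (x + e *\<^sub>R u)) \<longlongrightarrow> k u) (at_right 0)"
    and [measurable]: "k \<in> borel_measurable borel"
  shows "((\<lambda>e. \<integral>z. indicator (ball x d) z *\<^sub>R (f e z *\<^sub>R \<phi> z) \<partial>lborel)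
           \<longlongrightarrow> (\<integral>u. k u \<partial>lborel) *\<^sub>R \<phi> x) (at_right 0)"
proof -
  let ?D = "ball x d"
  have [measurable]: "?D \<in> sets borel" by simp
  have C0: "C \<ge> 0"
  proof -
    have "0 \<le> \<bar>f (e0/2) x\<bar>" by simp
    also have "\<dots> \<le> C * ((e0/2)\<^sup>2 / ((cmod (x - x))\<^sup>2 + (e0/2)\<^sup>2)\<^sup>2)"
      using fb[of "e0/2" x] \<open>d > 0\<close> \<open>e0 > 0\<close> by auto
    finally show ?thesis using \<open>e0 > 0\<close> by (simp add: zero_le_mult_iff zero_le_divide_iff)
  qed
  have small: "eventually (\<lambda>e::real. 0 < e \<and> e < e0) (at_right 0)"
    using \<open>e0 > 0\<close> eventually_at_right by blast
  have ifD: "integrable lborel (\<lambda>z. indicator ?D z * f e z)" if "0 < e" "e < e0" for e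
  proof (rule Bochner_Integration.integrable_bound)
    show "integrable lborel (\<lambda>z::complex. C * (kernel x e z))"
      using integrable_kernel_scaled[OF that(1)] by (intro integrable_mult_right)
    show "AE z in lborel. norm (indicator ?D z * f e z) \<le> norm (C * (kernel x e z))"
      using fb[OF that] C0 by (intro AE_I2) (auto simp: indicator_def)
  qed simp_all
  have mass: "((\<lambda>e. \<integral>z. indicator ?D z * f e z \<partial>lborel) \<longlongrightarrow> (\<integral>u. k u \<partial>lborel)) (at_right 0)"
  proof (subst tendsto_at_iff_sequentially, intro allI impI)
    fix X :: "nat \<Rightarrow> real" assume X: "\<forall>i. X i \<in> {0<..} - {0}" "X \<longlonglongrightarrow> 0"
    have X0: "X i > 0" for i using X by auto
    define s where "s i u = (if X i < e0 then (X i)\<^sup>2 * (indicator ?D (x + X i *\<^sub>R u) * f (X i) (x + X i *\<^sub>R u)) else 0)" for i u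
    have [measurable]: "s i \<in> borel_measurable borel" for i unfolding s_def by measurable
    have Xsmall: "eventually (\<lambda>i. X i < e0) sequentially"
      using order_tendstoD(2)[OF X(2) \<open>e0 > 0\<close>] .
    have XR: "filterlim X (at_right 0) sequentially"
      using X X0 by (simp add: filterlim_at less_imp_neq[OF X0, symmetric])
    have "(\<lambda>i. \<integral>u. s i u \<partial>lborel) \<longlonglongrightarrow> (\<integral>u. k u \<partial>lborel)"
    proof (rule integral_dominated_convergence)
      show "integrable lborel (\<lambda>u::complex. C * (1 / (1 + (cmod u)\<^sup>2)\<^sup>2))"
        using has_bochner_integral_kernel by (intro integrable_mult_right) (simp add: has_bochner_integral_iff)
      have "norm (s i u) \<le> C * (1 / (1 + (cmod u)\<^sup>2)\<^sup>2)" for i u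
      proof (cases "X i < e0 \<and> x + X i *\<^sub>R u \<in> ?D")
        case True
        have "(cmod (X i *\<^sub>R u))\<^sup>2 + (X i)\<^sup>2 = (X i)\<^sup>2 * (1 + (cmod u)\<^sup>2)"
          by (simp add: power_mult_distrib algebra_simps)
        then have e: "(X i)\<^sup>2 * ((X i)\<^sup>2 / ((cmod ((x + X i *\<^sub>R u) - x))\<^sup>2 + (X i)\<^sup>2)\<^sup>2) = 1 / (1 + (cmod u)\<^sup>2)\<^sup>2"
          using X0[of i] by (simp add: power_mult_distrib power2_eq_square)
        have "norm (s i u) = (X i)\<^sup>2 * \<bar>f (X i) (x + X i *\<^sub>R u)\<bar>"
          using True by (simp add: s_def abs_mult)
        also have "\<dots> \<le> (X i)\<^sup>2 * (C * ((X i)\<^sup>2 / ((cmod ((x + X i *\<^sub>R u) - x))\<^sup>2 + (X i)\<^sup>2)\<^sup>2))"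
          using True X0 by (intro mult_left_mono fb) auto
        also have "\<dots> = C * ((X i)\<^sup>2 * ((X i)\<^sup>2 / ((cmod ((x + X i *\<^sub>R u) - x))\<^sup>2 + (X i)\<^sup>2)\<^sup>2))"
          by (simp add: mult_ac)
        finally show ?thesis unfolding e .
      next
        case False
        then have "s i u = 0" by (auto simp: s_def)
        then show ?thesis using C0 by simp
      qed
      then show "AE u in lborel. norm (s i u) \<le> C * (1 / (1 + (cmod u)\<^sup>2)\<^sup>2)" for i by simp
      have "(\<lambda>i. s i u) \<longlonglongrightarrow> k u" for u
      proof -
        have "(\<lambda>i. (X i)\<^sup>2 * f (X i) (x + X i *\<^sub>R u)) \<longlonglongrightarrow> k u"
          using filterlim_compose[OF k XR] .
        moreover have "(\<lambda>i. x + X i *\<^sub>R u) \<longlonglongrightarrow> x + 0 *\<^sub>R u"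
          by (intro tendsto_intros X)
        then have "eventually (\<lambda>i. x + X i *\<^sub>R u \<in> ?D) sequentially"
          using \<open>d > 0\<close> by (intro topological_tendstoD) auto
        with Xsmall have "eventually (\<lambda>i. (X i)\<^sup>2 * f (X i) (x + X i *\<^sub>R u) = s i u) sequentially"
          by eventually_elim (simp add: s_def)
        ultimately show ?thesis by (rule Lim_transform_eventually)
      qed
      then show "AE u in lborel. (\<lambda>i. s i u) \<longlonglongrightarrow> k u" by simp
    qed auto
    moreover have "eventually (\<lambda>i. (\<integral>u. s i u \<partial>lborel) = ((\<lambda>e. \<integral>z. indicator ?D z * f e z \<partial>lborel) \<circ> X) i) sequentially"
      using Xsmall
    proof eventually_elim
      case (elim i)
      have "((\<lambda>e. \<integral>z. indicator ?D z * f e z \<partial>lborel) \<circ> X) i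
        = (\<integral>u. (X i)\<^sup>2 *\<^sub>R (indicator ?D (x + X i *\<^sub>R u) * f (X i) (x + X i *\<^sub>R u)) \<partial>lborel)"
        unfolding o_def by (rule lborel_integral_complex_affine[OF X0]) measurable
      then show ?case using elim by (simp add: s_def)
    qed
    ultimately show "((\<lambda>e. \<integral>z. indicator ?D z * f e z \<partial>lborel) \<circ> X) \<longlonglongrightarrow> (\<integral>u. k u \<partial>lborel)"
      by (rule Lim_transform_eventually)
  qed
  have osc: "((\<lambda>e. \<integral>z. (indicator ?D z * f e z) *\<^sub>R (\<phi> z - \<phi> x) \<partial>lborel) \<longlongrightarrow> 0) (at_right 0)"
  proof (rule Lim_null_comparison)
    have "((\<lambda>e. C * (\<integral>z. kernel x e z * cmod (\<phi> z - \<phi> x) \<partial>lborel)) \<longlongrightarrow> C * 0) (at_right 0)"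
      by (intro tendsto_mult_left kernel_average_tendsto_0[OF _ B lp]) measurable
    then show "((\<lambda>e. C * (\<integral>z. kernel x e z * cmod (\<phi> z - \<phi> x) \<partial>lborel)) \<longlongrightarrow> 0) (at_right 0)"
      by simp
    show "eventually (\<lambda>e. norm (\<integral>z. (indicator ?D z * f e z) *\<^sub>R (\<phi> z - \<phi> x) \<partial>lborel)
        \<le> C * (\<integral>z. kernel x e z * cmod (\<phi> z - \<phi> x) \<partial>lborel)) (at_right 0)"
      using small
    proof eventually_elim
      case (elim e)
      let ?k = "\<lambda>z. kernel x e z"
      have dB: "cmod (\<phi> z - \<phi> x) \<le> 2 * B" for z
        using B[of z] B[of x] norm_triangle_ineq4[of "\<phi> z" "\<phi> x"] by linarith
      have B0: "B \<ge> 0" using B[of 0] norm_ge_zero order_trans by blast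
      have iT: "integrable lborel (\<lambda>z. ?k z * cmod (\<phi> z - \<phi> x))"
      proof (rule Bochner_Integration.integrable_bound)
        show "integrable lborel (\<lambda>z. ?k z * (2 * B))"
          using elim by (intro integrable_mult_left integrable_kernel_scaled) auto
        show "AE z in lborel. norm (?k z * cmod (\<phi> z - \<phi> x)) \<le> norm (?k z * (2 * B))"
          using dB B0 by (intro AE_I2) (auto simp: abs_mult intro!: mult_left_mono divide_right_mono)
      qed simp_all
      have "norm (\<integral>z. (indicator ?D z * f e z) *\<^sub>R (\<phi> z - \<phi> x) \<partial>lborel) \<le> (\<integral>z. C * (?k z * cmod (\<phi> z - \<phi> x)) \<partial>lborel)"
      proof (rule Bochner_Integration.integral_norm_bound_integral)
        show i2: "integrable lborel (\<lambda>z. C * (?k z * cmod (\<phi> z - \<phi> x)))"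
          using iT by (rule integrable_mult_right)
        show le: "norm ((indicator ?D z * f e z) *\<^sub>R (\<phi> z - \<phi> x)) \<le> C * (?k z * cmod (\<phi> z - \<phi> x))" for z
        proof (cases "z \<in> ?D")
          case True
          have "\<bar>f e z\<bar> * cmod (\<phi> z - \<phi> x) \<le> (C * ?k z) * cmod (\<phi> z - \<phi> x)"
            using fb[OF _ _ True] elim by (intro mult_right_mono) auto
          then show ?thesis using True by (simp add: mult_ac)
        qed (use C0 in auto)
        show "integrable lborel (\<lambda>z. (indicator ?D z * f e z) *\<^sub>R (\<phi> z - \<phi> x))"
          by (rule Bochner_Integration.integrable_bound[OF i2])
             (measurable, intro AE_I2 order_trans[OF le], simp only: real_norm_def abs_ge_self)
      qed
      then show ?case by (simp only: integral_mult_right_zero)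
    qed
  qed
  have "((\<lambda>e. (\<integral>z. indicator ?D z * f e z \<partial>lborel) *\<^sub>R \<phi> x + (\<integral>z. (indicator ?D z * f e z) *\<^sub>R (\<phi> z - \<phi> x) \<partial>lborel))
     \<longlongrightarrow> (\<integral>u. k u \<partial>lborel) *\<^sub>R \<phi> x + 0) (at_right 0)"
    by (intro tendsto_intros mass osc)
  moreover have "eventually (\<lambda>e. (\<integral>z. indicator ?D z * f e z \<partial>lborel) *\<^sub>R \<phi> x + (\<integral>z. (indicator ?D z * f e z) *\<^sub>R (\<phi> z - \<phi> x) \<partial>lborel)
      = (\<integral>z. indicator ?D z *\<^sub>R (f e z *\<^sub>R \<phi> z) \<partial>lborel)) (at_right 0)"
    using small
  proof eventually_elim
    case (elim e)
    have i: "integrable lborel (\<lambda>z. indicator ?D z * f e z)" using ifD elim by blast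
    have i1: "integrable lborel (\<lambda>z. (indicator ?D z * f e z) *\<^sub>R \<phi> z)"
    proof (rule Bochner_Integration.integrable_bound)
      show "integrable lborel (\<lambda>z. B *\<^sub>R (indicator ?D z * f e z))" using i by simp
      have "B \<ge> 0" using B[of 0] norm_ge_zero order_trans by blast
      then show "AE z in lborel. norm ((indicator ?D z * f e z) *\<^sub>R \<phi> z) \<le> norm (B *\<^sub>R (indicator ?D z * f e z))"
        using B by (intro AE_I2) (auto simp: abs_mult mult.commute[of B] intro!: mult_left_mono)
    qed simp_all
    have i2: "integrable lborel (\<lambda>z. (indicator ?D z * f e z) *\<^sub>R \<phi> x)"
      using i by (rule integrable_scaleR_left)
    have "(\<integral>z. (indicator ?D z * f e z) *\<^sub>R (\<phi> z - \<phi> x) \<partial>lborel)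
       = (\<integral>z. (indicator ?D z * f e z) *\<^sub>R \<phi> z \<partial>lborel) - (\<integral>z. (indicator ?D z * f e z) *\<^sub>R \<phi> x \<partial>lborel)"
      using i1 i2 by (simp add: scaleR_diff_right)
    also have "(\<integral>z. (indicator ?D z * f e z) *\<^sub>R \<phi> x \<partial>lborel) = (\<integral>z. indicator ?D z * f e z \<partial>lborel) *\<^sub>R \<phi> x"
      using i by simp
    finally show ?case by simp
  qed
  ultimately show ?thesis
    by (simp add: Lim_transform_eventually)
qed

section \<open>Almost every point is a Lebesgue point\<close>

abbreviation thick_outside :: "complex set \<Rightarrow> real \<Rightarrow> complex set" where
  "thick_outside E a \<equiv> {x. x \<notin> E \<and> (\<forall>d>0. \<exists>e. 0 < e \<and> e < d \<and> measure lborel (E \<inter> ball x e) > a * e\<^sup>2)}"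

abbreviation thin_at :: "complex set \<Rightarrow> complex \<Rightarrow> bool" where
  "thin_at E x \<equiv> ((\<lambda>e. measure lborel (E \<inter> ball x e) / e\<^sup>2) \<longlongrightarrow> 0) (at_right 0)"

text \<open>The Vitali covering argument for the maximal function. Up to small measure \<open>E\<close> is a closed
  set \<open>K\<close>; a point outside \<open>E\<close> keeps a positive distance from \<open>K\<close>, so small discs around it see only
  the remainder \<open>U = E - K\<close>. Disjoint discs in which \<open>U\<close> has relative density at least \<open>a\<close> have
  total area at most a multiple of \<open>measure U / a\<close>, and their fivefold enlargements cover the
  exceptional points.\<close>

lemma density_point_exceptions_negligible:
  fixes E :: "complex set"
  assumes E: "E \<in> sets borel" "bounded E" and "a > 0"
  shows "negligible (thick_outside E a)"
    (is "negligible ?A")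
proof (subst negligible_outer_le, intro allI impI)
  fix \<eta> :: real assume "\<eta> > 0"
  (* 25 is the area factor of a fivefold enlargement in the plane *)
  define \<eta>' where "\<eta>' = \<eta> * a / (25 * pi)"
  have \<eta>': "\<eta>' > 0" using \<open>\<eta> > 0\<close> \<open>a > 0\<close> by (simp add: \<eta>'_def)
  have Elm: "E \<in> lmeasurable"
    using E by (auto intro!: bounded_set_imp_lmeasurable)
  obtain K where K: "closed K" "K \<subseteq> E" "E - K \<in> lmeasurable" "emeasure lebesgue (E - K) < ennreal \<eta>'"
    using sets_lebesgue_inner_closed[OF _ \<eta>', of E] E by (metis fmeasurableD Elm)
  define U where "U = E - K"
  have Ub: "U \<in> sets borel" using K E by (auto simp: U_def)
  have Um: "measure lebesgue U < \<eta>'"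
    using K(3,4) \<eta>' by (simp add: U_def emeasure_eq_measure2 ennreal_less_iff)
  have U_lm: "U \<in> lmeasurable" using K by (simp add: U_def)
  have sel: "\<exists>e. 0 < e \<and> e \<le> 1 \<and> cball x e \<inter> K = {} \<and> measure lborel (U \<inter> ball x e) > a * e\<^sup>2"
    if x: "x \<in> ?A" for x
  proof -
    have "x \<notin> K" using x K by auto
    then have "open (- K)" "x \<in> - K" using K by auto
    then obtain d where d: "d > 0" "cball x d \<subseteq> - K" by (meson open_contains_cball)
    obtain e where e: "0 < e" "e < min d 1" "measure lborel (E \<inter> ball x e) > a * e\<^sup>2"
      using x d(1) by (auto dest!: spec[of _ "min d 1"])
    have "cball x e \<inter> K = {}" using d e by (auto simp: subset_iff)
    moreover have "U \<inter> ball x e = E \<inter> ball x e"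
    proof -
      have "ball x e \<inter> K = {}" using calculation ball_subset_cball[of x e] by (simp add: disjoint_iff subset_iff)
      then show ?thesis unfolding U_def by auto
    qed
    ultimately show ?thesis using e by (intro exI[of _ e]) auto
  qed
  define r where "r x = (SOME e. 0 < e \<and> e \<le> 1 \<and> cball x e \<inter> K = {} \<and> measure lborel (U \<inter> ball x e) > a * e\<^sup>2)" for x
  have r: "0 < r x \<and> r x \<le> 1 \<and> cball x (r x) \<inter> K = {} \<and> measure lborel (U \<inter> ball x (r x)) > a * (r x)\<^sup>2" if "x \<in> ?A" for x
    unfolding r_def by (rule someI_ex[OF sel[OF that]])
  obtain C where C: "countable C" "C \<subseteq> ?A"
      "pairwise (\<lambda>i j. disjnt (cball i (r i)) (cball j (r j))) C"
      "\<And>i. i \<in> ?A \<Longrightarrow> \<exists>j. j \<in> C \<and> \<not> disjnt (cball i (r i)) (cball j (r j)) \<and> cball i (r i) \<subseteq> ball j (5 * r j)"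
    by (rule Vitali_covering_lemma_cballs_balls[of ?A r 1 "\<lambda>x. x"]) (use r in blast, rule that)
  define T where "T = (\<Union>j\<in>C. ball j (5 * r j))"
  have AT: "?A \<subseteq> T"
  proof
    fix x assume x: "x \<in> ?A"
    then obtain j where "j \<in> C" "cball x (r x) \<subseteq> ball j (5 * r j)" using C(4) by blast
    moreover have "x \<in> cball x (r x)" using r[OF x] by simp
    ultimately show "x \<in> T" unfolding T_def by blast
  qed
  have fin: "measure lebesgue (\<Union>j\<in>F. ball j (5 * r j)) \<le> \<eta>" if F: "finite F" "F \<subseteq> C" for F
  proof -
    have Fr: "r j > 0" "measure lborel (U \<inter> ball j (r j)) > a * (r j)\<^sup>2" if "j \<in> F" for j
      using r[of j] that F C(2) by auto
    have "measure lebesgue (\<Union>j\<in>F. ball j (5 * r j)) \<le> (\<Sum>j\<in>F. measure lebesgue (ball j (5 * r j)))"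
      by (rule measure_UNION_le) (use F in auto)
    also have "\<dots> \<le> (\<Sum>j\<in>F. 25 * pi / a * measure lebesgue (U \<inter> ball j (r j)))"
    proof (rule sum_mono)
      fix j assume j: "j \<in> F"
      have "measure lebesgue (ball j (5 * r j)) = pi * (5 * r j)\<^sup>2"
        using Fr[OF j] by (simp add: measure_def emeasure_lborel_ball_complex)
      also have "\<dots> = 25 * pi / a * (a * (r j)\<^sup>2)" using \<open>a > 0\<close> by (simp add: power_mult_distrib)
      also have "\<dots> \<le> 25 * pi / a * measure lebesgue (U \<inter> ball j (r j))"
        using Fr[OF j] \<open>a > 0\<close> Ub by (intro mult_left_mono) (auto simp: measure_def)
      finally show "measure lebesgue (ball j (5 * r j)) \<le> 25 * pi / a * measure lebesgue (U \<inter> ball j (r j))" .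
    qed
    also have "\<dots> = 25 * pi / a * (\<Sum>j\<in>F. measure lebesgue (U \<inter> ball j (r j)))"
      by (simp add: sum_distrib_left)
    also have "(\<Sum>j\<in>F. measure lebesgue (U \<inter> ball j (r j))) = measure lebesgue (\<Union>j\<in>F. U \<inter> ball j (r j))"
    proof (rule measure_UNION'[symmetric])
      show "\<And>j. j \<in> F \<Longrightarrow> U \<inter> ball j (r j) \<in> lmeasurable"
        using U_lm by (auto intro: fmeasurable_Int_fmeasurable)
      show "pairwise (\<lambda>i j. disjnt (U \<inter> ball i (r i)) (U \<inter> ball j (r j))) F"
        using C(3) F(2) unfolding pairwise_def disjnt_iff by (meson IntE ball_subset_cball subset_iff)
    qed (use F in auto)
    also have "25 * pi / a * measure lebesgue (\<Union>j\<in>F. U \<inter> ball j (r j)) \<le> 25 * pi / a * measure lebesgue U"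
      using U_lm F \<open>a > 0\<close> by (intro mult_left_mono measure_mono_fmeasurable) (auto intro!: sets.finite_UN fmeasurableD fmeasurable_Int_fmeasurable)
    also have "25 * pi / a * measure lebesgue U \<le> 25 * pi / a * \<eta>'"
      using Um \<open>a > 0\<close> by (intro mult_left_mono) auto
    also have "\<dots> = \<eta>" using \<open>a > 0\<close> by (simp add: \<eta>'_def)
    finally show ?thesis .
  qed
  have "T \<in> lmeasurable \<and> measure lebesgue T \<le> \<eta>"
    unfolding T_def
    using fmeasurable_UN_bound[OF C(1), of "\<lambda>j. ball j (5 * r j)" lebesgue \<eta>] 
      measure_UN_bound[OF C(1), of "\<lambda>j. ball j (5 * r j)" lebesgue \<eta>] fin
    by auto
  with AT show "\<exists>T. ?A \<subseteq> T \<and> T \<in> lmeasurable \<and> measure lebesgue T \<le> \<eta>" by blast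
qed


lemma AE_lborel_not_in_negligible:
  assumes "negligible (A :: 'a::euclidean_space set)"
  shows "AE x in lborel. x \<notin> A"
proof -
  have "A \<in> null_sets lebesgue" using assms by (simp add: negligible_iff_null_sets)
  then have "AE x in lebesgue. x \<notin> A" by (rule AE_not_in)
  then show ?thesis by (simp add: AE_completion_iff)
qed

lemma AE_density_zero_outside_bounded:
  fixes E :: "complex set"
  assumes E: "E \<in> sets borel" "bounded E"
  shows "AE x in lborel. x \<notin> E \<longrightarrow> thin_at E x"
proof -
  let ?A = "\<lambda>a. (thick_outside E a)"
  have "AE x in lborel. \<forall>m::nat. x \<notin> ?A (1 / Suc m)"
    by (subst AE_all_countable, intro allI AE_lborel_not_in_negligible
        density_point_exceptions_negligible E) auto
  then show ?thesis
  proof (rule AE_mp, intro AE_I2 impI)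
    fix x assume x: "\<forall>m::nat. x \<notin> ?A (1 / Suc m)" "x \<notin> E"
    show "thin_at E x"
    proof (rule tendstoI)
      fix \<eta> :: real assume "\<eta> > 0"
      obtain m :: nat where m: "1 / Suc m < \<eta>"
        using nat_approx_posE[OF \<open>\<eta> > 0\<close>] .
      obtain d where d: "d > 0" "\<And>e. 0 < e \<Longrightarrow> e < d \<Longrightarrow> measure lborel (E \<inter> ball x e) \<le> 1 / Suc m * e\<^sup>2"
      proof -
        have "\<not> (\<forall>d>0. \<exists>e. 0 < e \<and> e < d \<and> measure lborel (E \<inter> ball x e) > 1 / Suc m * e\<^sup>2)"
          using x by blast
        then show ?thesis using that by (meson not_less)
      qed
      have "eventually (\<lambda>e. 0 < e \<and> e < d) (at_right 0)"
        using d(1) eventually_at_right by blast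
      then show "eventually (\<lambda>e. dist (measure lborel (E \<inter> ball x e) / e\<^sup>2) 0 < \<eta>) (at_right 0)"
      proof eventually_elim
        case (elim e)
        then have "measure lborel (E \<inter> ball x e) \<le> 1 / Suc m * e\<^sup>2" "0 < e\<^sup>2"
          using d(2)[of e] by auto
        then have "measure lborel (E \<inter> ball x e) / e\<^sup>2 \<le> 1 / Suc m"
          by (simp only: pos_divide_le_eq)
        moreover have "0 \<le> measure lborel (E \<inter> ball x e) / e\<^sup>2" by simp
        ultimately show ?case using m unfolding dist_real_def by linarith
      qed
    qed
  qed
qed

text \<open>Density is a local property, so the bounded case applies to the intersections with an exhausting
  sequence of discs.\<close>

lemma AE_density_zero_outside:
  fixes E :: "complex set"
  assumes E: "E \<in> sets borel"
  shows "AE x in lborel. x \<notin> E \<longrightarrow> thin_at E x"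
proof -
  have "AE x in lborel. \<forall>n::nat. x \<notin> E \<inter> ball 0 (real n) \<longrightarrow>
     thin_at (E \<inter> ball 0 (real n)) x"
    by (subst AE_all_countable, intro allI AE_density_zero_outside_bounded)
       (use E in auto)
  then show ?thesis
  proof (rule AE_mp, intro AE_I2 impI)
    fix x assume H: "\<forall>n::nat. x \<notin> E \<inter> ball 0 (real n) \<longrightarrow>
     thin_at (E \<inter> ball 0 (real n)) x" and x: "x \<notin> E"
    obtain n :: nat where n: "cmod x < real n" using reals_Archimedean2 by blast
    then have "x \<in> ball 0 (real n)" by simp
    then obtain d where d: "d > 0" "ball x d \<subseteq> ball 0 (real n)"
      by (meson open_ball open_contains_ball)
    have "eventually (\<lambda>e. 0 < e \<and> e < d) (at_right 0)"
      using d(1) eventually_at_right by blast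
    then have "eventually (\<lambda>e. measure lborel (E \<inter> ball 0 (real n) \<inter> ball x e) / e\<^sup>2 = measure lborel (E \<inter> ball x e) / e\<^sup>2) (at_right 0)"
    proof eventually_elim
      case (elim e)
      then have "ball x e \<subseteq> ball 0 (real n)" using d(2) by (meson less_imp_le order_trans subset_ball)
      then have "E \<inter> ball 0 (real n) \<inter> ball x e = E \<inter> ball x e" by blast
      then show ?case by simp
    qed
    moreover have "thin_at (E \<inter> ball 0 (real n)) x"
      using H[rule_format, of n] x by simp
    ultimately show "thin_at E x"
      by (rule Lim_transform_eventually[rotated])
  qed
qed

text \<open>For bounded \<open>\<phi>\<close>, a small set \<open>E\<close> on which \<open>\<phi>\<close> may differ much from \<open>\<phi> x\<close> contributes at most
  \<open>2 B\<close> times its measure.\<close>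

lemma oscillation_average_le:
  fixes \<phi> :: "complex \<Rightarrow> complex"
  assumes m[measurable]: "\<phi> \<in> borel_measurable borel" and B: "\<And>z. cmod (\<phi> z) \<le> B"
    and E: "E \<in> sets borel" and s: "s \<ge> 0" "\<And>z. z \<notin> E \<Longrightarrow> z \<in> ball x e \<Longrightarrow> cmod (\<phi> z - \<phi> x) \<le> s" and e: "e > 0"
  shows "mean_oscillation \<phi> x e
     \<le> s * pi + 2 * B * (measure lborel (E \<inter> ball x e) / e\<^sup>2)"
proof -
  have B0: "B \<ge> 0" using B[of 0] norm_ge_zero order_trans by blast
  have dB: "cmod (\<phi> z - \<phi> x) \<le> 2 * B" for z
    using B[of z] B[of x] norm_triangle_ineq4[of "\<phi> z" "\<phi> x"] by linarith
  have fin: "emeasure lborel (ball x e) < \<infinity>" "emeasure lborel (E \<inter> ball x e) < \<infinity>"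
  proof -
    show 1: "emeasure lborel (ball x e) < \<infinity>" by (intro emeasure_bounded_finite bounded_ball)
    have "emeasure lborel (E \<inter> ball x e) \<le> emeasure lborel (ball x e)"
      by (rule emeasure_mono) auto
    then show "emeasure lborel (E \<inter> ball x e) < \<infinity>" using 1 by (rule le_less_trans)
  qed
  have i1: "integrable lborel (\<lambda>z. s * indicator (ball x e) z)"
    using fin by (intro integrable_mult_right integrable_real_indicator) auto
  have i2: "integrable lborel (\<lambda>z. 2 * B * indicator (E \<inter> ball x e) z)"
    using fin E by (intro integrable_mult_right integrable_real_indicator) auto
  have le: "indicator (ball x e) z * cmod (\<phi> z - \<phi> x) \<le> s * indicator (ball x e) z + 2 * B * indicator (E \<inter> ball x e) z" for z
    using s(2)[of z] dB[of z] s(1) B0 by (auto simp: indicator_def)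
  have "(\<integral>z. indicator (ball x e) z * cmod (\<phi> z - \<phi> x) \<partial>lborel)
      \<le> (\<integral>z. s * indicator (ball x e) z + 2 * B * indicator (E \<inter> ball x e) z \<partial>lborel)"
  proof (rule integral_mono)
    show "integrable lborel (\<lambda>z. indicator (ball x e) z * cmod (\<phi> z - \<phi> x))"
    proof (rule Bochner_Integration.integrable_bound)
      show "integrable lborel (\<lambda>z. s * indicator (ball x e) z + 2 * B * indicator (E \<inter> ball x e) z)"
        using i1 i2 by (rule Bochner_Integration.integrable_add)
      show "AE z in lborel. norm (indicator (ball x e) z * cmod (\<phi> z - \<phi> x)) \<le> norm (s * indicator (ball x e) z + 2 * B * indicator (E \<inter> ball x e) z)"
        using s(1) B0 by (intro AE_I2) (simp add: abs_of_nonneg, rule le)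
    qed (simp, intro borel_measurable_times borel_measurable_indicator borel_measurable_norm borel_measurable_diff m, simp_all)
  qed (use i1 i2 le in auto)
  also have "\<dots> = s * measure lborel (ball x e) + 2 * B * measure lborel (E \<inter> ball x e)"
    using i1 i2 E by (subst Bochner_Integration.integral_add) auto
  also have "measure lborel (ball x e) = pi * e\<^sup>2"
    using e by (simp add: measure_def emeasure_lborel_ball_complex)
  finally have "mean_oscillation \<phi> x e
     \<le> (s * (pi * e\<^sup>2) + 2 * B * measure lborel (E \<inter> ball x e)) / e\<^sup>2"
    by (rule divide_right_mono) simp
  then show ?thesis using e by (simp add: add_divide_distrib)
qed

lemma oscillation_average_nonneg: "0 \<le> mean_oscillation \<phi> x e"
  by (intro divide_nonneg_nonneg integral_nonneg_AE) auto

lemma isCont_imp_lebesgue_point: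
  assumes m[measurable]: "\<phi> \<in> borel_measurable borel" and B: "\<And>z. cmod (\<phi> z) \<le> B" and c: "isCont \<phi> x"
  shows "lebesgue_point \<phi> x"
  unfolding lebesgue_point_def
proof (rule tendstoI)
  fix \<eta> :: real assume "\<eta> > 0"
  then have "\<eta> / (2 * pi) > 0" by simp
  then obtain d where d: "d > 0" "\<And>z. dist z x < d \<Longrightarrow> dist (\<phi> z) (\<phi> x) < \<eta> / (2 * pi)"
    using c unfolding continuous_at_eps_delta by blast
  have "eventually (\<lambda>e. 0 < e \<and> e < d) (at_right 0)"
    using d(1) eventually_at_right by blast
  then show "eventually (\<lambda>e. dist (mean_oscillation \<phi> x e) 0 < \<eta>) (at_right 0)"
  proof eventually_elim
    case (elim e)
    have "mean_oscillation \<phi> x e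
     \<le> \<eta> / (2 * pi) * pi + 2 * B * (measure lborel ({} \<inter> ball x e) / e\<^sup>2)"
    proof (rule oscillation_average_le[OF m B])
      fix z assume "z \<in> ball x e"
      then show "cmod (\<phi> z - \<phi> x) \<le> \<eta> / (2 * pi)"
        using d(2)[of z] elim by (simp add: dist_norm norm_minus_commute)
    qed (use elim \<open>\<eta> > 0\<close> in auto)
    also have "\<dots> < \<eta>" using \<open>\<eta> > 0\<close> by simp
    finally show ?case using oscillation_average_nonneg[of x e \<phi>] by (simp add: dist_real_def)
  qed
qed

text \<open>For \<open>q\<close> in a countable dense set and \<open>k\<close> a natural number let \<open>E q k\<close> be the set where \<open>\<phi>\<close> is
  at least \<open>1 / Suc k\<close> away from \<open>q\<close>. Outside a null set every point that avoids some \<open>E q k\<close> sees it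
  with density zero, and every point avoids \<open>E q k\<close> once \<open>q\<close> is close to the value of \<open>\<phi>\<close> there.\<close>

lemma AE_lebesgue_point:
  assumes m[measurable]: "\<phi> \<in> borel_measurable borel" and B: "\<And>z. cmod (\<phi> z) \<le> B"
  shows "AE x in lborel. lebesgue_point \<phi> x"
proof -
  obtain Q :: "complex set" where Q: "countable Q" "\<And>X. open X \<Longrightarrow> X \<noteq> {} \<Longrightarrow> \<exists>q\<in>Q. q \<in> X"
    using countable_dense_setE by blast
  define E where "E q k = {z. cmod (\<phi> z - q) \<ge> 1 / Suc k}" for q and k :: nat
  have E: "E q k \<in> sets borel" for q k unfolding E_def by measurable
  have B0: "B \<ge> 0" using B[of 0] norm_ge_zero order_trans by blast
  have "AE x in lborel. \<forall>q\<in>Q. \<forall>k. x \<notin> E q k \<longrightarrow> thin_at (E q k) x"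
    by (subst AE_ball_countable[OF Q(1)], intro ballI, subst AE_all_countable, intro allI AE_density_zero_outside E)
  then show ?thesis
  proof (rule AE_mp, intro AE_I2 impI)
    fix x assume x: "\<forall>q\<in>Q. \<forall>k. x \<notin> E q k \<longrightarrow> thin_at (E q k) x"
    show "lebesgue_point \<phi> x"
      unfolding lebesgue_point_def
    proof (rule tendstoI)
      fix \<eta> :: real assume \<eta>: "\<eta> > 0"
      then have "\<eta> / (4 * pi) > 0" by simp
      have "\<eta> / (4 * pi) = \<eta> / (2 * pi) / 2" by simp
      obtain k :: nat where k: "1 / Suc k < \<eta> / (4 * pi)"
        using nat_approx_posE[OF \<open>\<eta> / (4 * pi) > 0\<close>] .
      obtain q where q: "q \<in> Q" "q \<in> ball (\<phi> x) (1 / Suc k)"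
        using Q(2)[of "ball (\<phi> x) (1 / Suc k)"] by (auto simp del: of_nat_Suc mem_ball)
      then have qx: "cmod (\<phi> x - q) < 1 / Suc k" by (simp add: dist_norm)
      then have "x \<notin> E q k" by (simp add: E_def)
      with x q have "thin_at (E q k) x" by blast
      then have "((\<lambda>e. 2 * B * (measure lborel (E q k \<inter> ball x e) / e\<^sup>2)) \<longlongrightarrow> 2 * B * 0) (at_right 0)"
        by (intro tendsto_mult_left)
      then have "eventually (\<lambda>e. 2 * B * (measure lborel (E q k \<inter> ball x e) / e\<^sup>2) < \<eta> / 2) (at_right 0)"
        using \<eta> by (intro order_tendstoD(2)[where a="\<eta>/2"]) auto
      moreover have "eventually (\<lambda>e::real. e > 0) (at_right 0)"
        by (simp add: eventually_at_right_less)
      ultimately show "eventually (\<lambda>e. dist (mean_oscillation \<phi> x e) 0 < \<eta>) (at_right 0)"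
      proof eventually_elim
        case (elim e)
        have "mean_oscillation \<phi> x e
            \<le> (\<eta> / (2 * pi)) * pi + 2 * B * (measure lborel (E q k \<inter> ball x e) / e\<^sup>2)"
        proof (rule oscillation_average_le[OF m B E])
          fix z assume "z \<notin> E q k"
          then have "cmod (\<phi> z - q) < 1 / Suc k" by (simp add: E_def)
          moreover have "cmod (\<phi> z - \<phi> x) \<le> cmod (\<phi> z - q) + cmod (\<phi> x - q)"
            using norm_triangle_ineq4[of "\<phi> z - q" "\<phi> x - q"] by simp
          ultimately show "cmod (\<phi> z - \<phi> x) \<le> \<eta> / (2 * pi)"
            using qx k \<open>\<eta> / (4 * pi) = \<eta> / (2 * pi) / 2\<close> by linarith
        qed (use elim \<eta> in auto)
        also have "\<dots> < \<eta>" using elim by simp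
        finally show ?case using oscillation_average_nonneg[of x e \<phi>] by (simp add: dist_real_def)
      qed
    qed
  qed
qed

section \<open>Densities that concentrate at finitely many points\<close>

text \<open>The common form of both families of densities, with \<open>e\<close> in the role of \<open>|w|\<close>. The poles are the
  zeros of \<open>p (z, 0)\<close>.\<close>

abbreviation pole_density :: "(complex \<times> real \<Rightarrow> real) \<Rightarrow> (complex \<times> real \<Rightarrow> real) \<Rightarrow> real \<Rightarrow> complex \<Rightarrow> real" where
  "pole_density h p e z \<equiv> e\<^sup>2 * h (z, e\<^sup>2) / (p (z, e\<^sup>2))\<^sup>2"

abbreviation quadratic_bound :: "(complex \<times> real \<Rightarrow> real) \<Rightarrow> complex \<Rightarrow> real \<Rightarrow> real \<Rightarrow> bool" where
  "quadratic_bound p x c d \<equiv>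
     \<forall>z\<in>ball x d. \<forall>r. 0 < r \<and> r < d \<longrightarrow> p (z, r) \<ge> c * ((cmod (z - x))\<^sup>2 + r)"

lemma concentration_off_poles:
  fixes p h :: "complex \<times> real \<Rightarrow> real" and \<phi> :: "complex \<Rightarrow> complex"
  assumes pc: "continuous_on (UNIV \<times> {0..}) p" and hc: "continuous_on (UNIV \<times> {0..}) h"
    and K: "compact K" "\<And>z r. z \<in> K \<Longrightarrow> r \<ge> 0 \<Longrightarrow> p (z, r) > 0"
    and m[measurable]: "\<phi> \<in> borel_measurable borel" and B: "\<And>z. cmod (\<phi> z) \<le> B"
    and fi: "\<And>e. e > 0 \<Longrightarrow> integrable lborel (\<lambda>z. indicator K z *\<^sub>R ((pole_density h p e z) *\<^sub>R \<phi> z))"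
  shows "((\<lambda>e. \<integral>z. indicator K z *\<^sub>R ((pole_density h p e z) *\<^sub>R \<phi> z) \<partial>lborel) \<longlongrightarrow> 0) (at_right 0)"
proof -
  have B0: "B \<ge> 0" using B[of 0] norm_ge_zero order_trans by blast
  have sub: "K \<times> {0..1} \<subseteq> UNIV \<times> {0::real..}" by auto
  have "continuous_on (K \<times> {0..1}) (\<lambda>x. h x / (p x)\<^sup>2)"
    using K(2) by (intro continuous_intros continuous_on_subset[OF pc sub] continuous_on_subset[OF hc sub]) force
  then have "compact ((\<lambda>x. h x / (p x)\<^sup>2) ` (K \<times> {0..1}))"
    by (intro compact_continuous_image compact_Times K) auto
  then obtain H where H: "\<forall>y\<in>(\<lambda>x. h x / (p x)\<^sup>2) ` (K \<times> {0..1}). norm y \<le> H"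
    using compact_imp_bounded bounded_iff by metis
  have Hb: "\<bar>h (z, r) / (p (z, r))\<^sup>2\<bar> \<le> H" if "z \<in> K" "0 \<le> r" "r \<le> 1" for z r
    using H that by auto
  have Km: "K \<in> sets borel" "emeasure lborel K < \<infinity>"
    using K(1) by (auto intro!: borel_closed compact_imp_closed emeasure_compact_finite simp del: infinity_ennreal_def)
  show ?thesis
  proof (rule Lim_null_comparison)
    show "((\<lambda>e. e\<^sup>2 * (\<bar>H\<bar> * B * measure lborel K)) \<longlongrightarrow> 0) (at_right 0)"
      by (rule tendsto_eq_intros tendsto_ident_at refl | simp)+
    have "eventually (\<lambda>e::real. 0 < e \<and> e < 1) (at_right 0)"
      using eventually_at_right_real[of 0 1] by simp
    then show "eventually (\<lambda>e. norm (\<integral>z. indicator K z *\<^sub>R ((pole_density h p e z) *\<^sub>R \<phi> z) \<partial>lborel)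
        \<le> e\<^sup>2 * (\<bar>H\<bar> * B * measure lborel K)) (at_right 0)"
    proof eventually_elim
      case (elim e)
      have e1: "e\<^sup>2 \<le> 1" using elim by (simp add: power_le_one)
      have "norm (\<integral>z. indicator K z *\<^sub>R ((pole_density h p e z) *\<^sub>R \<phi> z) \<partial>lborel)
         \<le> (\<integral>z. e\<^sup>2 * \<bar>H\<bar> * B * indicator K z \<partial>lborel)"
      proof (rule Bochner_Integration.integral_norm_bound_integral[OF fi])
        show "integrable lborel (\<lambda>z. e\<^sup>2 * \<bar>H\<bar> * B * indicator K z)"
          using Km by (intro integrable_mult_right integrable_real_indicator) auto
        fix z :: complex
        show "norm (indicator K z *\<^sub>R ((pole_density h p e z) *\<^sub>R \<phi> z)) \<le> e\<^sup>2 * \<bar>H\<bar> * B * indicator K z"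
        proof (cases "z \<in> K")
          case True
          have "\<bar>h (z, e\<^sup>2) / (p (z, e\<^sup>2))\<^sup>2\<bar> \<le> \<bar>H\<bar>"
            using Hb[OF True _ e1] by simp
          then have "e\<^sup>2 * \<bar>h (z, e\<^sup>2) / (p (z, e\<^sup>2))\<^sup>2\<bar> * cmod (\<phi> z) \<le> e\<^sup>2 * \<bar>H\<bar> * B"
            using B[of z] B0 by (intro mult_mono) auto
          then show ?thesis using True by (simp add: abs_mult)
        qed simp
      qed (use elim in auto)
      also have "\<dots> = e\<^sup>2 * (\<bar>H\<bar> * B * measure lborel K)"
        using Km by simp
      finally show ?case .
    qed
  qed
qed

text \<open>The lower bound on \<open>p\<close> dominates the density by the kernel, and the limit of
  \<open>p (x + e u, e\<^sup>2) / e\<^sup>2\<close> identifies the rescaled profile as \<open>h (x, 0) / (a |u|\<^sup>2 + b)\<^sup>2\<close>.\<close>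

lemma concentration_at_pole:
  fixes p h :: "complex \<times> real \<Rightarrow> real" and \<phi> :: "complex \<Rightarrow> complex"
  assumes hc: "continuous_on (UNIV \<times> {0..}) h"
    and m[measurable]: "\<phi> \<in> borel_measurable borel" and B: "\<And>z. cmod (\<phi> z) \<le> B"
    and lp: "lebesgue_point \<phi> x"
    and d: "d > 0" and c: "c > 0" "\<And>z r. z \<in> ball x d \<Longrightarrow> 0 < r \<Longrightarrow> r < d \<Longrightarrow> p (z, r) \<ge> c * ((cmod (z - x))\<^sup>2 + r)"
    and ab: "a > 0" "b > 0" "\<And>u. ((\<lambda>e. p (x + e *\<^sub>R u, e\<^sup>2) / e\<^sup>2) \<longlongrightarrow> a * (cmod u)\<^sup>2 + b) (at_right 0)"
    and fm: "\<And>e. (\<lambda>z. pole_density h p e z) \<in> borel_measurable borel"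
  shows "((\<lambda>e. \<integral>z. indicator (ball x d) z *\<^sub>R ((pole_density h p e z) *\<^sub>R \<phi> z) \<partial>lborel)
      \<longlongrightarrow> (h (x, 0) * pi / (a * b)) *\<^sub>R \<phi> x) (at_right 0)"
proof -
  have "compact (h ` (cball x d \<times> {0..1}))"
    by (intro compact_continuous_image compact_Times continuous_on_subset[OF hc]) auto
  then obtain H where "\<forall>y\<in>h ` (cball x d \<times> {0..1}). norm y \<le> H"
    using compact_imp_bounded bounded_iff by metis
  then have Hb: "\<bar>h (z, r)\<bar> \<le> H" if "z \<in> ball x d" "0 \<le> r" "r \<le> 1" for z r
    using that by auto
  define e0 where "e0 = min 1 d"
  have e0: "e0 > 0" "e0 \<le> 1" "e0 \<le> d" using d by (auto simp: e0_def)
  have esq: "e\<^sup>2 < e0" "e\<^sup>2 \<le> 1" "0 < e\<^sup>2" if "0 < e" "e < e0" for e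
  proof -
    have "e * e < e0 * 1" using that e0 by (intro mult_strict_mono) auto
    then show "e\<^sup>2 < e0" by (simp add: power2_eq_square)
    then show "e\<^sup>2 \<le> 1" using e0 by simp
    show "0 < e\<^sup>2" using that by simp
  qed
  let ?f = "\<lambda>e z. pole_density h p e z"
  let ?k = "\<lambda>u::complex. h (x, 0) * (1 / (a * (cmod u)\<^sup>2 + b)\<^sup>2)"
  have "((\<lambda>e. \<integral>z. indicator (ball x d) z *\<^sub>R (?f e z *\<^sub>R \<phi> z) \<partial>lborel)
           \<longlongrightarrow> (\<integral>u. ?k u \<partial>lborel) *\<^sub>R \<phi> x) (at_right 0)"
  proof (rule approximate_identity_at_lebesgue_point[OF m B lp d e0(1) fm])
    fix e z assume e: "0 < e" "e < e0" and z: "z \<in> ball x d"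
    let ?s = "(cmod (z - x))\<^sup>2 + e\<^sup>2"
    have s: "?s > 0" using e by (simp add: add_nonneg_pos)
    have "c * ?s \<le> p (z, e\<^sup>2)" using c(2)[OF z, of "e\<^sup>2"] esq[OF e] e0 by auto
    then have p2: "(c * ?s)\<^sup>2 \<le> (p (z, e\<^sup>2))\<^sup>2" using c(1) s by (intro power_mono) auto
    have "\<bar>?f e z\<bar> = e\<^sup>2 * \<bar>h (z, e\<^sup>2)\<bar> / (p (z, e\<^sup>2))\<^sup>2" by (simp add: abs_mult)
    also have "\<dots> \<le> e\<^sup>2 * H / (c * ?s)\<^sup>2"
      using Hb[OF z, of "e\<^sup>2"] esq[OF e] p2 c(1) s
      by (intro frac_le mult_left_mono mult_nonneg_nonneg) (auto intro: order_trans[OF abs_ge_zero])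
    also have "\<dots> = H / c\<^sup>2 * (e\<^sup>2 / ?s\<^sup>2)" by (simp add: power_mult_distrib)
    finally show "\<bar>?f e z\<bar> \<le> H / c\<^sup>2 * (e\<^sup>2 / ?s\<^sup>2)" .
  next
    fix u :: complex
    have pos: "a * (cmod u)\<^sup>2 + b > 0" using ab by (simp add: add_nonneg_pos)
    have lim: "((\<lambda>e::real. (x + e *\<^sub>R u, e\<^sup>2)) \<longlongrightarrow> (x + 0 *\<^sub>R u, 0\<^sup>2)) (at_right 0)"
      by (intro tendsto_intros)
    have "((\<lambda>e. h (x + e *\<^sub>R u, e\<^sup>2)) \<longlongrightarrow> h (x, 0)) (at_right 0)"
      using continuous_on_tendsto_compose[OF hc lim] by simp
    then have "((\<lambda>e. h (x + e *\<^sub>R u, e\<^sup>2) / (p (x + e *\<^sub>R u, e\<^sup>2) / e\<^sup>2)\<^sup>2) \<longlongrightarrow> h (x, 0) / (a * (cmod u)\<^sup>2 + b)\<^sup>2) (at_right 0)"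
      using pos by (intro tendsto_intros ab(3)) auto
    moreover have "eventually (\<lambda>e. h (x + e *\<^sub>R u, e\<^sup>2) / (p (x + e *\<^sub>R u, e\<^sup>2) / e\<^sup>2)\<^sup>2 = e\<^sup>2 * ?f e (x + e *\<^sub>R u)) (at_right 0)"
      using eventually_at_right_less[of 0]
      by eventually_elim (simp add: power_divide power2_eq_square)
    ultimately have "((\<lambda>e. e\<^sup>2 * ?f e (x + e *\<^sub>R u)) \<longlongrightarrow> h (x, 0) / (a * (cmod u)\<^sup>2 + b)\<^sup>2) (at_right 0)"
      by (rule Lim_transform_eventually)
    then show "((\<lambda>e. e\<^sup>2 * ?f e (x + e *\<^sub>R u)) \<longlongrightarrow> ?k u) (at_right 0)" by simp
  qed measurable
  also have "(\<integral>u. ?k u \<partial>lborel) = h (x, 0) * pi / (a * b)"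
    by (simp only: integral_mult_right_zero integral_kernel[OF ab(1,2)]) simp
  finally show ?thesis .
qed

lemma eventually_disjoint_balls:
  fixes S :: "'a::metric_space set"
  assumes "finite S"
  shows "eventually (\<lambda>d. \<forall>x\<in>S. \<forall>y\<in>S. x \<noteq> y \<longrightarrow> ball x d \<inter> ball y d = {}) (at_right 0)"
proof (intro eventually_ball_finite assms ballI)
  fix x y assume "x \<in> S" "y \<in> S"
  show "eventually (\<lambda>d. x \<noteq> y \<longrightarrow> ball x d \<inter> ball y d = {}) (at_right 0)"
  proof (cases "x = y")
    case False
    then have "dist x y / 2 > 0" by simp
    then have "eventually (\<lambda>d. 0 < d \<and> d < dist x y / 2) (at_right 0)"
      using eventually_at_right by blast
    then show ?thesis
      by eventually_elim (intro impI disjoint_ballI, linarith)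
  qed simp
qed

text \<open>Around the poles choose disjoint discs that are small enough for the lower bounds. Each disc
  contributes its own limit, and the rest of the support of \<open>\<phi>\<close> contributes nothing in the limit.\<close>

theorem concentration_at_poles:
  fixes p h :: "complex \<times> real \<Rightarrow> real" and \<phi> :: "complex \<Rightarrow> complex"
  assumes pc: "continuous_on (UNIV \<times> {0..}) p" and hc: "continuous_on (UNIV \<times> {0..}) h"
    and ppos: "\<And>z r. r > 0 \<Longrightarrow> p (z, r) > 0" and S: "finite S" "\<And>z. z \<notin> S \<Longrightarrow> p (z, 0) > 0"
    and near: "\<And>x. x \<in> S \<Longrightarrow> \<exists>c>0. \<exists>d>0. quadratic_bound p x c d"
    and ab: "\<And>x. x \<in> S \<Longrightarrow> a x > 0" "\<And>x. x \<in> S \<Longrightarrow> b x > 0"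
        "\<And>x u. x \<in> S \<Longrightarrow> ((\<lambda>e. p (x + e *\<^sub>R u, e\<^sup>2) / e\<^sup>2) \<longlongrightarrow> a x * (cmod u)\<^sup>2 + b x) (at_right 0)"
    and phi: "\<phi> \<in> B_c" and lp: "\<And>x. x \<in> S \<Longrightarrow> lebesgue_point \<phi> x"
  shows "((\<lambda>e. \<integral>z. (pole_density h p e z) *\<^sub>R \<phi> z \<partial>lborel)
      \<longlongrightarrow> (\<Sum>x\<in>S. (h (x, 0) * pi / (a x * b x)) *\<^sub>R \<phi> x)) (at_right 0)"
proof -
  let ?f = "\<lambda>e z. pole_density h p e z"
  have m[measurable]: "\<phi> \<in> borel_measurable borel" using phi by (simp add: B_c_def)
  obtain B where B: "\<And>z. cmod (\<phi> z) \<le> B"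
    using phi unfolding B_c_def bounded_iff by auto
  have B0: "B \<ge> 0" using B[of 0] norm_ge_zero order_trans by blast
  define K where "K = closure {z. \<phi> z \<noteq> 0}"
  have K: "compact K" using phi by (simp add: B_c_def K_def)
  have \<phi>K: "\<phi> z = 0" if "z \<notin> K" for z
    using that closure_subset[of "{z. \<phi> z \<noteq> 0}"] by (auto simp: K_def)
  have fcont: "continuous_on UNIV (?f e)" for e
  proof (cases "e = 0")
    case False
    then have pos: "p (z, e\<^sup>2) > 0" for z by (intro ppos) simp
    have "continuous_on UNIV (\<lambda>z. p (z, e\<^sup>2))" "continuous_on UNIV (\<lambda>z. h (z, e\<^sup>2))"
      by (auto intro!: continuous_on_compose2[OF pc] continuous_on_compose2[OF hc] continuous_intros)
    then show ?thesis using pos by (intro continuous_intros) (auto simp: less_imp_neq[OF pos, symmetric])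
  qed simp
  have fm[measurable]: "?f e \<in> borel_measurable borel" for e
    by (rule borel_measurable_continuous_onI[OF fcont])
  have fint: "integrable lborel (\<lambda>z. indicator A z *\<^sub>R (?f e z *\<^sub>R \<phi> z))" if A[measurable]: "A \<in> sets borel" for A e
  proof -
    have "compact (?f e ` K)" by (intro compact_continuous_image K continuous_on_subset[OF fcont]) simp
    from compact_imp_bounded[OF this] obtain F where F: "\<forall>y\<in>?f e ` K. norm y \<le> F"
      unfolding bounded_iff by (elim exE)
    show ?thesis
    proof (rule Bochner_Integration.integrable_bound)
      have "K \<in> sets borel" using K by (auto intro!: borel_closed compact_imp_closed)
      then show "integrable lborel (\<lambda>z. \<bar>F\<bar> * B * indicator K z)"
        using emeasure_compact_finite[OF K] by (intro integrable_mult_right integrable_real_indicator) auto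
      have "norm (indicator A z *\<^sub>R (?f e z *\<^sub>R \<phi> z)) \<le> norm (\<bar>F\<bar> * B * indicator K z)" for z
      proof (cases "z \<in> K")
        case True
        then have "\<bar>?f e z\<bar> \<le> \<bar>F\<bar>" using F by force
        then have "\<bar>?f e z\<bar> * cmod (\<phi> z) \<le> \<bar>F\<bar> * B" using B[of z] B0 by (intro mult_mono) auto
        moreover have "norm (indicator A z *\<^sub>R (?f e z *\<^sub>R \<phi> z)) \<le> \<bar>?f e z\<bar> * cmod (\<phi> z)"
          by (auto simp: indicator_def)
        ultimately show ?thesis using True B0 by (simp add: abs_mult del: abs_divide)
      qed (simp add: \<phi>K)
      then show "AE z in lborel. norm (indicator A z *\<^sub>R (?f e z *\<^sub>R \<phi> z)) \<le> norm (\<bar>F\<bar> * B * indicator K z)"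
        by simp
    qed measurable
  qed
  have "eventually (\<lambda>d. \<forall>x\<in>S. \<exists>c>0. quadratic_bound p x c d) (at_right 0)"
  proof (intro eventually_ball_finite S(1) ballI)
    fix x assume "x \<in> S"
    then obtain c d where cd: "c > 0" "d > 0" "quadratic_bound p x c d"
      using near by meson
    have "eventually (\<lambda>d'. 0 < d' \<and> d' < d) (at_right 0)"
      using cd(2) eventually_at_right by blast
    then show "eventually (\<lambda>d. \<exists>c>0. quadratic_bound p x c d) (at_right 0)"
    proof eventually_elim
      case (elim d')
      show ?case
        by (rule exI[of _ c], intro conjI cd(1) ballI allI impI, rule cd(3)[rule_format]) (use elim in auto)
    qed
  qed
  then have "eventually (\<lambda>d. d > 0 \<and> (\<forall>x\<in>S. \<exists>c>0. quadratic_bound p x c d)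
       \<and> (\<forall>x\<in>S. \<forall>y\<in>S. x \<noteq> y \<longrightarrow> ball x d \<inter> ball y d = {})) (at_right 0)"
    using eventually_disjoint_balls[OF S(1)] eventually_at_right_less[of "0::real"] by eventually_elim simp
  then obtain d where d: "d > 0"
      "\<And>x. x \<in> S \<Longrightarrow> \<exists>c>0. quadratic_bound p x c d"
      "\<And>x y. x \<in> S \<Longrightarrow> y \<in> S \<Longrightarrow> x \<noteq> y \<Longrightarrow> ball x d \<inter> ball y d = {}"
    using eventually_happens[of _ "at_right (0::real)"] by force
  define U where "U = K - (\<Union>x\<in>S. ball x d)"
  have U: "compact U" unfolding U_def by (intro compact_diff K open_UN ballI open_ball)
  have Um: "U \<in> sets borel" using U by (auto intro!: borel_closed compact_imp_closed)
  have Upos: "p (z, r) > 0" if "z \<in> U" "r \<ge> 0" for z r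
  proof (cases "r = 0")
    case True
    have "z \<notin> S" using that(1) d(1) by (auto simp: U_def)
    then show ?thesis using S(2) True by simp
  qed (use that ppos in auto)
  have "((\<lambda>e. (\<Sum>x\<in>S. \<integral>z. indicator (ball x d) z *\<^sub>R (?f e z *\<^sub>R \<phi> z) \<partial>lborel) + (\<integral>z. indicator U z *\<^sub>R (?f e z *\<^sub>R \<phi> z) \<partial>lborel))
     \<longlongrightarrow> (\<Sum>x\<in>S. (h (x, 0) * pi / (a x * b x)) *\<^sub>R \<phi> x) + 0) (at_right 0)"
  proof (intro tendsto_add tendsto_sum)
    fix x assume x: "x \<in> S"
    obtain c where c: "c > 0" "\<And>z r. z \<in> ball x d \<Longrightarrow> 0 < r \<Longrightarrow> r < d \<Longrightarrow> p (z, r) \<ge> c * ((cmod (z - x))\<^sup>2 + r)"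
      using d(2)[OF x] by meson
    show "((\<lambda>e. \<integral>z. indicator (ball x d) z *\<^sub>R (?f e z *\<^sub>R \<phi> z) \<partial>lborel) \<longlongrightarrow> (h (x, 0) * pi / (a x * b x)) *\<^sub>R \<phi> x) (at_right 0)"
      by (rule concentration_at_pole[OF hc m B lp[OF x] d(1) c ab[OF x] fm])
  next
    show "((\<lambda>e. \<integral>z. indicator U z *\<^sub>R (?f e z *\<^sub>R \<phi> z) \<partial>lborel) \<longlongrightarrow> 0) (at_right 0)"
      by (rule concentration_off_poles[OF pc hc U Upos m B fint[OF Um]])
  qed
  moreover have "(\<Sum>x\<in>S. \<integral>z. indicator (ball x d) z *\<^sub>R (?f e z *\<^sub>R \<phi> z) \<partial>lborel) + (\<integral>z. indicator U z *\<^sub>R (?f e z *\<^sub>R \<phi> z) \<partial>lborel)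
     = (\<integral>z. ?f e z *\<^sub>R \<phi> z \<partial>lborel)" for e
  proof -
    have fb: "integrable lborel (\<lambda>z. indicator (ball x d) z *\<^sub>R (?f e z *\<^sub>R \<phi> z))" for x
      by (rule fint) simp
    have "(\<Sum>x\<in>S. \<integral>z. indicator (ball x d) z *\<^sub>R (?f e z *\<^sub>R \<phi> z) \<partial>lborel) + (\<integral>z. indicator U z *\<^sub>R (?f e z *\<^sub>R \<phi> z) \<partial>lborel)
      = (\<integral>z. (\<Sum>x\<in>S. indicator (ball x d) z *\<^sub>R (?f e z *\<^sub>R \<phi> z)) + indicator U z *\<^sub>R (?f e z *\<^sub>R \<phi> z) \<partial>lborel)"
      using fb fint[OF Um] by (subst Bochner_Integration.integral_add) (auto simp: Bochner_Integration.integral_sum)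
    also have "\<dots> = (\<integral>z. ?f e z *\<^sub>R \<phi> z \<partial>lborel)"
    proof (rule Bochner_Integration.integral_cong)
      fix z :: complex
      show "(\<Sum>x\<in>S. indicator (ball x d) z *\<^sub>R (?f e z *\<^sub>R \<phi> z)) + indicator U z *\<^sub>R (?f e z *\<^sub>R \<phi> z) = ?f e z *\<^sub>R \<phi> z"
      proof (cases "\<exists>x\<in>S. z \<in> ball x d")
        case True
        then obtain x where x: "x \<in> S" "z \<in> ball x d" by blast
        have "z \<notin> ball y d" if "y \<in> S - {x}" for y
          using d(3)[OF x(1), of y] that x(2) by blast
        then have "(\<Sum>x\<in>S. indicator (ball x d) z *\<^sub>R (?f e z *\<^sub>R \<phi> z)) = ?f e z *\<^sub>R \<phi> z"
          using x S(1) by (subst sum.remove[of _ x]) (auto simp del: mem_ball intro!: sum.neutral)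
        moreover have "z \<notin> U" using x unfolding U_def by blast
        ultimately show ?thesis by simp
      next
        case False
        then have "(\<Sum>x\<in>S. indicator (ball x d) z *\<^sub>R (?f e z *\<^sub>R \<phi> z)) = 0"
          by (intro sum.neutral) (auto simp del: mem_ball)
        moreover have "z \<in> U \<longleftrightarrow> z \<in> K" using False unfolding U_def by blast
        ultimately show ?thesis using \<phi>K by (cases "z \<in> K") auto
      qed
    qed simp
    finally show ?thesis .
  qed
  ultimately show ?thesis by simp
qed

section \<open>Scalar matrices and inverses\<close>

lemma mat_mult_nth [simp]: "(mat c ** A) $ i $ j = c * A $ i $ j" for A :: "'a::comm_semiring_1^'m^'n"
proof -
  have "(\<Sum>k\<in>UNIV. (if i = k then c else 0) * A $ k $ j) = (\<Sum>k\<in>UNIV. if k = i then c * A $ k $ j else 0)"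
    by (intro sum.cong) auto
  then show ?thesis by (simp add: matrix_matrix_mult_def mat_def)
qed

lemma mult_mat_nth [simp]: "(A ** mat c) $ i $ j = c * A $ i $ j" for A :: "'a::comm_semiring_1^'n^'m"
proof -
  have "(\<Sum>k\<in>UNIV. A $ i $ k * (if k = j then c else 0)) = (\<Sum>k\<in>UNIV. if k = j then c * A $ i $ k else 0)"
    by (intro sum.cong) (auto simp: mult.commute)
  then show ?thesis by (simp add: matrix_matrix_mult_def mat_def)
qed

lemma mat_mult_commute: "A ** mat c = mat c ** A" for A :: "'a::comm_semiring_1^'n^'m"
  by (simp add: vec_eq_iff)

lemma mat_mult_mat: "mat a ** mat b = (mat (a * b) :: 'a::comm_semiring_1^'n^'n)"
  by (simp add: vec_eq_iff) (simp add: mat_def mult.commute)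

lemma trace_mat_mult: "trace (mat c ** A) = c * trace A" for A :: "'a::comm_semiring_1^'n^'n"
  by (simp add: trace_def sum_distrib_left)

lemma matrix_mul_uminus_left: "(- A) ** B = - (A ** B)" for A :: "'a::comm_ring_1^'n^'m"
  by (simp add: vec_eq_iff matrix_matrix_mult_def sum_negf)

lemma matrix_mul_uminus_right: "A ** (- B) = - (A ** B)" for A :: "'a::comm_ring_1^'n^'m"
  by (simp add: vec_eq_iff matrix_matrix_mult_def sum_negf)

lemma matrix_mul_diff_left: "(A - B) ** C = A ** C - B ** C" for A :: "'a::comm_ring_1^'n^'m"
  by (simp add: vec_eq_iff matrix_matrix_mult_def algebra_simps sum_subtractf)

lemma matrix_mul_diff_right: "A ** (B - C) = A ** B - A ** C" for A :: "'a::comm_ring_1^'n^'m"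
  by (simp add: vec_eq_iff matrix_matrix_mult_def algebra_simps sum_subtractf)

lemma matrix_mul_add_left: "(A + B) ** C = A ** C + B ** C" for A :: "'a::comm_ring_1^'n^'m"
  by (simp add: vec_eq_iff matrix_matrix_mult_def algebra_simps sum.distrib)

lemma matrix_inv_det_nz:
  fixes A :: "'a::field^'n^'n"
  assumes "det A \<noteq> 0"
  shows "A ** matrix_inv A = mat 1" "matrix_inv A ** A = mat 1"
proof -
  have "invertible A" using assms by (simp add: invertible_det_nz)
  then have "\<exists>B. A ** B = mat 1 \<and> B ** A = mat 1" by (simp add: invertible_def)
  from someI_ex[OF this] show "A ** matrix_inv A = mat 1" "matrix_inv A ** A = mat 1"
    unfolding matrix_inv_def by auto
qed

lemma matrix_inv_unique_left:
  fixes A B :: "'a::field^'n^'n"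
  assumes "B ** A = mat 1"
  shows "matrix_inv A = B"
proof -
  have "det B * det A = 1" using assms by (metis det_mul det_I)
  then have "det A \<noteq> 0" by auto
  then show ?thesis
    using matrix_inv_det_nz(1)[of A] assms by (metis matrix_mul_assoc matrix_mul_lid matrix_mul_rid)
qed

section \<open>The adjugate\<close>

text \<open>Row \<open>i\<close> is replaced by the \<open>j\<close>-th unit vector in the entry at \<open>(j, i)\<close>, which is the transposed
  cofactor convention. Unlike the inverse, the adjugate is continuous at singular matrices, which is
  where it will be evaluated.\<close>

definition adjugate :: "'a::comm_ring_1^'n^'n \<Rightarrow> 'a^'n^'n" where
  "adjugate A = (\<chi> j i. det (\<chi> k. if k = i then axis j 1 else A $ k))"

lemma det_replace_row:
  fixes A :: "'a::comm_ring_1^'n^'n"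
  shows "det (\<chi> k. if k = i then v else A $ k) = (\<Sum>j\<in>UNIV. v $ j * adjugate A $ j $ i)"
proof -
  have "v = (\<Sum>j\<in>UNIV. v $ j *s axis j 1)"
    by (simp add: basis_expansion)
  then have "det (\<chi> k. if k = i then v else A $ k)
     = det (\<chi> k. if k = i then (\<Sum>j\<in>UNIV. v $ j *s axis j 1) else A $ k)"
    by (rule arg_cong[where f="\<lambda>v. det (\<chi> k. if k = i then v else A $ k)"])
  also have "\<dots> = (\<Sum>j\<in>UNIV. det (\<chi> k. if k = i then v $ j *s axis j 1 else A $ k))"
    by (rule det_linear_row_sum) simp
  also have "\<dots> = (\<Sum>j\<in>UNIV. v $ j * adjugate A $ j $ i)"
    by (simp add: det_row_mul adjugate_def)
  finally show ?thesis .
qed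

text \<open>Expanding along row \<open>j\<close> after that row was replaced by row \<open>i\<close>: two equal rows unless \<open>i = j\<close>.\<close>

lemma matrix_mult_adjugate: "A ** adjugate A = mat (det A)" for A :: "'a::comm_ring_1^'n^'n"
proof -
  have "(\<Sum>k\<in>UNIV. A $ i $ k * adjugate A $ k $ j) = (if i = j then det A else 0)" for i j
  proof -
    have "(\<Sum>k\<in>UNIV. A $ i $ k * adjugate A $ k $ j) = det (\<chi> k. if k = j then A $ i else A $ k)"
      by (simp add: det_replace_row)
    also have "\<dots> = (if i = j then det A else 0)"
    proof (cases "i = j")
      case True
      then have "(\<chi> k. if k = j then A $ i else A $ k) = A" by (simp add: vec_eq_iff)
      then show ?thesis using True by simp
    next
      case False
      then show ?thesis
        by (simp, intro det_identical_rows[of i j]) (auto simp: row_def vec_eq_iff)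
    qed
    finally show ?thesis .
  qed
  then show ?thesis by (simp add: vec_eq_iff matrix_matrix_mult_def mat_def)
qed

lemma adjugate_of_left_inverse:
  fixes A B :: "'a::comm_ring_1^'n^'n"
  assumes "B ** A = mat 1"
  shows "adjugate A = mat (det A) ** B"
proof -
  have "adjugate A = B ** A ** adjugate A" using assms by simp
  also have "\<dots> = B ** mat (det A)" by (simp add: matrix_mult_adjugate flip: matrix_mul_assoc)
  finally show ?thesis by (simp add: mat_mult_commute)
qed

lemma adjugate_eq_det_inv:
  fixes A :: "'a::field^'n^'n"
  assumes "det A \<noteq> 0"
  shows "adjugate A = mat (det A) ** matrix_inv A"
  by (rule adjugate_of_left_inverse) (rule matrix_inv_det_nz(2)[OF assms])

lemma matrix_inv_eq_adjugate:
  fixes A :: "'a::field^'n^'n"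
  assumes "det A \<noteq> 0"
  shows "matrix_inv A = mat (1 / det A) ** adjugate A"
  using assms by (simp add: adjugate_eq_det_inv vec_eq_iff)

lemma tendsto_det [tendsto_intros]:
  fixes A :: "'b \<Rightarrow> 'a::real_normed_field^'n^'n"
  assumes "(A \<longlongrightarrow> B) F"
  shows "((\<lambda>x. det (A x)) \<longlongrightarrow> det B) F"
  unfolding det_def by (intro tendsto_intros assms)

lemma tendsto_adjugate [tendsto_intros]:
  fixes A :: "'b \<Rightarrow> 'a::real_normed_field^'n^'n"
  assumes "(A \<longlongrightarrow> B) F"
  shows "((\<lambda>x. adjugate (A x)) \<longlongrightarrow> adjugate B) F"
proof -
  have "((\<lambda>x. if k = i then axis j 1 else A x $ k) \<longlongrightarrow> (if k = i then axis j 1 else B $ k)) F" for i j k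
    using assms by (auto intro: tendsto_vec_nth)
  then show ?thesis unfolding adjugate_def by (intro tendsto_vec_lambda tendsto_det)
qed

lemma tendsto_matrix_mult [tendsto_intros]:
  fixes A :: "'b \<Rightarrow> 'a::real_normed_field^'n^'m"
  assumes "(A \<longlongrightarrow> A') F" "(B \<longlongrightarrow> B') F"
  shows "((\<lambda>x. A x ** B x) \<longlongrightarrow> A' ** B') F"
  unfolding matrix_matrix_mult_def by (intro tendsto_intros assms)

lemma tendsto_mat [tendsto_intros]:
  fixes f :: "'b \<Rightarrow> 'a::real_normed_field"
  assumes "(f \<longlongrightarrow> c) F"
  shows "((\<lambda>x. mat (f x) :: 'a^'n^'n) \<longlongrightarrow> mat c) F"
proof -
  have "((\<lambda>x. if i = j then f x else 0) \<longlongrightarrow> (if i = j then c else 0)) F" for i j :: 'n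
    using assms by auto
  then show ?thesis unfolding mat_def by (intro tendsto_vec_lambda)
qed

lemma tendsto_trace [tendsto_intros]:
  fixes A :: "'b \<Rightarrow> 'a::real_normed_field^'n^'n"
  assumes "(A \<longlongrightarrow> B) F"
  shows "((\<lambda>x. trace (A x)) \<longlongrightarrow> trace B) F"
  unfolding trace_def by (intro tendsto_intros assms)

section \<open>Entrywise calculus\<close>

text \<open>Differentiability entry by entry keeps all rules within the calculus of a field. The paths of Gram
  matrices below are polynomial in their parameter, so they extend to a complex parameter and the
  derivative in one complex variable applies.\<close>

definition has_entry_derivative :: "('a::real_normed_field \<Rightarrow> 'a^'n^'m) \<Rightarrow> 'a^'n^'m \<Rightarrow> 'a \<Rightarrow> bool" where
  "has_entry_derivative A A' t \<longleftrightarrow> (\<forall>i j. ((\<lambda>s. A s $ i $ j) has_field_derivative A' $ i $ j) (at t))"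

lemma has_entry_derivative_const: "has_entry_derivative (\<lambda>_. A) 0 t"
  by (simp add: has_entry_derivative_def)

lemma has_entry_derivative_add:
  "has_entry_derivative A A' t \<Longrightarrow> has_entry_derivative B B' t \<Longrightarrow> has_entry_derivative (\<lambda>s. A s + B s) (A' + B') t"
  unfolding has_entry_derivative_def by (auto intro!: derivative_intros)

lemma has_entry_derivative_diff:
  "has_entry_derivative A A' t \<Longrightarrow> has_entry_derivative B B' t \<Longrightarrow> has_entry_derivative (\<lambda>s. A s - B s) (A' - B') t"
  unfolding has_entry_derivative_def by (auto intro!: derivative_intros)

lemma has_entry_derivative_mat:
  "(f has_field_derivative f') (at t) \<Longrightarrow> has_entry_derivative (\<lambda>s. mat (f s)) (mat f') t"
  unfolding has_entry_derivative_def mat_def by (auto intro!: derivative_intros)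

lemma has_entry_derivative_mult:
  assumes "has_entry_derivative A A' t" "has_entry_derivative B B' t"
  shows "has_entry_derivative (\<lambda>s. A s ** B s) (A' ** B t + A t ** B') t"
  using assms unfolding has_entry_derivative_def matrix_matrix_mult_def
  by (auto intro!: derivative_eq_intros simp: sum.distrib algebra_simps)

lemma has_entry_derivative_unique:
  "has_entry_derivative A A' t \<Longrightarrow> has_entry_derivative A A'' t \<Longrightarrow> A' = A''"
  unfolding has_entry_derivative_def vec_eq_iff using DERIV_unique by blast

lemma has_entry_derivative_cong_ev:
  assumes "eventually (\<lambda>s. A s = B s) (nhds t)" "has_entry_derivative A A' t"
  shows "has_entry_derivative B A' t"
proof -
  have "((\<lambda>s. B s $ i $ j) has_field_derivative A' $ i $ j) (at t)" for i j
  proof -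
    have ev: "eventually (\<lambda>s. A s $ i $ j = B s $ i $ j) (nhds t)"
      using assms(1) by eventually_elim simp
    have "((\<lambda>s. A s $ i $ j) has_field_derivative A' $ i $ j) (at t)"
      using assms(2) by (simp add: has_entry_derivative_def)
    then show ?thesis by (rule iffD1[OF DERIV_cong_ev[OF refl ev refl]])
  qed
  then show ?thesis by (simp add: has_entry_derivative_def)
qed

lemma DERIV_trace:
  "has_entry_derivative A A' t \<Longrightarrow> ((\<lambda>s. trace (A s)) has_field_derivative trace A') (at t)"
  unfolding has_entry_derivative_def trace_def by (auto intro!: derivative_intros)

text \<open>Jacobi's formula, valid at singular matrices too. The product rule in the Leibniz expansion gives a
  sum of determinants, each with one row replaced by its derivative.\<close>

theorem DERIV_det:
  fixes A :: "'a::real_normed_field \<Rightarrow> 'a^'n^'n"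
  assumes "has_entry_derivative A A' t"
  shows "((\<lambda>s. det (A s)) has_field_derivative trace (adjugate (A t) ** A')) (at t)"
proof -
  let ?P = "{p. p permutes (UNIV :: 'n set)}"
  have D: "((\<lambda>s. A s $ i $ j) has_field_derivative A' $ i $ j) (at t)" for i j
    using assms by (simp add: has_entry_derivative_def)
  have "((\<lambda>s. det (A s)) has_field_derivative
      (\<Sum>p\<in>?P. of_int (sign p) * (\<Sum>i\<in>UNIV. A' $ i $ p i * (\<Prod>j\<in>UNIV - {i}. A t $ j $ p j)))) (at t)"
    unfolding det_def by (intro DERIV_sum DERIV_cmult has_field_derivative_prod D)
  also have "(\<Sum>p\<in>?P. of_int (sign p) * (\<Sum>i\<in>UNIV. A' $ i $ p i * (\<Prod>j\<in>UNIV - {i}. A t $ j $ p j)))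
      = (\<Sum>p\<in>?P. \<Sum>i\<in>UNIV. of_int (sign p) * (\<Prod>j\<in>UNIV. (\<chi> k. if k = i then A' $ i else A t $ k) $ j $ p j))"
  proof (intro sum.cong refl, subst sum_distrib_left, intro sum.cong refl)
    fix p i
    have "(\<Prod>j\<in>UNIV. (\<chi> k. if k = i then A' $ i else A t $ k) $ j $ p j)
        = A' $ i $ p i * (\<Prod>j\<in>UNIV - {i}. A t $ j $ p j)"
      by (subst prod.remove[of _ i]) (auto intro!: prod.cong)
    then show "of_int (sign p) * (A' $ i $ p i * (\<Prod>j\<in>UNIV - {i}. A t $ j $ p j)) =
        of_int (sign p) * (\<Prod>j\<in>UNIV. (\<chi> k. if k = i then A' $ i else A t $ k) $ j $ p j)" by simp
  qed
  also have "\<dots> = (\<Sum>i\<in>UNIV. det (\<chi> k. if k = i then A' $ i else A t $ k))"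
    unfolding det_def by (rule sum.swap)
  also have "\<dots> = (\<Sum>i\<in>UNIV. \<Sum>j\<in>UNIV. A' $ i $ j * adjugate (A t) $ j $ i)"
    by (simp add: det_replace_row)
  also have "\<dots> = trace (adjugate (A t) ** A')"
    unfolding trace_def matrix_matrix_mult_def by (subst sum.swap) (simp add: mult.commute)
  finally show ?thesis .
qed

lemma has_entry_derivative_adjugate_ex:
  fixes A :: "'a::real_normed_field \<Rightarrow> 'a^'n^'n"
  assumes "has_entry_derivative A A' t"
  shows "\<exists>D. has_entry_derivative (\<lambda>s. adjugate (A s)) D t"
proof -
  have "\<exists>d. ((\<lambda>s. adjugate (A s) $ j $ i) has_field_derivative d) (at t)" for i j
  proof -
    have "has_entry_derivative (\<lambda>s. \<chi> k. if k = i then axis j 1 else A s $ k) (\<chi> k. if k = i then 0 else A' $ k) t"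
      using assms by (auto simp: has_entry_derivative_def)
    from DERIV_det[OF this] show ?thesis by (auto simp: adjugate_def)
  qed
  then have "((\<lambda>s. adjugate (A s) $ j $ i) has_field_derivative deriv (\<lambda>s. adjugate (A s) $ j $ i) t) (at t)" for i j
    by (auto intro: DERIV_deriv_iff_field_differentiable[THEN iffD2] simp: field_differentiable_def)
  then show ?thesis
    by (intro exI[of _ "\<chi> j i. deriv (\<lambda>s. adjugate (A s) $ j $ i) t"]) (simp add: has_entry_derivative_def)
qed

text \<open>Cramer's rule shows that the inverse has some derivative; differentiating \<open>A\<^sup>-\<^sup>1 A = 1\<close> then
  determines it.\<close>

lemma has_entry_derivative_matrix_inv:
  fixes A :: "'a::real_normed_field \<Rightarrow> 'a^'n^'n"
  assumes A: "has_entry_derivative A A' t" and nz: "det (A t) \<noteq> 0"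
  shows "has_entry_derivative (\<lambda>s. matrix_inv (A s)) (- (matrix_inv (A t) ** A' ** matrix_inv (A t))) t"
proof -
  let ?N = "\<lambda>s. matrix_inv (A s)"
  have dd: "((\<lambda>s. det (A s)) has_field_derivative trace (adjugate (A t) ** A')) (at t)"
    by (rule DERIV_det[OF A])
  then have "((\<lambda>s. det (A s)) \<longlongrightarrow> det (A t)) (at t)" by (intro isContD DERIV_isCont)
  then have "eventually (\<lambda>s. det (A s) \<noteq> 0) (at t)" by (rule tendsto_imp_eventually_ne[OF _ nz])
  then have ev: "eventually (\<lambda>s. det (A s) \<noteq> 0) (nhds t)" using nz by (simp add: eventually_nhds_conv_at)
  obtain D where D: "has_entry_derivative (\<lambda>s. adjugate (A s)) D t"
    using has_entry_derivative_adjugate_ex[OF A] by (elim exE)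
  note c = DERIV_divide[OF DERIV_const[of 1] dd nz]
  have ev2: "eventually (\<lambda>s. mat (1 / det (A s)) ** adjugate (A s) = ?N s) (nhds t)"
    using ev by eventually_elim (simp add: matrix_inv_eq_adjugate)
  obtain N' where N': "has_entry_derivative ?N N' t"
    using has_entry_derivative_cong_ev[OF ev2 has_entry_derivative_mult[OF has_entry_derivative_mat[OF c] D]] ..
  have "has_entry_derivative (\<lambda>s. ?N s ** A s) (N' ** A t + ?N t ** A') t"
    by (rule has_entry_derivative_mult[OF N' A])
  moreover have "eventually (\<lambda>s. ?N s ** A s = mat 1) (nhds t)"
    using ev by eventually_elim (simp add: matrix_inv_det_nz)
  ultimately have "has_entry_derivative (\<lambda>s. mat 1) (N' ** A t + ?N t ** A') t"
    by (rule has_entry_derivative_cong_ev[rotated])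
  then have "N' ** A t + ?N t ** A' = 0"
    using has_entry_derivative_unique has_entry_derivative_const by blast
  then have "N' ** A t = - (?N t ** A')" by (simp add: eq_neg_iff_add_eq_0)
  then have "N' ** A t ** ?N t = - (?N t ** A') ** ?N t" by simp
  then have "N' = - (?N t ** A' ** ?N t)"
    by (simp add: matrix_inv_det_nz[OF nz] matrix_mul_uminus_left flip: matrix_mul_assoc)
  then show ?thesis using N' by simp
qed

section \<open>Nonsingular matrices are dense\<close>

definition det_pencil :: "complex^'n^'n \<Rightarrow> complex^'n^'n \<Rightarrow> complex poly" where
  "det_pencil A B = det (\<chi> i j. [:A $ i $ j, B $ i $ j:])"

lemma poly_det_pencil: "poly (det_pencil A B) z = det (A + mat z ** B)"
  unfolding det_pencil_def det_def by (simp add: poly_sum poly_prod)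

text \<open>The determinant of \<open>A + z B\<close> is a polynomial in \<open>z\<close>, and \<open>s A + B\<close> is invertible for small
  \<open>s \<noteq> 0\<close>, so this polynomial does not vanish at \<open>z = 1 / s\<close>.\<close>

lemma finite_singular_pencil:
  fixes A B :: "complex^'n^'n"
  assumes "det B \<noteq> 0"
  shows "finite {z. det (A + mat z ** B) = 0}"
proof -
  have "((\<lambda>s. det (mat s ** A + B)) \<longlongrightarrow> det (mat 0 ** A + B)) (at 0)"
    by (intro tendsto_intros)
  then have "eventually (\<lambda>s::complex. det (mat s ** A + B) \<noteq> 0) (at 0)"
    using assms by (intro tendsto_imp_eventually_ne) auto
  moreover have "eventually (\<lambda>s::complex. s \<noteq> 0) (at 0)" by (simp add: eventually_at_filter)
  ultimately have "eventually (\<lambda>s::complex. det (mat s ** A + B) \<noteq> 0 \<and> s \<noteq> 0) (at 0)"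
    by eventually_elim simp
  then obtain s :: complex where s: "det (mat s ** A + B) \<noteq> 0" "s \<noteq> 0"
    using eventually_happens[of _ "at (0::complex)"] by auto
  have "mat s ** (A + mat (1 / s) ** B) = mat s ** A + B"
    using s(2) by (simp add: vec_eq_iff algebra_simps)
  then have "det (A + mat (1 / s) ** B) \<noteq> 0" using s(1) by (metis det_mul mult_zero_right)
  then have "det_pencil A B \<noteq> 0" using poly_det_pencil[of A B "1 / s"] by auto
  then show ?thesis using poly_roots_finite[of "det_pencil A B"] by (simp add: poly_det_pencil)
qed

lemma eventually_notin_finite:
  assumes "finite (S :: 'a::t1_space set)"
  shows "eventually (\<lambda>x. x \<notin> S) (at a)"
proof -
  have "open (- (S - {a}))" by (intro open_Compl finite_imp_closed finite_Diff assms)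
  then show ?thesis
    unfolding eventually_at_topological by (intro exI[of _ "- (S - {a})"]) auto
qed

lemma eventually_det_shift_nonzero:
  fixes A :: "complex^'n^'n"
  shows "eventually (\<lambda>e. det (A + mat e) \<noteq> 0) (at 0)"
  using eventually_notin_finite[OF finite_singular_pencil[of "mat 1" A], of 0]
  by simp

lemma tendsto_shift_mat: "((\<lambda>e. A + mat e) \<longlongrightarrow> A) (at 0)" for A :: "complex^'n^'n"
proof -
  have "((\<lambda>e. A + mat e) \<longlongrightarrow> A + mat 0) (at 0)" by (intro tendsto_intros)
  then show ?thesis by simp
qed

text \<open>Clear for invertible matrices, hence for \<open>A + e\<close> and \<open>B + e\<close> with all small \<open>e \<noteq> 0\<close>; then
  let \<open>e\<close> tend to zero.\<close>

lemma adjugate_mult: "adjugate (A ** B) = adjugate B ** adjugate A" for A B :: "complex^'n^'n"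
proof (rule tendsto_unique[of "at (0::complex)"])
  show "((\<lambda>e. adjugate ((A + mat e) ** (B + mat e))) \<longlongrightarrow> adjugate (A ** B)) (at 0)"
    by (intro tendsto_intros tendsto_shift_mat)
  have "((\<lambda>e. adjugate (B + mat e) ** adjugate (A + mat e)) \<longlongrightarrow> adjugate B ** adjugate A) (at 0)"
    by (intro tendsto_intros tendsto_shift_mat)
  moreover have "eventually (\<lambda>e. adjugate (B + mat e) ** adjugate (A + mat e) = adjugate ((A + mat e) ** (B + mat e))) (at 0)"
    using eventually_det_shift_nonzero[of A] eventually_det_shift_nonzero[of B]
  proof eventually_elim
    case (elim e)
    let ?A = "A + mat e" and ?B = "B + mat e"
    have "(matrix_inv ?B ** matrix_inv ?A) ** (?A ** ?B) = matrix_inv ?B ** (matrix_inv ?A ** ?A) ** ?B"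
      by (simp only: matrix_mul_assoc)
    also have "\<dots> = mat 1" using elim by (simp add: matrix_inv_det_nz)
    finally have "adjugate (?A ** ?B) = mat (det (?A ** ?B)) ** (matrix_inv ?B ** matrix_inv ?A)"
      by (rule adjugate_of_left_inverse)
    also have "\<dots> = (mat (det ?B) ** matrix_inv ?B) ** (mat (det ?A) ** matrix_inv ?A)"
      by (simp add: det_mul vec_eq_iff matrix_matrix_mult_def[of "_ ** _"] matrix_matrix_mult_def[of "matrix_inv _"]
          sum_distrib_left mult_ac)
    finally show ?case using elim by (simp add: adjugate_eq_det_inv)
  qed
  ultimately show "((\<lambda>e. adjugate ((A + mat e) ** (B + mat e))) \<longlongrightarrow> adjugate B ** adjugate A) (at 0)"
    by (rule Lim_transform_eventually)
qed simp

section \<open>Adjoints and Gram matrices\<close>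

lemma adjoint_matrix_nth [simp]: "adjoint_matrix A $ i $ j = cnj (A $ j $ i)"
  by (simp add: adjoint_matrix_def)

lemma adjoint_matrix_mult: "adjoint_matrix (A ** B) = adjoint_matrix B ** adjoint_matrix A"
  by (simp add: vec_eq_iff matrix_matrix_mult_def mult.commute)

lemma adjoint_matrix_involutive [simp]: "adjoint_matrix (adjoint_matrix A) = A"
  by (simp add: vec_eq_iff)

lemma adjoint_matrix_add: "adjoint_matrix (A + B) = adjoint_matrix A + adjoint_matrix B"
  by (simp add: vec_eq_iff)

lemma adjoint_matrix_diff: "adjoint_matrix (A - B) = adjoint_matrix A - adjoint_matrix B"
  by (simp add: vec_eq_iff)

lemma adjoint_matrix_mat [simp]: "adjoint_matrix (mat c) = mat (cnj c)"
  by (simp add: vec_eq_iff mat_def)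

lemma det_adjoint_matrix: "det (adjoint_matrix A) = cnj (det A)"
proof -
  have "det (\<chi> i j. cnj (A $ i $ j)) = cnj (det A)"
    unfolding det_def by (simp add: cnj_sum cnj_prod)
  moreover have "adjoint_matrix A = transpose (\<chi> i j. cnj (A $ i $ j))"
    by (simp add: vec_eq_iff transpose_def)
  ultimately show ?thesis by simp
qed

lemma trace_adjoint_matrix: "trace (adjoint_matrix A) = cnj (trace A)"
  by (simp add: trace_def cnj_sum)

lemma tendsto_adjoint_matrix [tendsto_intros]:
  assumes "(A \<longlongrightarrow> B) F"
  shows "((\<lambda>x. adjoint_matrix (A x)) \<longlongrightarrow> adjoint_matrix B) F"
  unfolding adjoint_matrix_def by (intro tendsto_intros assms)

lemma matrix_inv_adjoint_matrix:
  assumes "det A \<noteq> 0"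
  shows "matrix_inv (adjoint_matrix A) = adjoint_matrix (matrix_inv A)"
proof (rule matrix_inv_unique_left)
  show "adjoint_matrix (matrix_inv A) ** adjoint_matrix A = mat 1"
    using matrix_inv_det_nz(1)[OF assms] by (simp flip: adjoint_matrix_mult)
qed

lemma adjugate_adjoint_matrix: "adjugate (adjoint_matrix A) = adjoint_matrix (adjugate A)"
proof (rule tendsto_unique[of "at (0::complex)"])
  show "((\<lambda>e. adjugate (adjoint_matrix (A + mat e))) \<longlongrightarrow> adjugate (adjoint_matrix A)) (at 0)"
    by (intro tendsto_intros tendsto_shift_mat)
  have "((\<lambda>e. adjoint_matrix (adjugate (A + mat e))) \<longlongrightarrow> adjoint_matrix (adjugate A)) (at 0)"
    by (intro tendsto_intros tendsto_shift_mat)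
  moreover have "eventually (\<lambda>e. adjoint_matrix (adjugate (A + mat e)) = adjugate (adjoint_matrix (A + mat e))) (at 0)"
    using eventually_det_shift_nonzero[of A]
  proof eventually_elim
    case (elim e)
    then show ?case
      by (simp add: adjugate_eq_det_inv det_adjoint_matrix matrix_inv_adjoint_matrix adjoint_matrix_mult mat_mult_commute)
  qed
  ultimately show "((\<lambda>e. adjugate (adjoint_matrix (A + mat e))) \<longlongrightarrow> adjoint_matrix (adjugate A)) (at 0)"
    by (rule Lim_transform_eventually)
qed simp

text \<open>The matrix whose determinant defines \<^const>\<open>Psi\<close>, for \<open>Y = M - z\<close> and \<open>r = |w|\<^sup>2\<close>.\<close>

definition gram :: "complex^'n^'n \<Rightarrow> real \<Rightarrow> complex^'n^'n" where
  "gram Y r = adjoint_matrix Y ** Y + mat (of_real r)"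

lemma tendsto_gram [tendsto_intros]:
  assumes "(Y \<longlongrightarrow> Y') F" "(r \<longlongrightarrow> r') F"
  shows "((\<lambda>x. gram (Y x) (r x)) \<longlongrightarrow> gram Y' r') F"
  unfolding gram_def by (intro tendsto_intros assms)

lemma adjoint_matrix_gram [simp]: "adjoint_matrix (gram Y r) = gram Y r"
  by (simp add: gram_def adjoint_matrix_add adjoint_matrix_mult)

lemma Im_det_gram [simp]: "Im (det (gram Y r)) = 0"
  using det_adjoint_matrix[of "gram Y r"] by (simp add: complex_eq_iff)

lemma det_gram_0: "det (gram Y 0) = of_real ((cmod (det Y))\<^sup>2)"
  by (simp add: gram_def det_mul det_adjoint_matrix mult.commute complex_norm_square flip: complex_norm_square)

lemma mat_mult_vector: "mat c *v x = c *s x" for x :: "'a::comm_semiring_1^'n"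
proof -
  have "(\<Sum>j\<in>UNIV. (if i = j then c else 0) * x $ j) = (\<Sum>j\<in>UNIV. if i = j then c * x $ j else 0)" for i
    by (intro sum.cong) auto
  then show ?thesis by (simp add: vec_eq_iff matrix_vector_mult_def mat_def)
qed

text \<open>For \<open>x\<close> in the kernel, \<open>0 = \<langle>x, (Y' Y + r) x\<rangle> = |Y x|\<^sup>2 + r |x|\<^sup>2\<close>.\<close>

lemma det_gram_nonzero:
  assumes "r > 0"
  shows "det (gram Y r) \<noteq> 0"
proof -
  have "\<forall>x. gram Y r *v x = 0 \<longrightarrow> x = 0"
  proof (intro allI impI)
    fix x assume 0: "gram Y r *v x = 0"
    have gx: "gram Y r *v x = adjoint_matrix Y *v (Y *v x) + of_real r *s x"
      by (simp add: gram_def matrix_vector_mult_add_rdistrib matrix_vector_mul_assoc)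
         (simp add: mat_mult_vector)
    have "(\<Sum>i\<in>UNIV. cnj (x $ i) * (adjoint_matrix Y *v (Y *v x)) $ i) + (\<Sum>i\<in>UNIV. cnj (x $ i) * (of_real r * x $ i)) = 0"
    proof -
      have "(adjoint_matrix Y *v (Y *v x)) $ i + of_real r * x $ i = 0" for i
        using 0 gx by (simp add: vec_eq_iff)
      then have "cnj (x $ i) * (adjoint_matrix Y *v (Y *v x)) $ i + cnj (x $ i) * (of_real r * x $ i) = 0" for i
        by (metis distrib_left mult_zero_right)
      then show ?thesis by (simp flip: sum.distrib)
    qed
    moreover have "(\<Sum>i\<in>UNIV. cnj (x $ i) * (adjoint_matrix Y *v (Y *v x)) $ i) = of_real (\<Sum>k\<in>UNIV. (cmod ((Y *v x) $ k))\<^sup>2)"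
    proof -
      have "(\<Sum>i\<in>UNIV. cnj (x $ i) * (adjoint_matrix Y *v (Y *v x)) $ i)
          = (\<Sum>i\<in>UNIV. \<Sum>k\<in>UNIV. cnj (Y $ k $ i * x $ i) * (Y *v x) $ k)"
        by (simp add: matrix_vector_mult_def[of "adjoint_matrix Y"] sum_distrib_left mult_ac)
      also have "\<dots> = (\<Sum>k\<in>UNIV. cnj ((Y *v x) $ k) * (Y *v x) $ k)"
        by (subst sum.swap) (simp add: matrix_vector_mult_def cnj_sum flip: sum_distrib_right)
      finally show ?thesis by (simp add: complex_norm_square mult.commute flip: of_real_power)
    qed
    moreover have "(\<Sum>i\<in>UNIV. cnj (x $ i) * (of_real r * x $ i)) = of_real (r * (\<Sum>i\<in>UNIV. (cmod (x $ i))\<^sup>2))"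
      by (simp add: complex_norm_square sum_distrib_left mult_ac flip: of_real_power)
    ultimately have "(\<Sum>k\<in>UNIV. (cmod ((Y *v x) $ k))\<^sup>2) + r * (\<Sum>i\<in>UNIV. (cmod (x $ i))\<^sup>2) = 0"
      by (metis of_real_add of_real_eq_0_iff)
    moreover have "(\<Sum>k\<in>UNIV. (cmod ((Y *v x) $ k))\<^sup>2) \<ge> 0" "(\<Sum>i\<in>UNIV. (cmod (x $ i))\<^sup>2) \<ge> 0"
      by (auto intro: sum_nonneg)
    ultimately have "(\<Sum>i\<in>UNIV. (cmod (x $ i))\<^sup>2) = 0"
      using assms by (smt (verit) mult_pos_pos)
    then show "x = 0" by (simp add: sum_nonneg_eq_0_iff vec_eq_iff)
  qed
  then have "invertible (gram Y r)" by (simp add: invertible_left_inverse matrix_left_invertible_ker)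
  then show ?thesis by (simp add: invertible_det_nz)
qed

text \<open>The determinant is real and does not vanish along the path from \<open>0\<close> to \<open>Y\<close>, at whose start it
  is a power of \<open>r\<close>.\<close>

lemma det_gram_pos:
  fixes Y :: "complex^'n^'n"
  assumes "r > 0"
  shows "Re (det (gram Y r)) > 0"
proof (rule ccontr)
  assume neg: "\<not> ?thesis"
  let ?f = "\<lambda>s::real. Re (det (gram (mat (of_real s) ** Y) r))"
  have nz: "?f s \<noteq> 0" for s
    using det_gram_nonzero[OF assms, of "mat (of_real s) ** Y"] Im_det_gram[of "mat (of_real s) ** Y" r]
    by (metis complex_eqI zero_complex.sel)
  have cont: "continuous_on {0..1} ?f"
    unfolding continuous_on_def gram_def by (intro ballI tendsto_intros)
  have "gram (mat (of_real 0) ** Y) r = mat (of_real r)"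
    by (simp add: gram_def vec_eq_iff)
  moreover have "det (mat (of_real r) :: complex^'n^'n) = of_real (r ^ CARD('n))"
    by (subst det_diagonal) (auto simp: mat_def)
  ultimately have "?f 0 > 0" using assms by simp
  moreover have "?f 1 \<le> 0" using neg by simp
  ultimately obtain s where "0 \<le> s" "s \<le> 1" "?f s = 0"
    using IVT2'[of ?f 1 0 0] cont by auto
  then show False using nz by blast
qed

lemma det_gram_eq_of_real: "det (gram Y r) = of_real (Re (det (gram Y r)))"
  by (simp add: complex_eq_iff)


text \<open>From \<open>Y (Y' Y + r) = (Y Y' + r) Y\<close> for invertible \<open>Y\<close>, and by density for all \<open>Y\<close>.\<close>

lemma det_gram_adjoint: "det (gram (adjoint_matrix Y) r) = det (gram Y r)" for Y :: "complex^'n^'n"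
proof (rule tendsto_unique[of "at (0::complex)"])
  show "((\<lambda>e. det (gram (adjoint_matrix (Y + mat e)) r)) \<longlongrightarrow> det (gram (adjoint_matrix Y) r)) (at 0)"
    by (intro tendsto_intros tendsto_shift_mat)
  have "((\<lambda>e. det (gram (Y + mat e) r)) \<longlongrightarrow> det (gram Y r)) (at 0)"
    by (intro tendsto_intros tendsto_shift_mat)
  moreover have "eventually (\<lambda>e. det (gram (Y + mat e) r) = det (gram (adjoint_matrix (Y + mat e)) r)) (at 0)"
    using eventually_det_shift_nonzero[of Y]
  proof eventually_elim
    case (elim e)
    let ?Y = "Y + mat e"
    have "?Y ** gram ?Y r = gram (adjoint_matrix ?Y) r ** ?Y"
      unfolding gram_def matrix_add_ldistrib[of ?Y] matrix_mul_add_left[of _ _ ?Y]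
      by (simp only: adjoint_matrix_involutive matrix_mul_assoc mat_mult_commute)
    then have "det ?Y * det (gram ?Y r) = det (gram (adjoint_matrix ?Y) r) * det ?Y"
      by (metis det_mul)
    then show ?case using elim by simp
  qed
  ultimately show "((\<lambda>e. det (gram (adjoint_matrix (Y + mat e)) r)) \<longlongrightarrow> det (gram Y r)) (at 0)"
    by (rule Lim_transform_eventually)
qed simp

section \<open>Derivatives of the log-determinant potential\<close>

lemma has_vector_derivative_of_complex_path:
  assumes "(f has_field_derivative f') (at (0::complex))"
  shows "((\<lambda>s::real. f (of_real s)) has_vector_derivative f') (at 0)"
  by (rule has_vector_derivative_real_field) (use assms in simp)

text \<open>The path has a complex parameter so that \<open>DERIV_det\<close> applies; the logarithm is taken along real
  parameters, where the determinants below are real.\<close>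

lemma log_det_path_derivative:
  fixes X :: "complex \<Rightarrow> complex^'n^'n"
  assumes X: "has_entry_derivative X X' 0" and pos: "Im (det (X 0)) = 0" "Re (det (X 0)) > 0"
  shows "((\<lambda>s::real. of_real (ln (Re (det (X (of_real s))))) :: complex)
     has_vector_derivative of_real (Re (trace (matrix_inv (X 0) ** X')))) (at 0)"
proof -
  let ?d = "Re (det (X 0))"
  have dd: "det (X 0) = of_real ?d" using pos by (simp add: complex_eq_iff)
  then have nz: "det (X 0) \<noteq> 0" using pos by auto
  have "((\<lambda>s::real. det (X (of_real s))) has_vector_derivative trace (adjugate (X 0) ** X')) (at 0)"
    using has_vector_derivative_of_complex_path[OF DERIV_det[OF X]] .
  then have "((\<lambda>s::real. Re (det (X (of_real s)))) has_real_derivative Re (trace (adjugate (X 0) ** X'))) (at 0)"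
    by (simp add: has_vector_derivative_complex_iff)
  then have "((\<lambda>s::real. ln (Re (det (X (of_real s))))) has_real_derivative (1 / ?d * Re (trace (adjugate (X 0) ** X')))) (at 0)"
    by (rule DERIV_chain2[rotated]) (use DERIV_ln_divide[OF pos(2)] in simp)
  moreover have "1 / ?d * Re (trace (adjugate (X 0) ** X')) = Re (trace (matrix_inv (X 0) ** X'))"
  proof -
    have "trace (adjugate (X 0) ** X') = of_real ?d * trace (matrix_inv (X 0) ** X')"
      using dd by (simp add: adjugate_eq_det_inv[OF nz] trace_mat_mult flip: matrix_mul_assoc)
    then show ?thesis using pos by simp
  qed
  ultimately have "((\<lambda>s::real. ln (Re (det (X (of_real s))))) has_real_derivative Re (trace (matrix_inv (X 0) ** X'))) (at 0)"
    by simp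
  then show ?thesis
    by (intro has_vector_derivative_of_real) (simp add: has_real_derivative_iff_has_vector_derivative)
qed

lemma Psi_eq: "Psi M z w = ln (Re (det (gram (M - mat z) ((cmod w)\<^sup>2)))) / (2 * real CARD('n))"
  for M :: "complex^'n^'n"
  by (simp add: Psi_def gram_def adjoint_matrix_diff)

lemma Psi_derivative_w:
  fixes M :: "complex^'n^'n"
  assumes w: "w \<noteq> 0"
  shows "((\<lambda>s::real. of_real (Psi M z (w + of_real s * v)) :: complex) has_vector_derivative
     of_real (2 * Re (cnj v * w) * Re (trace (matrix_inv (gram (M - mat z) ((cmod w)\<^sup>2)))) / (2 * real CARD('n)))) (at 0)"
proof -
  let ?Y = "M - mat z"
  define X where "X s = adjoint_matrix ?Y ** ?Y + mat (of_real ((cmod w)\<^sup>2) + s * of_real (2 * Re (cnj v * w)) + s\<^sup>2 * of_real ((cmod v)\<^sup>2))" for s :: complex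
  have Xr: "X (of_real s) = gram ?Y ((cmod (w + of_real s * v))\<^sup>2)" for s
  proof -
    have "(cmod (w + of_real s * v))\<^sup>2 = (cmod w)\<^sup>2 + s * (2 * Re (cnj v * w)) + s\<^sup>2 * (cmod v)\<^sup>2"
      unfolding cmod_power2 by (simp add: power2_eq_square algebra_simps)
    then show ?thesis by (simp add: X_def gram_def)
  qed
  have X0: "X 0 = gram ?Y ((cmod w)\<^sup>2)" using Xr[of 0] by simp
  have r: "(cmod w)\<^sup>2 > 0" using w by simp
  have "has_entry_derivative X (0 + mat (of_real (2 * Re (cnj v * w)))) 0"
    unfolding X_def
    by (intro has_entry_derivative_add has_entry_derivative_const has_entry_derivative_mat)
       (auto intro!: derivative_eq_intros)
  from log_det_path_derivative[OF this]
  have "((\<lambda>s::real. of_real (ln (Re (det (X (of_real s))))) :: complex)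
     has_vector_derivative of_real (Re (trace (matrix_inv (X 0) ** mat (of_real (2 * Re (cnj v * w))))))) (at 0)"
    using det_gram_pos[OF r, of ?Y] by (simp add: X0)
  then have "((\<lambda>s::real. of_real (ln (Re (det (X (of_real s))))) / of_real (2 * real CARD('n)) :: complex)
     has_vector_derivative of_real (Re (trace (matrix_inv (X 0) ** mat (of_real (2 * Re (cnj v * w)))))) / of_real (2 * real CARD('n))) (at 0)"
    by (rule has_vector_derivative_divide)
  then show ?thesis
    unfolding Xr X0 Psi_eq mat_mult_commute trace_mat_mult by simp
qed

lemma wirtinger_Psi_w:
  fixes M :: "complex^'n^'n"
  assumes w: "w \<noteq> 0"
  shows "wirtinger (\<lambda>w'. of_real (Psi M z w')) w
     = cnj w * of_real (Re (trace (matrix_inv (gram (M - mat z) ((cmod w)\<^sup>2)))) / (2 * real CARD('n)))"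
proof -
  let ?T = "Re (trace (matrix_inv (gram (M - mat z) ((cmod w)\<^sup>2)))) / (2 * real CARD('n))"
  have "partial_x (\<lambda>w'. of_real (Psi M z w')) w = of_real (2 * Re w * ?T)"
    unfolding partial_x_def
    using vector_derivative_at[OF Psi_derivative_w[OF w, of M z 1]] by simp
  moreover have "partial_y (\<lambda>w'. of_real (Psi M z w')) w = of_real (2 * Im w * ?T)"
    unfolding partial_y_def
    using vector_derivative_at[OF Psi_derivative_w[OF w, of M z \<i>]] by (simp add: mult.commute[of \<i>])
  ultimately have "wirtinger (\<lambda>w'. of_real (Psi M z w')) w = (of_real (2 * Re w * ?T) - \<i> * of_real (2 * Im w * ?T)) / 2"
    by (simp add: wirtinger_def)
  also have "\<dots> = cnj w * of_real ?T"
    by (simp add: complex_eq_iff)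
  finally show ?thesis .
qed

text \<open>For real \<open>s\<close> this is the Gram matrix at the point \<open>z + s v\<close>. The parameter is complex, and its
  conjugate does not occur, to make the entries holomorphic in \<open>s\<close>.\<close>

definition gram_line :: "complex^'n^'n \<Rightarrow> complex \<Rightarrow> complex \<Rightarrow> real \<Rightarrow> complex \<Rightarrow> complex^'n^'n" where
  "gram_line M z v r s =
     (adjoint_matrix (M - mat z) - mat (s * cnj v)) ** ((M - mat z) - mat (s * v)) + mat (of_real r)"

lemma gram_line_of_real: "gram_line M z v r (of_real s) = gram (M - mat (z + of_real s * v)) r"
proof -
  have m: "mat (a + b) = (mat a + mat b :: complex^'n^'n)" for a b by (simp add: vec_eq_iff mat_def)
  show ?thesis
    by (simp add: gram_line_def gram_def adjoint_matrix_diff adjoint_matrix_add m diff_diff_eq)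
qed

lemma gram_line_0: "gram_line M z v r 0 = gram (M - mat z) r"
  using gram_line_of_real[of M z v r 0] by simp

lemma has_entry_derivative_gram_line:
  "has_entry_derivative (gram_line M z v r) (- (mat (cnj v) ** (M - mat z)) - adjoint_matrix (M - mat z) ** mat v) 0"
proof -
  have a: "has_entry_derivative (\<lambda>s. adjoint_matrix (M - mat z) - mat (s * cnj v)) (0 - mat (cnj v)) 0"
    by (intro has_entry_derivative_diff has_entry_derivative_const has_entry_derivative_mat) (auto intro!: derivative_eq_intros)
  have b: "has_entry_derivative (\<lambda>s. (M - mat z) - mat (s * v)) (0 - mat v) 0"
    by (intro has_entry_derivative_diff has_entry_derivative_const has_entry_derivative_mat) (auto intro!: derivative_eq_intros)
  have "has_entry_derivative (gram_line M z v r) (((0 - mat (cnj v)) ** ((M - mat z) - mat (0 * v)) + (adjoint_matrix (M - mat z) - mat (0 * cnj v)) ** (0 - mat v)) + 0) 0"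
    unfolding gram_line_def[abs_def]
    by (intro has_entry_derivative_add has_entry_derivative_mult[OF a b] has_entry_derivative_const)
  then show ?thesis
    by (simp add: matrix_mul_uminus_left matrix_mul_uminus_right)
qed

text \<open>The Gram matrix is Hermitian, so both traces are those of adjoint matrices.\<close>

lemma trace_inv_gram_adjoint:
  assumes "r > 0"
  shows "trace (matrix_inv (gram Y r) ** adjoint_matrix Y) = cnj (trace (matrix_inv (gram Y r) ** Y))"
proof -
  have "adjoint_matrix (matrix_inv (gram Y r)) = matrix_inv (gram Y r)"
    using matrix_inv_adjoint_matrix[OF det_gram_nonzero[OF assms, of Y]] by simp
  then have "cnj (trace (matrix_inv (gram Y r) ** Y)) = trace (adjoint_matrix Y ** matrix_inv (gram Y r))"
    by (simp add: adjoint_matrix_mult flip: trace_adjoint_matrix)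
  then show ?thesis using trace_mul_sym[of "adjoint_matrix Y" "matrix_inv (gram Y r)"] by simp
qed

lemma Psi_derivative_z:
  fixes M :: "complex^'n^'n"
  assumes w: "w \<noteq> 0"
  shows "((\<lambda>s::real. of_real (Psi M (z + of_real s * v) w) :: complex) has_vector_derivative
     of_real (- 2 * Re (cnj v * trace (matrix_inv (gram (M - mat z) ((cmod w)\<^sup>2)) ** (M - mat z))) / (2 * real CARD('n)))) (at 0)"
proof -
  let ?Y = "M - mat z" and ?r = "(cmod w)\<^sup>2"
  let ?\<alpha> = "trace (matrix_inv (gram ?Y ?r) ** ?Y)"
  have r: "?r > 0" using w by simp
  let ?X = "gram_line M z v ?r"
  note X = gram_line_of_real[of M z v ?r] gram_line_0[of M z v ?r] has_entry_derivative_gram_line[of M z v ?r]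
  have tr: "Re (trace (matrix_inv (?X 0) ** (- (mat (cnj v) ** ?Y) - adjoint_matrix ?Y ** mat v))) = - 2 * Re (cnj v * ?\<alpha>)"
  proof -
    have "trace (matrix_inv (?X 0) ** (- (mat (cnj v) ** ?Y) - adjoint_matrix ?Y ** mat v))
       = - trace (matrix_inv (gram ?Y ?r) ** (mat (cnj v) ** ?Y)) - trace (matrix_inv (gram ?Y ?r) ** (adjoint_matrix ?Y ** mat v))"
      by (simp add: X(2) matrix_mul_diff_right matrix_mul_uminus_right trace_sub)
    also have "trace (matrix_inv (gram ?Y ?r) ** (mat (cnj v) ** ?Y)) = cnj v * ?\<alpha>"
      by (simp add: trace_mat_mult mat_mult_commute matrix_mul_assoc flip: trace_mat_mult)
    also have "trace (matrix_inv (gram ?Y ?r) ** (adjoint_matrix ?Y ** mat v)) = v * cnj ?\<alpha>"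
      by (simp only: matrix_mul_assoc) (simp only: mat_mult_commute trace_mat_mult trace_inv_gram_adjoint[OF r])
    finally show ?thesis by simp
  qed
  have "((\<lambda>s::real. of_real (ln (Re (det (?X (of_real s))))) :: complex)
     has_vector_derivative of_real (- 2 * Re (cnj v * ?\<alpha>))) (at 0)"
    using log_det_path_derivative[OF X(3)] det_gram_pos[OF r, of ?Y] unfolding tr by (simp add: X(2))
  then have "((\<lambda>s::real. of_real (ln (Re (det (?X (of_real s))))) / of_real (2 * real CARD('n)) :: complex)
     has_vector_derivative of_real (- 2 * Re (cnj v * ?\<alpha>)) / of_real (2 * real CARD('n))) (at 0)"
    by (rule has_vector_derivative_divide)
  then show ?thesis unfolding X(1) Psi_eq by simp
qed

text \<open>Along the direction \<open>v\<close> the derivative of \<open>log det\<close> is \<open>- 2 Re (cnj v * \<alpha>)\<close> for one complex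
  number \<open>\<alpha>\<close>; the anti-holomorphic derivative picks out \<open>- \<alpha>\<close>.\<close>

lemma wirtinger_cnj_Psi:
  fixes M :: "complex^'n^'n"
  assumes w: "w \<noteq> 0"
  shows "wirtinger_cnj (\<lambda>z'. of_real (Psi M z' w)) z
     = - trace (matrix_inv (gram (M - mat z) ((cmod w)\<^sup>2)) ** (M - mat z)) / of_real (2 * real CARD('n))"
proof -
  let ?\<alpha> = "trace (matrix_inv (gram (M - mat z) ((cmod w)\<^sup>2)) ** (M - mat z))"
  have x: "partial_x (\<lambda>z'. of_real (Psi M z' w)) z = of_real (- 2 * Re ?\<alpha> / (2 * real CARD('n)))"
    unfolding partial_x_def
    using vector_derivative_at[OF Psi_derivative_z[OF w, of M z 1]] by simp
  have y: "partial_y (\<lambda>z'. of_real (Psi M z' w)) z = of_real (- 2 * Im ?\<alpha> / (2 * real CARD('n)))"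
    unfolding partial_y_def
    using vector_derivative_at[OF Psi_derivative_z[OF w, of M z \<i>]] by (simp add: mult.commute[of \<i>])
  show ?thesis unfolding wirtinger_cnj_def x y
    by (simp add: complex_eq_iff)
qed

lemma mixed_derivative_Psi_path:
  fixes M :: "complex^'n^'n" and v z :: complex
  assumes r: "r > 0"
  defines "Y \<equiv> M - mat z" and "G \<equiv> matrix_inv (gram (M - mat z) r)"
  shows "((\<lambda>s::real. trace (matrix_inv (gram (M - mat (z + of_real s * v)) r) ** (M - mat (z + of_real s * v))))
    has_vector_derivative (cnj v * trace (G ** Y ** G ** Y) + v * (trace (G ** adjoint_matrix Y ** G ** Y) - trace G))) (at 0)"
proof -
  let ?X = "gram_line M z v r"
  note X = gram_line_of_real[of M z v r] gram_line_0[of M z v r] has_entry_derivative_gram_line[of M z v r]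
  have G: "matrix_inv (?X 0) = G" by (simp add: X(2) G_def)
  have "det (?X 0) \<noteq> 0" using det_gram_nonzero[OF r, of "M - mat z"] by (simp add: X(2))
  from has_entry_derivative_matrix_inv[OF X(3) this]
  have 1: "has_entry_derivative (\<lambda>s. matrix_inv (?X s)) (- (G ** (- (mat (cnj v) ** Y) - adjoint_matrix Y ** mat v) ** G)) 0"
    by (simp only: G Y_def)
  have 2: "has_entry_derivative (\<lambda>s. (M - mat z) - mat (s * v)) (0 - mat v) 0"
    by (intro has_entry_derivative_diff has_entry_derivative_const has_entry_derivative_mat) (auto intro!: derivative_eq_intros)
  from has_vector_derivative_of_complex_path[OF DERIV_trace[OF has_entry_derivative_mult[OF 1 2]]]
  have "((\<lambda>s::real. trace (matrix_inv (?X (of_real s)) ** ((M - mat z) - mat (of_real s * v))))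
    has_vector_derivative trace (- (G ** (- (mat (cnj v) ** Y) - adjoint_matrix Y ** mat v) ** G) ** ((M - mat z) - mat (0 * v)) + matrix_inv (?X 0) ** (0 - mat v))) (at 0)" .
  moreover have "trace (- (G ** (- (mat (cnj v) ** Y) - adjoint_matrix Y ** mat v) ** G) ** ((M - mat z) - mat (0 * v)) + matrix_inv (?X 0) ** (0 - mat v))
     = cnj v * trace (G ** Y ** G ** Y) + v * (trace (G ** adjoint_matrix Y ** G ** Y) - trace G)"
  proof -
    have "- (G ** (- (mat (cnj v) ** Y) - adjoint_matrix Y ** mat v) ** G) ** ((M - mat z) - mat (0 * v)) + matrix_inv (?X 0) ** (0 - mat v)
       = mat (cnj v) ** (G ** Y ** G ** Y) + mat v ** (G ** adjoint_matrix Y ** G ** Y) - mat v ** G"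
    proof -
      have e1: "- (mat (cnj v) ** Y) - adjoint_matrix Y ** mat v = - (mat (cnj v) ** Y + mat v ** adjoint_matrix Y)"
        by (simp add: mat_mult_commute)
      have e2: "G ** (mat c ** A) ** G ** Y = mat c ** (G ** A ** G ** Y)" for c A
        by (simp only: matrix_mul_assoc mat_mult_commute[of G])
      have e3: "- (G ** (- (P + Q)) ** G) ** Y = G ** P ** G ** Y + G ** Q ** G ** Y" for P Q
        by (simp only: matrix_mul_uminus_left matrix_mul_uminus_right minus_minus matrix_add_ldistrib matrix_mul_add_left)
      have e4: "(M - mat z) - mat (0 * v) = Y" by (simp add: Y_def)
      show ?thesis
        unfolding e1 G e4 e3 e2 by (simp add: matrix_mul_uminus_right mat_mult_commute[of G])
    qed
    then show ?thesis by (simp add: trace_sub trace_add trace_mat_mult right_diff_distrib)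
  qed
  moreover have "(M - mat z) - mat (of_real s * v) = M - mat (z + of_real s * v)" for s
    by (simp add: vec_eq_iff mat_def)
  ultimately show ?thesis unfolding X(1) by simp
qed

text \<open>With \<open>G\<close> and \<open>K\<close> the inverses of \<open>Y' Y + r\<close> and \<open>Y Y' + r\<close>: the intertwining \<open>Y G = K Y\<close> gives
  \<open>Y G Y' = K Y Y' = 1 - r K\<close>, and cyclicity of the trace brings this product together. This identity
  produces the factor \<open>r\<close> in the density of \<^const>\<open>mu_Lambda\<close>.\<close>

lemma trace_gram_identity:
  fixes Y :: "complex^'n^'n"
  assumes r: "r > 0"
  defines "G \<equiv> matrix_inv (gram Y r)" and "K \<equiv> matrix_inv (gram (adjoint_matrix Y) r)"
  shows "trace G - trace (G ** adjoint_matrix Y ** G ** Y) = of_real r * trace (K ** G)"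
proof -
  let ?H = "gram Y r" and ?L = "gram (adjoint_matrix Y) r" and ?Y' = "adjoint_matrix Y"
  have iH: "?H ** G = mat 1" "G ** ?H = mat 1" and iL: "?L ** K = mat 1" "K ** ?L = mat 1"
    using matrix_inv_det_nz[OF det_gram_nonzero[OF r]] by (auto simp: G_def K_def)
  have "Y ** ?H = ?L ** Y"
    by (simp add: gram_def matrix_add_ldistrib matrix_mul_add_left matrix_mul_assoc mat_mult_commute)
  then have "K ** (Y ** ?H) ** G = K ** (?L ** Y) ** G" by simp
  then have "K ** Y ** (?H ** G) = (K ** ?L) ** Y ** G" by (simp only: matrix_mul_assoc)
  then have YG: "Y ** G = K ** Y" by (simp add: iH iL)
  have "Y ** ?Y' = ?L - mat (of_real r)" by (simp add: gram_def)
  then have "K ** (Y ** ?Y') = mat 1 - mat (of_real r) ** K"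
    by (simp add: matrix_mul_diff_right iL mat_mult_commute)
  then have YGY: "Y ** G ** ?Y' = mat 1 - mat (of_real r) ** K"
    by (simp add: YG flip: matrix_mul_assoc)
  have "trace (G ** ?Y' ** G ** Y) = trace (Y ** (G ** ?Y' ** G))"
    by (rule trace_mul_sym)
  also have "Y ** (G ** ?Y' ** G) = Y ** G ** ?Y' ** G" by (simp only: matrix_mul_assoc)
  also have "\<dots> = G - mat (of_real r) ** (K ** G)"
    unfolding YGY by (simp add: matrix_mul_diff_left flip: matrix_mul_assoc)
  finally show ?thesis by (simp add: trace_sub trace_mat_mult)
qed

lemma mixed_derivative_Psi:
  fixes M :: "complex^'n^'n"
  assumes w: "w \<noteq> 0"
  shows "wirtinger (wirtinger_cnj (\<lambda>z'. of_real (Psi M z' w))) z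
     = of_real ((cmod w)\<^sup>2) * trace (matrix_inv (gram (adjoint_matrix (M - mat z)) ((cmod w)\<^sup>2)) ** matrix_inv (gram (M - mat z) ((cmod w)\<^sup>2)))
        / of_real (2 * real CARD('n))"
proof -
  let ?r = "(cmod w)\<^sup>2" and ?Y = "M - mat z" and ?N = "of_real (2 * real CARD('n)) :: complex"
  let ?G = "matrix_inv (gram ?Y ?r)"
  let ?F = "wirtinger_cnj (\<lambda>z'. of_real (Psi M z' w))"
  have r: "?r > 0" using w by simp
  have F: "?F = (\<lambda>z. - trace (matrix_inv (gram (M - mat z) ?r) ** (M - mat z)) / ?N)"
    by (rule ext) (rule wirtinger_cnj_Psi[OF w])
  let ?A = "trace (?G ** ?Y ** ?G ** ?Y)" and ?B = "trace (?G ** adjoint_matrix ?Y ** ?G ** ?Y) - trace ?G"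
  have d: "((\<lambda>s::real. ?F (z + of_real s * v)) has_vector_derivative (- (cnj v * ?A + v * ?B) / ?N)) (at 0)" for v
    unfolding F
    by (intro has_vector_derivative_divide has_vector_derivative_minus mixed_derivative_Psi_path[OF r])
  have x: "partial_x ?F z = - (?A + ?B) / ?N"
    unfolding partial_x_def using vector_derivative_at[OF d[of 1]] by simp
  have y: "partial_y ?F z = - (cnj \<i> * ?A + \<i> * ?B) / ?N"
    unfolding partial_y_def using vector_derivative_at[OF d[of \<i>]] by (simp add: mult.commute[of \<i>])
  have "wirtinger ?F z = (- (?A + ?B) / ?N - \<i> * (- (cnj \<i> * ?A + \<i> * ?B) / ?N)) / 2"
    by (simp only: wirtinger_def x y)
  also have "\<dots> = - ?B / ?N"
    by (simp add: field_simps)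
  also have "- ?B = of_real ?r * trace (matrix_inv (gram (adjoint_matrix ?Y) ?r) ** ?G)"
    using trace_gram_identity[OF r, of ?Y] by simp
  finally show ?thesis .
qed

section \<open>Diagonalization\<close>

definition diag_matrix :: "('n \<Rightarrow> 'a::zero) \<Rightarrow> 'a^'n^'n" where
  "diag_matrix d = (\<chi> i j. if i = j then d i else 0)"

lemma det_diag_matrix: "det (diag_matrix d :: 'a::comm_ring_1^'n^'n) = (\<Prod>i\<in>UNIV. d i)"
  by (subst det_diagonal) (auto simp: diag_matrix_def)

lemma mult_diag_matrix_nth: "(A ** diag_matrix d) $ i $ j = A $ i $ j * d j" for A :: "'a::comm_semiring_1^'n^'m"
proof -
  have "(\<Sum>k\<in>UNIV. A $ i $ k * (if k = j then d k else 0)) = (\<Sum>k\<in>UNIV. if k = j then A $ i $ j * d j else 0)"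
    by (intro sum.cong) auto
  then show ?thesis by (simp add: matrix_matrix_mult_def diag_matrix_def)
qed

lemma adjugate_diag_matrix:
  "adjugate (diag_matrix d :: 'a::field^'n^'n) = diag_matrix (\<lambda>i. \<Prod>k\<in>UNIV - {i}. d k)"
proof -
  have "adjugate (diag_matrix d :: 'a^'n^'n) $ j $ i = (if j = i then \<Prod>k\<in>UNIV - {i}. d k else 0)" for i j
  proof (cases "j = i")
    case True
    have "det (\<chi> k. if k = i then axis i 1 else (diag_matrix d :: 'a^'n^'n) $ k) = (\<Prod>k\<in>UNIV. if k = i then 1 else d k)"
      by (subst det_diagonal) (auto simp: diag_matrix_def axis_def intro!: prod.cong)
    also have "\<dots> = (\<Prod>k\<in>UNIV - {i}. d k)"
      by (subst prod.remove[of _ i]) (auto intro!: prod.cong)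
    finally show ?thesis using True by (simp add: adjugate_def)
  next
    case False
    have "det (\<chi> k. if k = i then axis j 1 else (diag_matrix d :: 'a^'n^'n) $ k) = 0"
      by (rule det_zero_column(2)[of i]) (use False in \<open>auto simp: column_def vec_eq_iff diag_matrix_def axis_def\<close>)
    then show ?thesis using False by (simp add: adjugate_def)
  qed
  then show ?thesis by (simp add: vec_eq_iff diag_matrix_def)
qed

lemma eigensystem_mult:
  assumes "eigensystem M L S"
  shows "M ** S = S ** diag_matrix L"
proof -
  have "(M ** S) $ i $ j = S $ i $ j * L j" for i j
  proof -
    have "(M *v column j S) $ i = (L j *s column j S) $ i"
      using assms by (simp add: eigensystem_def eigenvector_def)
    then show ?thesis
      by (simp add: matrix_vector_mult_def matrix_matrix_mult_def column_def mult.commute)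
  qed
  then show ?thesis by (simp add: vec_eq_iff mult_diag_matrix_nth)
qed

text \<open>Eigenvectors for distinct eigenvalues are independent: applying the product of all \<open>M - L i\<close> with
  \<open>i \<noteq> j\<close> to a vanishing combination of eigenvectors leaves a nonzero multiple of the \<open>j\<close>-th term.\<close>

lemma eigensystem_det_nonzero:
  fixes M S :: "complex^'n^'n"
  assumes es: "eigensystem M L S"
  shows "det S \<noteq> 0"
proof -
  have inj: "inj L" using es by (simp add: eigensystem_def bij_betw_def)
  have col: "column j S \<noteq> 0" for j using es by (simp add: eigensystem_def eigenvector_def)
  have step: "(M - mat c) *v (S *v y) = S *v (\<chi> k. (L k - c) * y $ k)" for c y
  proof -
    have "(M - mat c) *v (S *v y) = (M ** S) *v y - c *s (S *v y)"
      by (simp only: matrix_vector_mult_diff_rdistrib matrix_vector_mul_assoc[of M S y] mat_mult_vector)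
    also have "\<dots> = S *v (\<chi> k. (L k - c) * y $ k)"
      unfolding eigensystem_mult[OF es]
      by (simp add: vec_eq_iff matrix_vector_mult_def mult_diag_matrix_nth sum_distrib_left sum_subtractf algebra_simps)
    finally show ?thesis .
  qed
  have "x = 0" if x: "S *v x = 0" for x
  proof -
    have filt: "S *v (\<chi> k. (\<Prod>i\<in>A. L k - L i) * x $ k) = 0" if "finite A" for A
      using that
    proof induction
      case empty
      then show ?case using x by simp
    next
      case (insert a A)
      have "S *v (\<chi> k. (\<Prod>i\<in>insert a A. L k - L i) * x $ k) = (M - mat (L a)) *v (S *v (\<chi> k. (\<Prod>i\<in>A. L k - L i) * x $ k))"
        using insert.hyps by (simp add: step mult.assoc)
      also have "\<dots> = 0" by (simp only: insert.IH matrix_vector_mult_0_right)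
      finally show ?case .
    qed
    have "x $ j = 0" for j
    proof -
      let ?c = "\<Prod>i\<in>UNIV - {j}. L j - L i"
      have c: "?c \<noteq> 0" using inj by (auto simp: inj_eq)
      (* for k different from j the product contains the factor L k - L k *)
      have v: "(\<chi> k. (\<Prod>i\<in>UNIV - {j}. L k - L i) * x $ k) = (\<chi> k. if k = j then ?c * x $ j else 0)"
        by (auto simp: vec_eq_iff intro!: prod_zero)
      have "S *v (\<chi> k. if k = j then ?c * x $ j else 0) = (?c * x $ j) *s column j S"
      proof -
        have "(\<Sum>k\<in>UNIV. S $ i $ k * (if k = j then ?c * x $ j else 0)) = (\<Sum>k\<in>UNIV. if k = j then S $ i $ j * (?c * x $ j) else 0)" for i
          by (intro sum.cong) auto
        then show ?thesis by (simp add: vec_eq_iff matrix_vector_mult_def column_def mult.commute)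
      qed
      then have "(?c * x $ j) *s column j S = 0" using filt[of "UNIV - {j}"] v by simp
      then show ?thesis using col[of j] c by simp
    qed
    then show "x = 0" by (simp add: vec_eq_iff)
  qed
  then have "invertible S" by (simp add: invertible_left_inverse matrix_left_invertible_ker)
  then show ?thesis by (simp add: invertible_det_nz)
qed

lemma eigensystem_diagonalizes:
  fixes M S :: "complex^'n^'n"
  assumes es: "eigensystem M L S"
  shows "M - mat z = S ** diag_matrix (\<lambda>k. L k - z) ** matrix_inv S"
proof -
  have S: "S ** matrix_inv S = mat 1" by (rule matrix_inv_det_nz[OF eigensystem_det_nonzero[OF es]])
  have d: "diag_matrix (\<lambda>k. L k - z) = diag_matrix L - mat z"
    by (simp add: vec_eq_iff diag_matrix_def mat_def)
  have "S ** diag_matrix (\<lambda>k. L k - z) ** matrix_inv S = (M - mat z) ** (S ** matrix_inv S)"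
    by (simp add: d matrix_mul_diff_left matrix_mul_diff_right eigensystem_mult[OF es, symmetric] mat_mult_commute matrix_mul_assoc)
  then show ?thesis by (simp add: S)
qed

lemma eigensystem_det:
  fixes M S :: "complex^'n^'n"
  assumes es: "eigensystem M L S"
  shows "det (M - mat z) = (\<Prod>k\<in>UNIV. L k - z)"
proof -
  have "det S * det (matrix_inv S) = 1"
    using matrix_inv_det_nz(1)[OF eigensystem_det_nonzero[OF es]] by (metis det_mul det_I)
  then show ?thesis
    by (simp add: eigensystem_diagonalizes[OF es, of z] det_mul det_diag_matrix mult.commute)
qed

text \<open>In the eigenbasis the adjugate at an eigenvalue has a single nonzero diagonal entry, so it is the
  rank-one product of a right eigenvector and the dual left eigenvector.\<close>

lemma eigensystem_adjugate:
  fixes M S :: "complex^'n^'n"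
  assumes es: "eigensystem M L S"
  shows "adjugate (M - mat (L j)) $ a $ b = (\<Prod>k\<in>UNIV - {j}. L k - L j) * S $ a $ j * matrix_inv S $ j $ b"
proof -
  let ?S' = "matrix_inv S" and ?d = "\<lambda>i. \<Prod>k\<in>UNIV - {i}. L k - L j"
  have nz: "det S \<noteq> 0" by (rule eigensystem_det_nonzero[OF es])
  have dd: "det S * det ?S' = 1"
    using matrix_inv_det_nz(1)[OF nz] by (metis det_mul det_I)
  have "adjugate (M - mat (L j)) = adjugate ?S' ** (adjugate (diag_matrix (\<lambda>k. L k - L j)) ** adjugate S)"
    unfolding eigensystem_diagonalizes[OF es, of "L j"] adjugate_mult ..
  also have "adjugate ?S' = mat (det ?S') ** S"
    by (rule adjugate_of_left_inverse[OF matrix_inv_det_nz(1)[OF nz]])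
  also have "adjugate S = mat (det S) ** ?S'" by (rule adjugate_eq_det_inv[OF nz])
  also have "mat (det ?S') ** S ** (adjugate (diag_matrix (\<lambda>k. L k - L j)) ** (mat (det S) ** ?S'))
     = mat (det ?S') ** (S ** adjugate (diag_matrix (\<lambda>k. L k - L j)) ** (mat (det S) ** ?S'))"
    by (simp only: matrix_mul_assoc)
  finally have A: "adjugate (M - mat (L j)) = mat (det ?S') ** (S ** diag_matrix ?d ** (mat (det S) ** ?S'))"
    unfolding adjugate_diag_matrix .
  have d0: "?d i = 0" if "i \<noteq> j" for i
    using that by (intro prod_zero) auto
  have "adjugate (M - mat (L j)) $ a $ b = det ?S' * (\<Sum>k\<in>UNIV. S $ a $ k * ?d k * (det S * ?S' $ k $ b))"
    unfolding A mat_mult_nth by (simp add: matrix_matrix_mult_def[of "S ** _"] mult_diag_matrix_nth)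
  also have "(\<Sum>k\<in>UNIV. S $ a $ k * ?d k * (det S * ?S' $ k $ b)) = (\<Sum>k\<in>{j}. S $ a $ k * ?d k * (det S * ?S' $ k $ b))"
    by (rule sum.mono_neutral_right) (auto simp: d0)
  also have "det ?S' * \<dots> = (det S * det ?S') * (?d j * S $ a $ j * ?S' $ j $ b)"
    by (simp add: mult_ac)
  finally show ?thesis by (simp add: dd)
qed

lemma sum_cnj_mult_self: "(\<Sum>i\<in>A. cnj (f i) * f i) = of_real (\<Sum>i\<in>A. (cmod (f i))\<^sup>2)"
  by (simp add: complex_norm_square mult.commute flip: of_real_power)

text \<open>With \<open>A\<close> the Gram matrix of the columns of \<open>S\<close>, its \<open>j\<close>-th diagonal entry is the squared norm of the right
  eigenvector, and that of its inverse is the squared norm of the dual left eigenvector.\<close>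

lemma overlap_eq:
  fixes S :: "complex^'n^'n"
  assumes "det S \<noteq> 0"
  shows "overlap S j = of_real ((\<Sum>a\<in>UNIV. (cmod (S $ a $ j))\<^sup>2) * (\<Sum>b\<in>UNIV. (cmod (matrix_inv S $ j $ b))\<^sup>2))"
proof -
  let ?S' = "matrix_inv S"
  have "?S' ** adjoint_matrix ?S' ** (adjoint_matrix S ** S) = ?S' ** (adjoint_matrix (S ** ?S')) ** S"
    by (simp add: adjoint_matrix_mult matrix_mul_assoc)
  also have "\<dots> = mat 1" by (simp add: matrix_inv_det_nz[OF assms])
  finally have "matrix_inv (adjoint_matrix S ** S) = ?S' ** adjoint_matrix ?S'"
    by (rule matrix_inv_unique_left)
  then have "overlap S j = (\<Sum>b\<in>UNIV. ?S' $ j $ b * cnj (?S' $ j $ b)) * (\<Sum>a\<in>UNIV. cnj (S $ a $ j) * S $ a $ j)"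
    by (simp add: overlap_def matrix_matrix_mult_def)
  also have "(\<Sum>b\<in>UNIV. ?S' $ j $ b * cnj (?S' $ j $ b)) = of_real (\<Sum>b\<in>UNIV. (cmod (?S' $ j $ b))\<^sup>2)"
    using sum_cnj_mult_self[of "\<lambda>b. ?S' $ j $ b" UNIV] by (simp add: mult.commute)
  finally show ?thesis by (simp add: sum_cnj_mult_self)
qed

lemma overlap_pos:
  fixes M S :: "complex^'n^'n"
  assumes es: "eigensystem M L S"
  shows "Re (overlap S j) > 0"
proof -
  let ?S' = "matrix_inv S"
  have nz: "det S \<noteq> 0" by (rule eigensystem_det_nonzero[OF es])
  have "column j S \<noteq> 0" using es by (simp add: eigensystem_def eigenvector_def)
  then obtain a where a: "S $ a $ j \<noteq> 0" by (auto simp: vec_eq_iff column_def)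
  have "(?S' ** S) $ j $ j = 1" by (simp add: matrix_inv_det_nz[OF nz] mat_def)
  then have "(\<Sum>k\<in>UNIV. ?S' $ j $ k * S $ k $ j) \<noteq> 0" by (simp add: matrix_matrix_mult_def)
  then obtain b where b: "?S' $ j $ b \<noteq> 0" by (metis (mono_tags, lifting) mult_zero_left sum.neutral)
  have "(\<Sum>a\<in>UNIV. (cmod (S $ a $ j))\<^sup>2) > 0" by (rule sum_pos2[of _ a]) (use a in auto)
  moreover have "(\<Sum>b\<in>UNIV. (cmod (?S' $ j $ b))\<^sup>2) > 0" by (rule sum_pos2[of _ b]) (use b in auto)
  ultimately show ?thesis by (simp add: overlap_eq[OF nz])
qed

text \<open>Let \<open>C\<close> be the adjugate of \<open>M - L j\<close> and \<open>C'\<close> its adjoint. The first trace is \<open>tr (C C')\<close>, a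
  product of squared norms. The second is \<open>tr (C' C C C')\<close>, and since \<open>C\<close> is \<open>q j\<close> times a
  projection, \<open>C C = q j C\<close> reduces it to the first.\<close>

lemma trace_adjugate_gram_at_eigenvalue:
  fixes M S :: "complex^'n^'n"
  assumes es: "eigensystem M L S"
  defines "q \<equiv> \<lambda>j. \<Prod>k\<in>UNIV - {j}. L k - L j"
  shows "trace (adjugate (gram (M - mat (L j)) 0)) = of_real ((cmod (q j))\<^sup>2 * Re (overlap S j))"
    and "trace (adjugate (gram (adjoint_matrix (M - mat (L j))) 0) ** adjugate (gram (M - mat (L j)) 0))
        = of_real ((cmod (q j)) ^ 4 * Re (overlap S j))"
proof -
  let ?Y = "M - mat (L j)" and ?S' = "matrix_inv S"
  define C where "C = adjugate ?Y"
  have nz: "det S \<noteq> 0" by (rule eigensystem_det_nonzero[OF es])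
  have C: "C $ a $ b = q j * S $ a $ j * ?S' $ j $ b" for a b
    by (simp add: C_def q_def eigensystem_adjugate[OF es])
  have g1: "adjugate (gram ?Y 0) = C ** adjoint_matrix C"
    by (simp add: gram_def adjugate_mult adjugate_adjoint_matrix C_def)
  have g2: "adjugate (gram (adjoint_matrix ?Y) 0) = adjoint_matrix C ** C"
    by (simp add: gram_def adjugate_mult adjugate_adjoint_matrix C_def)
  have "trace (C ** adjoint_matrix C) = (\<Sum>a\<in>UNIV. \<Sum>b\<in>UNIV. C $ a $ b * cnj (C $ a $ b))"
    by (simp add: trace_def matrix_matrix_mult_def)
  also have "\<dots> = (\<Sum>a\<in>UNIV. \<Sum>b\<in>UNIV. of_real ((cmod (q j))\<^sup>2 * (cmod (S $ a $ j))\<^sup>2 * (cmod (?S' $ j $ b))\<^sup>2))"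
    by (intro sum.cong refl) (simp only: C complex_norm_square of_real_mult complex_cnj_mult mult_ac)
  also have "\<dots> = of_real (\<Sum>a\<in>UNIV. \<Sum>b\<in>UNIV. (cmod (q j))\<^sup>2 * (cmod (S $ a $ j))\<^sup>2 * (cmod (?S' $ j $ b))\<^sup>2)"
    by (simp only: of_real_sum)
  also have "(\<Sum>a\<in>UNIV. \<Sum>b\<in>UNIV. (cmod (q j))\<^sup>2 * (cmod (S $ a $ j))\<^sup>2 * (cmod (?S' $ j $ b))\<^sup>2)
      = (cmod (q j))\<^sup>2 * Re (overlap S j)"
    by (simp only: overlap_eq[OF nz] Re_complex_of_real sum_product) (simp only: sum_distrib_left mult.assoc)
  finally have t1: "trace (C ** adjoint_matrix C) = of_real ((cmod (q j))\<^sup>2 * Re (overlap S j))" .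
  then show "trace (adjugate (gram ?Y 0)) = of_real ((cmod (q j))\<^sup>2 * Re (overlap S j))"
    by (simp add: g1)
  have "(?S' ** S) $ j $ j = 1" by (simp add: matrix_inv_det_nz[OF nz] mat_def)
  then have one: "(\<Sum>k\<in>UNIV. ?S' $ j $ k * S $ k $ j) = 1" by (simp add: matrix_matrix_mult_def)
  have CC: "C ** C = mat (q j) ** C"
  proof -
    have "(C ** C) $ a $ b = q j * C $ a $ b" for a b
    proof -
      have "(C ** C) $ a $ b = (\<Sum>k\<in>UNIV. (q j * q j * S $ a $ j * ?S' $ j $ b) * (?S' $ j $ k * S $ k $ j))"
        by (simp add: matrix_matrix_mult_def C mult_ac)
      also have "\<dots> = q j * q j * S $ a $ j * ?S' $ j $ b"
        by (subst sum_distrib_left[symmetric]) (simp add: one)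
      finally show ?thesis by (simp add: C mult_ac)
    qed
    then show ?thesis by (simp add: vec_eq_iff)
  qed
  let ?D = "adjoint_matrix C"
  have DD: "?D ** ?D = mat (cnj (q j)) ** ?D"
  proof -
    have "adjoint_matrix (C ** C) = adjoint_matrix (mat (q j) ** C)" by (simp add: CC)
    then show ?thesis by (simp add: adjoint_matrix_mult mat_mult_commute)
  qed
  have "trace ((?D ** C) ** (C ** ?D)) = trace (?D ** (C ** C ** ?D))"
    by (simp only: matrix_mul_assoc)
  also have "\<dots> = trace ((C ** C ** ?D) ** ?D)" by (rule trace_mul_sym)
  also have "(C ** C ** ?D) ** ?D = (C ** C) ** (?D ** ?D)" by (simp only: matrix_mul_assoc)
  also have "\<dots> = (mat (q j) ** C) ** (mat (cnj (q j)) ** ?D)" unfolding CC DD ..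
  also have "\<dots> = mat (q j) ** (mat (cnj (q j)) ** (C ** ?D))"
    by (metis mat_mult_commute matrix_mul_assoc)
  also have "trace \<dots> = q j * cnj (q j) * trace (C ** ?D)" by (simp add: trace_mat_mult)
  also have "\<dots> = of_real ((cmod (q j)) ^ 4 * Re (overlap S j))"
    unfolding t1 complex_norm_square[symmetric] by (simp add: power4_eq_xxxx power2_eq_square)
  finally show "trace (adjugate (gram (adjoint_matrix ?Y) 0) ** adjugate (gram ?Y 0)) = of_real ((cmod (q j)) ^ 4 * Re (overlap S j))"
    unfolding g1 g2 .
qed

section \<open>Concentration for a fixed matrix\<close>

text \<open>The function \<open>p\<close>, and after it the numerators of the densities of \<^const>\<open>mu_O\<close> and \<^const>\<open>mu_Lambda\<close> once
  inverses are replaced by adjugates.\<close>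

definition det_gram_fun :: "complex^'n^'n \<Rightarrow> complex \<times> real \<Rightarrow> real" where
  "det_gram_fun M x = Re (det (gram (M - mat (fst x)) (snd x)))"

definition minor_fun :: "complex^'n^'n \<Rightarrow> complex \<times> real \<Rightarrow> real" where
  "minor_fun M x = Re (trace (adjugate (gram (M - mat (fst x)) (snd x))))"

definition mixed_minor_fun :: "complex^'n^'n \<Rightarrow> complex \<times> real \<Rightarrow> real" where
  "mixed_minor_fun M x = Re (trace (adjugate (gram (adjoint_matrix (M - mat (fst x))) (snd x)) ** adjugate (gram (M - mat (fst x)) (snd x))))"

lemma continuous_on_det_gram_fun: "continuous_on A (det_gram_fun M)"
  unfolding continuous_on_def det_gram_fun_def by (intro ballI tendsto_intros)

lemma continuous_on_minor_fun: "continuous_on A (minor_fun M)"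
  unfolding continuous_on_def minor_fun_def by (intro ballI tendsto_intros)

lemma continuous_on_mixed_minor_fun: "continuous_on A (mixed_minor_fun M)"
  unfolding continuous_on_def mixed_minor_fun_def by (intro ballI tendsto_intros)

lemma det_gram_fun_0: "det_gram_fun M (z, 0) = (cmod (det (M - mat z)))\<^sup>2"
  by (simp add: det_gram_fun_def det_gram_0)

lemma DERIV_det_gram_fun: "((\<lambda>r. det_gram_fun M (z, r)) has_real_derivative minor_fun M (z, r)) (at r)"
proof -
  let ?Y = "M - mat z"
  have "has_entry_derivative (\<lambda>s. adjoint_matrix ?Y ** ?Y + mat s) (0 + mat 1) (of_real r)"
    by (intro has_entry_derivative_add has_entry_derivative_const has_entry_derivative_mat) (auto intro!: derivative_eq_intros)
  from has_vector_derivative_real_field[OF DERIV_det[OF this]]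
  have "((\<lambda>r. det (gram ?Y r)) has_vector_derivative trace (adjugate (gram ?Y r))) (at r)"
    by (simp add: gram_def)
  then show ?thesis
    by (simp add: det_gram_fun_def minor_fun_def has_vector_derivative_complex_iff)
qed

text \<open>This isolates the first-order behaviour of \<open>p\<close> at \<open>r = 0\<close>: the intermediate point tends to zero
  with \<open>r\<close>.\<close>

lemma det_gram_fun_mean_value:
  assumes "r > 0"
  shows "\<exists>\<xi>. 0 < \<xi> \<and> \<xi> < r \<and> det_gram_fun M (z, r) = (cmod (det (M - mat z)))\<^sup>2 + r * minor_fun M (z, \<xi>)"
proof -
  have "\<exists>\<xi>. \<xi> > 0 \<and> \<xi> < r \<and> det_gram_fun M (z, r) - det_gram_fun M (z, 0) = (r - 0) * minor_fun M (z, \<xi>)"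
    by (rule MVT2[OF assms DERIV_det_gram_fun])
  then show ?thesis unfolding det_gram_fun_0 by (auto simp: algebra_simps)
qed

lemma trace_inv_gram_eq_minor_fun:
  assumes "r > 0"
  shows "Re (trace (matrix_inv (gram (M - mat z) r))) = minor_fun M (z, r) / det_gram_fun M (z, r)"
proof -
  let ?H = "gram (M - mat z) r"
  have nz: "det ?H \<noteq> 0" by (rule det_gram_nonzero[OF assms])
  have "trace (adjugate ?H) = det ?H * trace (matrix_inv ?H)"
    by (simp add: adjugate_eq_det_inv[OF nz] trace_mat_mult)
  also have "det ?H = of_real (Re (det ?H))" by (rule det_gram_eq_of_real)
  finally show ?thesis
    using det_gram_pos[OF assms, of "M - mat z"] by (simp add: minor_fun_def det_gram_fun_def)
qed

lemma mat_mult_left_commute: "A ** (mat c ** B) = mat c ** (A ** B)" for A :: "'a::comm_semiring_1^'n^'m"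
  by (simp only: matrix_mul_assoc mat_mult_commute)

lemma trace_inv_gram_product_eq:
  assumes "r > 0"
  shows "Re (trace (matrix_inv (gram (adjoint_matrix (M - mat z)) r) ** matrix_inv (gram (M - mat z) r)))
     = mixed_minor_fun M (z, r) / (det_gram_fun M (z, r))\<^sup>2"
proof -
  let ?H = "gram (M - mat z) r" and ?K = "gram (adjoint_matrix (M - mat z)) r"
  have nz: "det ?H \<noteq> 0" "det ?K \<noteq> 0" by (rule det_gram_nonzero[OF assms])+
  have "adjugate ?K ** adjugate ?H = mat (det ?K) ** (mat (det ?H) ** (matrix_inv ?K ** matrix_inv ?H))"
    unfolding adjugate_eq_det_inv[OF nz(1)] adjugate_eq_det_inv[OF nz(2)]
    by (simp only: matrix_mul_assoc[symmetric] mat_mult_left_commute[of "matrix_inv ?K"])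
  then have "trace (adjugate ?K ** adjugate ?H) = det ?K * (det ?H * trace (matrix_inv ?K ** matrix_inv ?H))"
    by (simp add: trace_mat_mult)
  also have "det ?K = det ?H" by (rule det_gram_adjoint)
  also have "det ?H = of_real (Re (det ?H))" by (rule det_gram_eq_of_real)
  finally show ?thesis
    using det_gram_pos[OF assms, of "M - mat z"] by (simp add: mixed_minor_fun_def det_gram_fun_def power2_eq_square)
qed

lemma ennreal_max_0: "ennreal (max 0 x) = ennreal x"
  by (cases "x \<ge> 0") (auto simp: max_def ennreal_neg)

text \<open>The truncation at zero changes nothing under \<^const>\<open>ennreal\<close> and makes the numerator
  nonnegative by construction.\<close>

lemma mu_Lambda_eq:
  fixes M :: "complex^'n^'n"
  assumes w: "w \<noteq> 0"
  shows "mu_Lambda M w = density lborel (\<lambda>z. ennreal ((cmod w)\<^sup>2 * (max 0 (mixed_minor_fun M (z, (cmod w)\<^sup>2)) / (pi * real CARD('n)))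
      / (det_gram_fun M (z, (cmod w)\<^sup>2))\<^sup>2))"
proof -
  let ?r = "(cmod w)\<^sup>2"
  have r: "?r > 0" using w by simp
  have "ennreal (2 / pi * Re (wirtinger (wirtinger_cnj (\<lambda>z'. of_real (Psi M z' w))) z))
     = ennreal (?r * (max 0 (mixed_minor_fun M (z, ?r)) / (pi * real CARD('n))) / (det_gram_fun M (z, ?r))\<^sup>2)" for z
  proof -
    let ?c = "?r / (pi * real CARD('n) * (det_gram_fun M (z, ?r))\<^sup>2)"
    have "Re (wirtinger (wirtinger_cnj (\<lambda>z'. of_real (Psi M z' w))) z)
       = ?r * (mixed_minor_fun M (z, ?r) / (det_gram_fun M (z, ?r))\<^sup>2) / (2 * real CARD('n))"
      unfolding mixed_derivative_Psi[OF w] trace_inv_gram_product_eq[OF r, symmetric]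
      by (simp only: Re_divide_of_real Re_complex_of_real times_complex.sel Im_complex_of_real) simp
    then have e: "2 / pi * Re (wirtinger (wirtinger_cnj (\<lambda>z'. of_real (Psi M z' w))) z) = ?c * mixed_minor_fun M (z, ?r)"
      by simp
    have "ennreal (?c * mixed_minor_fun M (z, ?r)) = ennreal (max 0 (?c * mixed_minor_fun M (z, ?r)))"
      by (rule ennreal_max_0[symmetric])
    also have "max 0 (?c * mixed_minor_fun M (z, ?r)) = ?c * max 0 (mixed_minor_fun M (z, ?r))"
      by (simp add: max_mult_distrib_left)
    finally show ?thesis unfolding e by (simp add: mult_ac)
  qed
  then show ?thesis unfolding mu_Lambda_def by simp
qed

lemma mu_O_eq:
  fixes M :: "complex^'n^'n"
  assumes w: "w \<noteq> 0"
  shows "mu_O M w = density lborel (\<lambda>z. ennreal ((cmod w)\<^sup>2 * ((minor_fun M (z, (cmod w)\<^sup>2))\<^sup>2 / (pi * (real CARD('n))\<^sup>2))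
      / (det_gram_fun M (z, (cmod w)\<^sup>2))\<^sup>2))"
proof -
  let ?r = "(cmod w)\<^sup>2"
  have r: "?r > 0" using w by simp
  have "4 / pi * (cmod (wirtinger (\<lambda>w'. complex_of_real (Psi M z w')) w))\<^sup>2
     = ?r * ((minor_fun M (z, ?r))\<^sup>2 / (pi * (real CARD('n))\<^sup>2)) / (det_gram_fun M (z, ?r))\<^sup>2" for z
    unfolding wirtinger_Psi_w[OF w] trace_inv_gram_eq_minor_fun[OF r] norm_mult complex_mod_cnj norm_of_real power_mult_distrib power2_abs
    by (simp add: power_divide power_mult_distrib field_simps)
  then show ?thesis unfolding mu_O_def by simp
qed

lemma integral_density_kernel:
  fixes p h :: "complex \<times> real \<Rightarrow> real" and \<phi> :: "complex \<Rightarrow> complex"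
  assumes "continuous_on UNIV p" "continuous_on UNIV h" "\<And>x. h x \<ge> 0" "\<And>z. p (z, e\<^sup>2) > 0"
    and [measurable]: "\<phi> \<in> borel_measurable borel"
  shows "(\<integral>z. \<phi> z \<partial>density lborel (\<lambda>z. ennreal (pole_density h p e z)))
      = (\<integral>z. (pole_density h p e z) *\<^sub>R \<phi> z \<partial>lborel)"
proof (rule integral_density)
  have c: "continuous_on UNIV (\<lambda>z. p (z, e\<^sup>2))" "continuous_on UNIV (\<lambda>z. h (z, e\<^sup>2))"
    by (auto intro!: continuous_on_compose2[OF assms(1)] continuous_on_compose2[OF assms(2)] continuous_intros)
  then have "continuous_on UNIV (\<lambda>z. pole_density h p e z)"
    using less_imp_neq[OF assms(4), symmetric]
    by (intro continuous_on_divide continuous_on_mult continuous_on_power continuous_on_const) simp_all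
  then show "(\<lambda>z. pole_density h p e z) \<in> borel_measurable lborel"
    by (simp add: borel_measurable_continuous_onI)
  show "AE z in lborel. 0 \<le> pole_density h p e z"
    using assms(3) by simp
qed simp

lemma filterlim_cmod_at_right_0: "filterlim cmod (at_right 0) (at 0)"
  unfolding filterlim_at
  by (auto intro!: tendsto_eq_intros simp: eventually_at_filter)

text \<open>At \<open>z = L j\<close> this is the squared modulus of the derivative of the characteristic polynomial.\<close>

definition eigen_gap :: "('n::finite \<Rightarrow> complex) \<Rightarrow> 'n \<Rightarrow> complex \<Rightarrow> real" where
  "eigen_gap L j z = (\<Prod>k\<in>UNIV - {j}. (cmod (L k - z))\<^sup>2)"

lemma continuous_on_eigen_gap: "continuous_on A (eigen_gap L j)"
  unfolding eigen_gap_def by (intro continuous_intros)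

lemma eigen_gap_pos: "inj L \<Longrightarrow> eigen_gap L j (L j) > 0"
  unfolding eigen_gap_def by (intro prod_pos) (auto simp: inj_eq)

lemma eigen_gap_at_eigenvalue: "(cmod (\<Prod>k\<in>UNIV - {j}. L k - L j))\<^sup>2 = eigen_gap L j (L j)"
  unfolding eigen_gap_def by (simp add: prod_norm[symmetric] prod_power_distrib)

lemma norm_det_factor:
  assumes "eigensystem M L S"
  shows "(cmod (det (M - mat z)))\<^sup>2 = (cmod (z - L j))\<^sup>2 * eigen_gap L j z"
  unfolding eigensystem_det[OF assms] eigen_gap_def
  by (subst prod.remove[of _ j]) (auto simp: norm_mult power_mult_distrib prod_norm[symmetric] prod_power_distrib norm_minus_commute)

lemma minor_fun_at_eigenvalue:
  assumes "eigensystem M L S"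
  shows "minor_fun M (L j, 0) = eigen_gap L j (L j) * Re (overlap S j)"
  unfolding minor_fun_def fst_conv snd_conv trace_adjugate_gram_at_eigenvalue(1)[OF assms] Re_complex_of_real eigen_gap_at_eigenvalue ..

lemma mixed_minor_fun_at_eigenvalue:
  assumes "eigensystem M L S"
  shows "mixed_minor_fun M (L j, 0) = (eigen_gap L j (L j))\<^sup>2 * Re (overlap S j)"
proof -
  have "(cmod (\<Prod>k\<in>UNIV - {j}. L k - L j)) ^ 4 = (eigen_gap L j (L j))\<^sup>2"
    unfolding eigen_gap_at_eigenvalue[symmetric] by simp
  then show ?thesis
    unfolding mixed_minor_fun_def fst_conv snd_conv trace_adjugate_gram_at_eigenvalue(2)[OF assms] Re_complex_of_real by simp
qed

text \<open>Both coefficients in \<open>p(z, r) = |z - L j|\<^sup>2 eigen_gap + r minor_fun\<close> are positive at the eigenvalue,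
  hence bounded below near it.\<close>

lemma det_gram_fun_lower_bound:
  assumes es: "eigensystem M L S"
  shows "\<exists>c>0. \<exists>d>0. quadratic_bound (det_gram_fun M) (L j) c d"
proof -
  have inj: "inj L" using es by (simp add: eigensystem_def bij_betw_def)
  let ?g = "eigen_gap L j (L j)" and ?m = "minor_fun M (L j, 0)"
  have g: "?g > 0" by (rule eigen_gap_pos[OF inj])
  have m: "?m > 0" unfolding minor_fun_at_eigenvalue[OF es] using g overlap_pos[OF es] by simp
  have "isCont (eigen_gap L j) (L j)" using continuous_on_eigen_gap[of UNIV L j] by (simp add: continuous_on_eq_continuous_at)
  then obtain d1 where d1: "d1 > 0" "\<And>z. dist z (L j) < d1 \<Longrightarrow> dist (eigen_gap L j z) ?g < ?g / 2"
    using g unfolding continuous_at_eps_delta by (meson half_gt_zero)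
  have "isCont (minor_fun M) (L j, 0)" using continuous_on_minor_fun[of UNIV M] by (simp add: continuous_on_eq_continuous_at)
  then obtain d2 where d2: "d2 > 0" "\<And>x. dist x (L j, 0) < d2 \<Longrightarrow> dist (minor_fun M x) ?m < ?m / 2"
    using m unfolding continuous_at_eps_delta by (meson half_gt_zero)
  define c where "c = min (?g / 2) (?m / 2)"
  define d where "d = min d1 (d2 / 2)"
  show ?thesis
  proof (intro exI conjI ballI allI impI)
    show "c > 0" using g m by (simp add: c_def)
    show "d > 0" using d1 d2 by (simp add: d_def)
    fix z r assume z: "z \<in> ball (L j) d" and r: "0 < r \<and> r < d"
    obtain \<xi> where \<xi>: "0 < \<xi>" "\<xi> < r" and eq: "det_gram_fun M (z, r) = (cmod (det (M - mat z)))\<^sup>2 + r * minor_fun M (z, \<xi>)"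
      using det_gram_fun_mean_value[of r M z] r by blast
    have "dist (z, \<xi>) (L j, 0) \<le> dist z (L j) + dist \<xi> 0"
      unfolding dist_Pair_Pair by (rule sqrt_sum_squares_le_sum) auto
    also have "\<dots> < d2" using z r \<xi> by (simp add: d_def dist_commute)
    finally have "dist (minor_fun M (z, \<xi>)) ?m < ?m / 2" by (rule d2(2))
    then have "\<bar>minor_fun M (z, \<xi>) - ?m\<bar> < ?m / 2" by (simp only: dist_real_def)
    then have 1: "c \<le> minor_fun M (z, \<xi>)" unfolding c_def by linarith
    have "dist (eigen_gap L j z) ?g < ?g / 2" using z by (intro d1(2)) (simp add: d_def dist_commute)
    then have "\<bar>eigen_gap L j z - ?g\<bar> < ?g / 2" by (simp only: dist_real_def)
    then have 2: "c \<le> eigen_gap L j z" unfolding c_def by linarith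
    have "c * ((cmod (z - L j))\<^sup>2 + r) = (cmod (z - L j))\<^sup>2 * c + r * c" by (simp add: algebra_simps)
    also have "\<dots> \<le> (cmod (z - L j))\<^sup>2 * eigen_gap L j z + r * minor_fun M (z, \<xi>)"
      using 1 2 r by (intro add_mono mult_left_mono) auto
    finally show "det_gram_fun M (z, r) \<ge> c * ((cmod (z - L j))\<^sup>2 + r)"
      unfolding eq norm_det_factor[OF es, of z j] .
  qed
qed

lemma det_gram_fun_blow_up:
  assumes es: "eigensystem M L S"
  shows "((\<lambda>e. det_gram_fun M (L j + e *\<^sub>R u, e\<^sup>2) / e\<^sup>2)
     \<longlongrightarrow> eigen_gap L j (L j) * (cmod u)\<^sup>2 + eigen_gap L j (L j) * Re (overlap S j)) (at_right 0)"
proof -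
  (* a mean value point for each e; it is squeezed between 0 and e squared *)
  define \<xi> where "\<xi> e = (SOME x. 0 < x \<and> x < e\<^sup>2 \<and> det_gram_fun M (L j + e *\<^sub>R u, e\<^sup>2)
      = (cmod (det (M - mat (L j + e *\<^sub>R u))))\<^sup>2 + e\<^sup>2 * minor_fun M (L j + e *\<^sub>R u, x))" for e :: real
  have \<xi>: "0 < \<xi> e" "\<xi> e < e\<^sup>2" and eq: "det_gram_fun M (L j + e *\<^sub>R u, e\<^sup>2)
      = (cmod (det (M - mat (L j + e *\<^sub>R u))))\<^sup>2 + e\<^sup>2 * minor_fun M (L j + e *\<^sub>R u, \<xi> e)" if "e > 0" for e
  proof -
    have "e\<^sup>2 > 0" using that by simp
    from someI_ex[OF det_gram_fun_mean_value[OF this, of M "L j + e *\<^sub>R u"]]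
    show "0 < \<xi> e" "\<xi> e < e\<^sup>2" "det_gram_fun M (L j + e *\<^sub>R u, e\<^sup>2)
      = (cmod (det (M - mat (L j + e *\<^sub>R u))))\<^sup>2 + e\<^sup>2 * minor_fun M (L j + e *\<^sub>R u, \<xi> e)"
      unfolding \<xi>_def by auto
  qed
  have pos: "eventually (\<lambda>e::real. e > 0) (at_right 0)" by (rule eventually_at_right_less)
  have sq: "((\<lambda>e::real. e\<^sup>2) \<longlongrightarrow> 0) (at_right 0)" by (rule tendsto_eq_intros tendsto_ident_at refl | simp)+
  have \<xi>0: "(\<xi> \<longlongrightarrow> 0) (at_right 0)"
    by (rule tendsto_sandwich[OF _ _ tendsto_const sq])
       (use pos \<xi> in \<open>auto elim!: eventually_mono intro: less_imp_le\<close>)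
  have z0: "((\<lambda>e. L j + e *\<^sub>R u) \<longlongrightarrow> L j) (at_right 0)"
    by (rule tendsto_eq_intros tendsto_ident_at refl | simp)+
  have 1: "((\<lambda>e. minor_fun M (L j + e *\<^sub>R u, \<xi> e)) \<longlongrightarrow> minor_fun M (L j, 0)) (at_right 0)"
    using continuous_on_tendsto_compose[OF continuous_on_minor_fun[of UNIV M] tendsto_Pair[OF z0 \<xi>0]] by simp
  have 2: "((\<lambda>e. eigen_gap L j (L j + e *\<^sub>R u)) \<longlongrightarrow> eigen_gap L j (L j)) (at_right 0)"
    using continuous_on_tendsto_compose[OF continuous_on_eigen_gap[of UNIV L j] z0] by simp
  have "((\<lambda>e. eigen_gap L j (L j + e *\<^sub>R u) * (cmod u)\<^sup>2 + minor_fun M (L j + e *\<^sub>R u, \<xi> e))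
     \<longlongrightarrow> eigen_gap L j (L j) * (cmod u)\<^sup>2 + minor_fun M (L j, 0)) (at_right 0)"
    by (intro tendsto_intros 1 2)
  moreover have "eventually (\<lambda>e. eigen_gap L j (L j + e *\<^sub>R u) * (cmod u)\<^sup>2 + minor_fun M (L j + e *\<^sub>R u, \<xi> e)
      = det_gram_fun M (L j + e *\<^sub>R u, e\<^sup>2) / e\<^sup>2) (at_right 0)"
    using pos
  proof eventually_elim
    case (elim e)
    show ?case unfolding eq[OF elim] norm_det_factor[OF es, of _ j]
      using elim by (simp add: power_mult_distrib add_divide_distrib)
  qed
  ultimately show ?thesis
    unfolding minor_fun_at_eigenvalue[OF es] by (rule Lim_transform_eventually)
qed

lemma det_gram_fun_pos:
  assumes "r > 0" shows "det_gram_fun M (z, r) > 0"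
  using det_gram_pos[OF assms, of "M - mat z"] by (simp add: det_gram_fun_def)

text \<open>The concentration theorem with \<open>a = eigen_gap\<close> and \<open>b = eigen_gap * overlap\<close>, transported from the
  set of eigenvalues to their labels.\<close>

lemma potential_measure_limit:
  fixes M S :: "complex^'n^'n" and h :: "complex \<times> real \<Rightarrow> real"
  assumes es: "eigensystem M L S" and h: "continuous_on UNIV h" "\<And>x. h x \<ge> 0"
    and phi: "\<phi> \<in> B_c" and lp: "\<And>j. lebesgue_point \<phi> (L j)"
    and mu: "\<And>w. w \<noteq> 0 \<Longrightarrow> \<mu> w = density lborel (\<lambda>z. ennreal (pole_density h (det_gram_fun M) (cmod w) z))"
  shows "((\<lambda>w. \<integral>z. \<phi> z \<partial>\<mu> w)
     \<longlongrightarrow> (\<Sum>j\<in>UNIV. (h (L j, 0) * pi / (eigen_gap L j (L j) * (eigen_gap L j (L j) * Re (overlap S j)))) *\<^sub>R \<phi> (L j))) (at 0)"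
proof -
  have inj: "inj L" using es by (simp add: eigensystem_def bij_betw_def)
  have m: "\<phi> \<in> borel_measurable borel" using phi by (simp add: B_c_def)
  let ?i = "inv L"
  let ?a = "\<lambda>x. eigen_gap L (?i x) x" and ?b = "\<lambda>x. eigen_gap L (?i x) x * Re (overlap S (?i x))"
  have i: "?i (L j) = j" for j using inj by simp
  have "((\<lambda>e. \<integral>z. (pole_density h (det_gram_fun M) e z) *\<^sub>R \<phi> z \<partial>lborel)
      \<longlongrightarrow> (\<Sum>x\<in>range L. (h (x, 0) * pi / (?a x * ?b x)) *\<^sub>R \<phi> x)) (at_right 0)"
  proof (rule concentration_at_poles)
    show "continuous_on (UNIV \<times> {0..}) (det_gram_fun M)" by (rule continuous_on_det_gram_fun)
    show "continuous_on (UNIV \<times> {0..}) h" using h(1) by (rule continuous_on_subset) simp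
    show "det_gram_fun M (z, r) > 0" if "r > 0" for z r by (rule det_gram_fun_pos[OF that])
    show "det_gram_fun M (z, 0) > 0" if "z \<notin> range L" for z
      using that unfolding det_gram_fun_0 eigensystem_det[OF es] by (auto simp: prod_norm[symmetric])
    show "\<exists>c>0. \<exists>d>0. quadratic_bound (det_gram_fun M) x c d" if "x \<in> range L" for x
      using that det_gram_fun_lower_bound[OF es] by blast
    show "?a x > 0" if "x \<in> range L" for x
      using that eigen_gap_pos[OF inj] by (auto simp: i)
    show "?b x > 0" if "x \<in> range L" for x
      using that eigen_gap_pos[OF inj] overlap_pos[OF es] by (auto simp: i)
    show "((\<lambda>e. det_gram_fun M (x + e *\<^sub>R u, e\<^sup>2) / e\<^sup>2) \<longlongrightarrow> ?a x * (cmod u)\<^sup>2 + ?b x) (at_right 0)" if "x \<in> range L" for x u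
      using that det_gram_fun_blow_up[OF es] by (auto simp: i)
    show "lebesgue_point \<phi> x" if "x \<in> range L" for x using that lp by auto
  qed (use phi in auto)
  from filterlim_compose[OF this filterlim_cmod_at_right_0]
  have "((\<lambda>w. \<integral>z. (pole_density h (det_gram_fun M) (cmod w) z) *\<^sub>R \<phi> z \<partial>lborel)
      \<longlongrightarrow> (\<Sum>x\<in>range L. (h (x, 0) * pi / (?a x * ?b x)) *\<^sub>R \<phi> x)) (at 0)" .
  moreover have "eventually (\<lambda>w. (\<integral>z. (pole_density h (det_gram_fun M) (cmod w) z) *\<^sub>R \<phi> z \<partial>lborel) = (\<integral>z. \<phi> z \<partial>\<mu> w)) (at 0)"
  proof -
    have "eventually (\<lambda>w::complex. w \<noteq> 0) (at 0)" by (simp add: eventually_at_filter)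
    then show ?thesis
    proof eventually_elim
      case (elim w)
      then have "(cmod w)\<^sup>2 > 0" by simp
      then show ?case unfolding mu[OF elim]
        by (intro integral_density_kernel[symmetric] continuous_on_det_gram_fun h det_gram_fun_pos m)
    qed
  qed
  ultimately have "((\<lambda>w. \<integral>z. \<phi> z \<partial>\<mu> w) \<longlongrightarrow> (\<Sum>x\<in>range L. (h (x, 0) * pi / (?a x * ?b x)) *\<^sub>R \<phi> x)) (at 0)"
    by (rule Lim_transform_eventually)
  then show ?thesis by (simp add: sum.reindex[OF inj] i)
qed

lemma integral_atomic_measure:
  fixes \<phi> :: "complex \<Rightarrow> complex"
  assumes "\<phi> \<in> borel_measurable borel" "\<And>j. c j \<ge> 0"
  shows "(\<integral>z. \<phi> z \<partial>atomic_measure c x) = (\<Sum>j\<in>UNIV. c j *\<^sub>R \<phi> (x j))"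
  unfolding atomic_measure_def using assms
  by (subst integral_distr) (auto simp: measurable_point_measure_eq1 intro!: lebesgue_integral_point_measure_finite)

text \<open>Each eigenvalue contributes \<open>h \<pi> / (a b)\<close> with \<open>a = g\<close> and \<open>b = g O\<close>, where \<open>g\<close> is the eigenvalue gap and
  \<open>O\<close> the overlap. For \<^const>\<open>mu_Lambda\<close> the numerator is \<open>g\<^sup>2 O / (\<pi> N)\<close>, which leaves \<open>1 / N\<close>; for \<^const>\<open>mu_O\<close>
  it is \<open>(g O)\<^sup>2 / (\<pi> N\<^sup>2)\<close>, which leaves \<open>O / N\<^sup>2\<close>.\<close>

theorem concentration_for_fixed_matrix:
  fixes M S :: "complex^'n^'n"
  assumes es: "eigensystem M L S" and phi: "\<phi> \<in> B_c" and lp: "\<And>j. lebesgue_point \<phi> (L j)"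
  shows "((\<lambda>w. \<integral>z. \<phi> z \<partial>mu_Lambda M w) \<longlongrightarrow> (\<integral>z. \<phi> z \<partial>Xi_measure L)) (at 0)"
    and "((\<lambda>w. \<integral>z. \<phi> z \<partial>mu_O M w) \<longlongrightarrow> (\<integral>z. \<phi> z \<partial>Theta_measure S L)) (at 0)"
proof -
  have m: "\<phi> \<in> borel_measurable borel" using phi by (simp add: B_c_def)
  have inj: "inj L" using es by (simp add: eigensystem_def bij_betw_def)
  have g: "eigen_gap L j (L j) > 0" and O: "Re (overlap S j) > 0" for j
    by (rule eigen_gap_pos[OF inj], rule overlap_pos[OF es])
  have mx: "max 0 (mixed_minor_fun M (L j, 0)) = (eigen_gap L j (L j))\<^sup>2 * Re (overlap S j)" for j
    unfolding mixed_minor_fun_at_eigenvalue[OF es] by (rule max_absorb2) (simp add: less_imp_le[OF O])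
  let ?N = "real CARD('n)"
  let ?h = "\<lambda>x. max 0 (mixed_minor_fun M x) / (pi * ?N)"
  have "((\<lambda>w. \<integral>z. \<phi> z \<partial>mu_Lambda M w)
     \<longlongrightarrow> (\<Sum>j\<in>UNIV. (?h (L j, 0) * pi / (eigen_gap L j (L j) * (eigen_gap L j (L j) * Re (overlap S j)))) *\<^sub>R \<phi> (L j))) (at 0)"
    by (rule potential_measure_limit[OF es _ _ phi lp mu_Lambda_eq])
       (auto intro!: continuous_intros continuous_on_mixed_minor_fun)
  also have "(\<Sum>j\<in>UNIV. (?h (L j, 0) * pi / (eigen_gap L j (L j) * (eigen_gap L j (L j) * Re (overlap S j)))) *\<^sub>R \<phi> (L j))
     = (\<Sum>j\<in>UNIV. (1 / ?N) *\<^sub>R \<phi> (L j))"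
    by (intro sum.cong refl arg_cong2[where f=scaleR])
      (simp only: mx, simp add: power2_eq_square less_imp_neq[OF g, symmetric] less_imp_neq[OF O, symmetric])
  also have "\<dots> = (\<integral>z. \<phi> z \<partial>Xi_measure L)"
    unfolding Xi_measure_def by (rule integral_atomic_measure[OF m, symmetric]) simp
  finally show "((\<lambda>w. \<integral>z. \<phi> z \<partial>mu_Lambda M w) \<longlongrightarrow> (\<integral>z. \<phi> z \<partial>Xi_measure L)) (at 0)" .
  let ?k = "\<lambda>x. (minor_fun M x)\<^sup>2 / (pi * ?N\<^sup>2)"
  have "((\<lambda>w. \<integral>z. \<phi> z \<partial>mu_O M w)
     \<longlongrightarrow> (\<Sum>j\<in>UNIV. (?k (L j, 0) * pi / (eigen_gap L j (L j) * (eigen_gap L j (L j) * Re (overlap S j)))) *\<^sub>R \<phi> (L j))) (at 0)"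
    by (rule potential_measure_limit[OF es _ _ phi lp mu_O_eq])
       (auto intro!: continuous_intros continuous_on_minor_fun)
  also have "(\<Sum>j\<in>UNIV. (?k (L j, 0) * pi / (eigen_gap L j (L j) * (eigen_gap L j (L j) * Re (overlap S j)))) *\<^sub>R \<phi> (L j))
     = (\<Sum>j\<in>UNIV. (Re (overlap S j) / ?N\<^sup>2) *\<^sub>R \<phi> (L j))"
    by (intro sum.cong refl arg_cong2[where f=scaleR])
      (simp add: minor_fun_at_eigenvalue[OF es] power2_eq_square less_imp_neq[OF g, symmetric] less_imp_neq[OF O, symmetric])
  also have "\<dots> = (\<integral>z. \<phi> z \<partial>Theta_measure S L)"
    unfolding Theta_measure_def by (rule integral_atomic_measure[OF m, symmetric]) (use O in \<open>simp add: less_imp_le\<close>)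
  finally show "((\<lambda>w. \<integral>z. \<phi> z \<partial>mu_O M w) \<longlongrightarrow> (\<integral>z. \<phi> z \<partial>Theta_measure S L)) (at 0)" .
qed

section \<open>Absolute continuity and translates\<close>

text \<open>Checked on boxes, coordinate by coordinate.\<close>

lemma distr_translate_PiM_lborel:
  fixes y :: "'i::finite \<Rightarrow> real"
  shows "distr (\<Pi>\<^sub>M i\<in>UNIV. lborel) (\<Pi>\<^sub>M i\<in>UNIV. lborel) (\<lambda>x. \<lambda>i\<in>UNIV. x i + y i) = (\<Pi>\<^sub>M i\<in>(UNIV :: 'i set). (lborel :: real measure))"
proof -
  interpret product_sigma_finite "\<lambda>i::'i. lborel :: real measure" ..
  let ?P = "\<Pi>\<^sub>M i\<in>(UNIV :: 'i set). (lborel :: real measure)"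
  have [measurable]: "(\<lambda>x. \<lambda>i\<in>UNIV. x i + y i) \<in> measurable ?P ?P"
    by (intro measurable_restrict) measurable
  show ?thesis
  proof (rule PiM_eqI)
    fix A :: "'i \<Rightarrow> real set" assume A: "\<And>i. i \<in> UNIV \<Longrightarrow> A i \<in> sets lborel"
    then have [measurable]: "A i \<in> sets borel" for i by simp
    have pre: "(\<lambda>x. \<lambda>i\<in>UNIV. x i + y i) -` (Pi\<^sub>E UNIV A) \<inter> space ?P = Pi\<^sub>E UNIV (\<lambda>i. (\<lambda>x. y i + x) -` A i)"
      by (auto simp: space_PiM PiE_def Pi_def add.commute)
    have "emeasure (distr ?P ?P (\<lambda>x. \<lambda>i\<in>UNIV. x i + y i)) (Pi\<^sub>E UNIV A) = emeasure ?P (Pi\<^sub>E UNIV (\<lambda>i. (\<lambda>x. y i + x) -` A i))"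
      unfolding pre[symmetric] by (rule emeasure_distr) (use A in auto)
    also have "\<dots> = (\<Prod>i\<in>UNIV. emeasure lborel ((\<lambda>x. y i + x) -` A i))"
      by (rule emeasure_PiM) (auto intro!: measurable_sets_borel[of _ borel])
    also have "\<dots> = (\<Prod>i\<in>UNIV. emeasure lborel (A i))"
    proof (rule prod.cong)
      fix i :: 'i
      have "emeasure lborel (A i) = emeasure (distr lborel borel ((+) (y i))) (A i)"
        by (simp only: lborel_distr_plus)
      also have "\<dots> = emeasure lborel ((\<lambda>x. y i + x) -` A i)"
        by (subst emeasure_distr) auto
      finally show "emeasure lborel ((\<lambda>x. y i + x) -` A i) = emeasure lborel (A i)" ..
    qed simp
    finally show "emeasure (distr ?P ?P (\<lambda>x. \<lambda>i\<in>UNIV. x i + y i)) (Pi\<^sub>E UNIV A) = (\<Prod>i\<in>UNIV. emeasure lborel (A i))" .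
  qed auto
qed

text \<open>By Fubini almost every translation vector moves almost every point out of \<open>B\<close>. One such
  translation suffices, because Lebesgue measure is invariant under it.\<close>

lemma AE_PiM_lborel_avoids:
  fixes E :: "'i::finite \<Rightarrow> 'v::euclidean_space" and y :: "complex \<Rightarrow> 'i \<Rightarrow> real"
  assumes B[measurable]: "B \<in> sets borel" and y[measurable]: "\<And>i. (\<lambda>c. y c i) \<in> borel_measurable borel"
    and null: "\<And>v. AE c in lborel. v + (\<Sum>i\<in>UNIV. y c i *\<^sub>R E i) \<notin> B"
  shows "AE x in (\<Pi>\<^sub>M i\<in>UNIV. lborel). a + (\<Sum>i\<in>UNIV. x i *\<^sub>R E i) \<notin> B"
proof -
  interpret product_sigma_finite "\<lambda>i::'i. lborel :: real measure" ..
  interpret fin: finite_product_sigma_finite "\<lambda>i::'i. lborel :: real measure" UNIV by standard auto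
  let ?P = "\<Pi>\<^sub>M i\<in>(UNIV :: 'i set). (lborel :: real measure)"
  interpret pair_sigma_finite ?P "lborel :: complex measure" ..
  let ?H = "\<lambda>x. a + (\<Sum>i\<in>UNIV. x i *\<^sub>R E i)"
  have H[measurable]: "?H \<in> borel_measurable ?P" by measurable
  (* no exceptional x here: the hypothesis covers every starting point *)
  have ae0: "AE x in ?P. AE c in lborel. ?H x + (\<Sum>i\<in>UNIV. y c i *\<^sub>R E i) \<notin> B"
    using null by simp
  have meas: "{x \<in> space (?P \<Otimes>\<^sub>M lborel). ?H (fst x) + (\<Sum>i\<in>UNIV. y (snd x) i *\<^sub>R E i) \<notin> B} \<in> sets (?P \<Otimes>\<^sub>M lborel)"
    by measurable
  have ae: "AE c in lborel. AE x in ?P. ?H x + (\<Sum>i\<in>UNIV. y c i *\<^sub>R E i) \<notin> B"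
    by (rule iffD1[OF AE_commute[of "\<lambda>x c. ?H x + (\<Sum>i\<in>UNIV. y c i *\<^sub>R E i) \<notin> B", OF meas] ae0])
  have "ae_filter (lborel :: complex measure) \<noteq> bot"
    by (simp add: ae_filter_eq_bot_iff)
  from eventually_happens'[OF this ae]
  obtain c where c: "AE x in ?P. ?H x + (\<Sum>i\<in>UNIV. y c i *\<^sub>R E i) \<notin> B" ..
  have "?H x + (\<Sum>i\<in>UNIV. y c i *\<^sub>R E i) = ?H (\<lambda>i\<in>UNIV. x i + y c i)" for x
    by (simp add: scaleR_add_left sum.distrib add.assoc)
  with c have "AE x in ?P. ?H (\<lambda>i\<in>UNIV. x i + y c i) \<notin> B" by simp
  then have "AE x in distr ?P ?P (\<lambda>x. \<lambda>i\<in>UNIV. x i + y c i). ?H x \<notin> B"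
    by (subst AE_distr_iff) (auto intro!: measurable_restrict)
  then show ?thesis unfolding distr_translate_PiM_lborel .
qed

lemma PiM_density:
  fixes f :: "'i::finite \<Rightarrow> real \<Rightarrow> ennreal"
  assumes f[measurable]: "\<And>i. f i \<in> borel_measurable borel" and pr: "\<And>i. prob_space (density lborel (f i))"
  shows "(\<Pi>\<^sub>M i\<in>UNIV. density lborel (f i)) = density (\<Pi>\<^sub>M i\<in>UNIV. lborel) (\<lambda>x. \<Prod>i\<in>UNIV. f i (x i))"
proof -
  interpret product_sigma_finite "\<lambda>i::'i. lborel :: real measure" ..
  interpret D: product_sigma_finite "\<lambda>i. density lborel (f i)"
    by (rule product_sigma_finite.intro) (rule prob_space_imp_sigma_finite[OF pr])
  let ?P = "\<Pi>\<^sub>M i\<in>(UNIV :: 'i set). (lborel :: real measure)"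
  show ?thesis
  proof (rule D.PiM_eqI[symmetric])
    show "sets (density ?P (\<lambda>x. \<Prod>i\<in>UNIV. f i (x i))) = sets (\<Pi>\<^sub>M i\<in>UNIV. density lborel (f i))"
      by (simp cong: sets_PiM_cong)
    fix A :: "'i \<Rightarrow> real set" assume "\<And>i. i \<in> UNIV \<Longrightarrow> A i \<in> sets (density lborel (f i))"
    then have A[measurable]: "A i \<in> sets borel" for i by simp
    have "emeasure (density ?P (\<lambda>x. \<Prod>i\<in>UNIV. f i (x i))) (Pi\<^sub>E UNIV A)
        = (\<integral>\<^sup>+x. (\<Prod>i\<in>UNIV. f i (x i)) * indicator (Pi\<^sub>E UNIV A) x \<partial>?P)"
      by (subst emeasure_density) (auto intro!: sets_PiM_I_finite borel_measurable_prod)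
    also have "\<dots> = (\<integral>\<^sup>+x. (\<Prod>i\<in>UNIV. f i (x i) * indicator (A i) (x i)) \<partial>?P)"
    proof (rule nn_integral_cong)
      fix x :: "'i \<Rightarrow> real"
      have "indicator (Pi\<^sub>E UNIV A) x = (\<Prod>i\<in>UNIV. indicator (A i) (x i) :: ennreal)"
        by (auto simp: indicator_def PiE_def Pi_def prod_zero_iff)
      then show "(\<Prod>i\<in>UNIV. f i (x i)) * indicator (Pi\<^sub>E UNIV A) x = (\<Prod>i\<in>UNIV. f i (x i) * indicator (A i) (x i))"
        by (simp add: prod.distrib)
    qed
    also have "\<dots> = (\<Prod>i\<in>UNIV. \<integral>\<^sup>+x. f i x * indicator (A i) x \<partial>lborel)"
      by (rule product_nn_integral_prod) auto
    also have "\<dots> = (\<Prod>i\<in>UNIV. emeasure (density lborel (f i)) (A i))"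
      by (simp add: emeasure_density)
    finally show "emeasure (density ?P (\<lambda>x. \<Prod>i\<in>UNIV. f i (x i))) (Pi\<^sub>E UNIV A) = (\<Prod>i\<in>UNIV. emeasure (density lborel (f i)) (A i))" .
  qed simp
qed

lemma AE_indep_densities:
  fixes Z :: "'i::finite \<Rightarrow> 'w \<Rightarrow> real"
  assumes P: "prob_space P" and ind: "prob_space.indep_vars P (\<lambda>_. borel) Z UNIV"
    and d: "\<And>i. distributed P lborel (Z i) (f i)"
    and Q: "AE x in (\<Pi>\<^sub>M i\<in>UNIV. lborel). Q x" and Qm: "{x \<in> space (\<Pi>\<^sub>M i\<in>UNIV. lborel). Q x} \<in> sets (\<Pi>\<^sub>M i\<in>UNIV. lborel)"
  shows "AE \<omega> in P. Q (\<lambda>i. Z i \<omega>)"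
proof -
  interpret prob_space P by (rule P)
  have f[measurable]: "f i \<in> borel_measurable borel" for i using d[of i] by (simp add: distributed_def)
  have dd: "distr P borel (Z i) = density lborel (f i)" for i
    using d[of i] by (simp add: distributed_def cong: distr_cong)
  have rv[measurable]: "Z i \<in> borel_measurable P" for i
    using d[of i] by (simp add: distributed_def)
  have pr: "prob_space (density lborel (f i))" for i
    unfolding dd[symmetric] by (rule prob_space_distr) (rule rv)
  have "distr P (\<Pi>\<^sub>M i\<in>UNIV. borel) (\<lambda>x. \<lambda>i\<in>UNIV. Z i x) = (\<Pi>\<^sub>M i\<in>UNIV. distr P borel (Z i))"
    using ind by (subst (asm) indep_vars_iff_distr_eq_PiM) auto
  also have "\<dots> = density (\<Pi>\<^sub>M i\<in>UNIV. lborel) (\<lambda>x. \<Prod>i\<in>UNIV. f i (x i))"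
    unfolding dd by (rule PiM_density[OF f pr])
  finally have law: "distr P (\<Pi>\<^sub>M i\<in>UNIV. borel) (\<lambda>x. \<lambda>i\<in>UNIV. Z i x) = density (\<Pi>\<^sub>M i\<in>UNIV. lborel) (\<lambda>x. \<Prod>i\<in>UNIV. f i (x i))" .
  have "AE x in density (\<Pi>\<^sub>M i\<in>UNIV. lborel) (\<lambda>x. \<Prod>i\<in>UNIV. f i (x i)). Q x"
    using Q by (subst AE_density) (auto intro!: borel_measurable_prod)
  then have "AE x in distr P (\<Pi>\<^sub>M i\<in>UNIV. borel) (\<lambda>x. \<lambda>i\<in>UNIV. Z i x). Q x"
    unfolding law .
  moreover have "sets (\<Pi>\<^sub>M i\<in>(UNIV::'i set). (borel :: real measure)) = sets (\<Pi>\<^sub>M i\<in>UNIV. lborel)"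
    by (rule sets_PiM_cong) auto
  moreover have "(\<lambda>x. \<lambda>i\<in>UNIV. Z i x) \<in> measurable P (\<Pi>\<^sub>M i\<in>UNIV. borel)"
    by measurable
  ultimately have "AE \<omega> in P. Q (\<lambda>i\<in>UNIV. Z i \<omega>)"
    using Qm by (subst (asm) AE_distr_iff) (auto simp: space_PiM)
  then show ?thesis by (simp add: restrict_UNIV)
qed


section \<open>Measurability of the exceptional sets of matrices\<close>

lemma eigenvalues_iff_det: "z \<in> eigenvalues M \<longleftrightarrow> det (M - mat z) = 0"
proof -
  have "(M *v v = z *s v) \<longleftrightarrow> (M - mat z) *v v = 0" for v
    by (simp add: matrix_vector_mult_diff_rdistrib mat_mult_vector)
  then have "z \<in> eigenvalues M \<longleftrightarrow> \<not> (\<forall>v. (M - mat z) *v v = 0 \<longrightarrow> v = 0)"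
    by (auto simp: eigenvalues_def eigenvector_def)
  also have "\<dots> \<longleftrightarrow> \<not> invertible (M - mat z)"
    by (simp add: invertible_left_inverse matrix_left_invertible_ker)
  finally show ?thesis by (simp add: invertible_det_nz)
qed

lemma finite_eigenvalues: "finite (eigenvalues M)"
proof -
  have "finite (uminus ` {z. det (M + mat z ** mat 1) = 0})"
    by (intro finite_imageI finite_singular_pencil) simp
  moreover have "eigenvalues M \<subseteq> uminus ` {z. det (M + mat z ** mat 1) = 0}"
  proof
    fix z assume "z \<in> eigenvalues M"
    moreover have "M - mat z = M + mat (- z)" by (simp add: vec_eq_iff mat_def)
    ultimately show "z \<in> uminus ` {z. det (M + mat z ** mat 1) = 0}"
      by (intro image_eqI[of _ _ "- z"]) (simp_all add: eigenvalues_iff_det)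
  qed
  ultimately show ?thesis by (rule rev_finite_subset)
qed

text \<open>Projection along a compact factor is a closed map.\<close>

lemma closed_ex_compact:
  fixes F :: "complex \<times> (complex^'n^'n) \<Rightarrow> 'b::t1_space"
  assumes K: "compact K" and F: "continuous_on UNIV F"
  shows "closed {M. \<exists>z\<in>K. F (z, M) = c}"
proof -
  have "closedin (top_of_set (K \<times> UNIV)) ((K \<times> UNIV) \<inter> F -` {c})"
    by (rule continuous_closedin_preimage) (auto intro: continuous_on_subset[OF F])
  from closedin_compact_projection[OF K this]
  have "closed {M. \<exists>z. z \<in> K \<and> (z, M) \<in> (K \<times> UNIV) \<inter> F -` {c}}" by simp
  also have "{M. \<exists>z. z \<in> K \<and> (z, M) \<in> (K \<times> UNIV) \<inter> F -` {c}} = {M. \<exists>z\<in>K. F (z, M) = c}"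
    by auto
  finally show ?thesis .
qed

lemma continuous_on_shift_det: "continuous_on A (\<lambda>x. det (snd x - mat (fst x) :: complex^'n^'n))"
  unfolding continuous_on_def by (intro ballI tendsto_intros)

lemma continuous_on_shift_trace_adjugate: "continuous_on A (\<lambda>x. trace (adjugate (snd x - mat (fst x) :: complex^'n^'n)))"
  unfolding continuous_on_def by (intro ballI tendsto_intros)

text \<open>An open set is a countable union of compact sets. A projection of a Borel set need not be Borel, so
  null sets of eigenvalues are approached through open sets.\<close>

lemma borel_eigenvalue_in_open:
  assumes "open U"
  shows "{M :: complex^'n^'n. \<exists>z\<in>U. det (M - mat z) = 0} \<in> sets borel"
proof -
  obtain C :: "nat \<Rightarrow> complex set" where C: "\<And>n. compact (C n)" "(\<Union>n. C n) = U"
    using open_Union_compact_subsets[OF assms] by metis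
  have "{M :: complex^'n^'n. \<exists>z\<in>C n. det (M - mat z) = 0} \<in> sets borel" for n
    using closed_ex_compact[OF C(1)[of n] continuous_on_shift_det[of UNIV], of 0] by (auto intro: borel_closed)
  then have "(\<Union>n. {M :: complex^'n^'n. \<exists>z\<in>C n. det (M - mat z) = 0}) \<in> sets borel" by auto
  also have "(\<Union>n. {M :: complex^'n^'n. \<exists>z\<in>C n. det (M - mat z) = 0}) = {M. \<exists>z\<in>U. det (M - mat z) = 0}"
    using C(2) by blast
  finally show ?thesis .
qed

lemma decreasing_open_null_cover:
  fixes E :: "complex set"
  assumes "negligible E"
  obtains U where "\<And>n::nat. open (U n)" "\<And>n. E \<subseteq> U n" "decseq U" "negligible (\<Inter>n. U n)"
proof -
  have E: "E \<in> null_sets lebesgue" using assms by (simp add: negligible_iff_null_sets)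
  have "\<exists>T. open T \<and> E \<subseteq> T \<and> T \<in> lmeasurable \<and> measure lebesgue T < 1 / Suc n" for n
  proof -
    obtain T where T: "open T" "E \<subseteq> T" "T - E \<in> lmeasurable" "emeasure lebesgue (T - E) < ennreal (1 / Suc n)"
      using sets_lebesgue_outer_open[of E "1 / Suc n"] E by (auto simp: null_sets_def)
    have eq: "emeasure lebesgue T = emeasure lebesgue (T - E)"
      using E T by (simp add: emeasure_Diff_null_set)
    have lt: "emeasure lebesgue T < ennreal (1 / Suc n)" using T(4) eq by simp
    then have lm: "T \<in> lmeasurable" using T(1)
      by (intro fmeasurableI) (auto intro: order.strict_trans)
    then have "measure lebesgue T < 1 / Suc n"
      using lt by (simp add: emeasure_eq_measure2 ennreal_less_iff)
    then show ?thesis using T lm by blast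
  qed
  then obtain T where T: "\<And>n. open (T n)" "\<And>n. E \<subseteq> T n" "\<And>n. T n \<in> lmeasurable" "\<And>n. measure lebesgue (T n) < 1 / Suc n"
    by metis
  define U where "U n = (\<Inter>i\<in>{..n}. T i)" for n
  show ?thesis
  proof (rule that[of U])
    show "open (U n)" for n unfolding U_def by (intro open_INT T(1) ballI) simp
    show "E \<subseteq> U n" for n unfolding U_def using T(2) by blast
    show "decseq U" unfolding U_def decseq_def by force
    show "negligible (\<Inter>n. U n)"
      unfolding negligible_outer
    proof (intro allI impI)
      fix e :: real assume "e > 0"
      then obtain n :: nat where n: "1 / Suc n < e" by (rule nat_approx_posE)
      have "(\<Inter>n. U n) \<subseteq> T n" unfolding U_def by blast
      then show "\<exists>T. (\<Inter>n. U n) \<subseteq> T \<and> T \<in> lmeasurable \<and> measure lebesgue T < e"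
        using T(3,4)[of n] n by (intro exI[of _ "T n"]) auto
    qed
  qed
qed

text \<open>There are finitely many eigenvalues. If each of them left the decreasing sequence at some index, all
  would have left it at the maximum of these indices.\<close>

lemma eigenvalue_in_decreasing_Inter:
  fixes M :: "complex^'n^'n"
  assumes U: "decseq U" and z: "\<And>n::nat. \<exists>z\<in>U n. det (M - mat z) = 0"
  shows "\<exists>z\<in>(\<Inter>n. U n). det (M - mat z) = 0"
proof (rule ccontr)
  assume not: "\<not> ?thesis"
  have "\<exists>n. z \<notin> U n" if "z \<in> eigenvalues M" for z
    using not that by (auto simp: eigenvalues_iff_det)
  then obtain N where N: "\<And>z. z \<in> eigenvalues M \<Longrightarrow> z \<notin> U (N z)" by metis
  define m where "m = Max (insert 0 (N ` eigenvalues M))"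
  obtain z where z: "z \<in> U m" "det (M - mat z) = 0" using z by blast
  then have e: "z \<in> eigenvalues M" by (simp add: eigenvalues_iff_det)
  have "N z \<le> m" unfolding m_def by (rule Max_ge) (use e finite_eigenvalues in auto)
  then have "U m \<subseteq> U (N z)" using U by (simp add: decseq_def)
  then show False using z(1) N[OF e] by blast
qed

text \<open>A common zero of the characteristic polynomial and its derivative, written with continuous functions
  of the matrix to make the measurability of this set visible.\<close>

definition degenerate :: "complex^'n^'n \<Rightarrow> bool" where
  "degenerate M \<longleftrightarrow> (\<exists>z. det (M - mat z) = 0 \<and> trace (adjugate (M - mat z)) = 0)"

lemma borel_degenerate: "{M :: complex^'n^'n. degenerate M} \<in> sets borel"
proof -
  have "continuous_on UNIV (\<lambda>x. (det (snd x - mat (fst x) :: complex^'n^'n), trace (adjugate (snd x - mat (fst x)))))"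
    by (intro continuous_on_Pair continuous_on_shift_det continuous_on_shift_trace_adjugate)
  from closed_ex_compact[OF compact_cball this, of 0 _ "(0, 0)"]
  have "{M :: complex^'n^'n. \<exists>z\<in>cball 0 (real n). det (M - mat z) = 0 \<and> trace (adjugate (M - mat z)) = 0} \<in> sets borel" for n
    by (auto intro: borel_closed)
  then have "(\<Union>n. {M :: complex^'n^'n. \<exists>z\<in>cball 0 (real n). det (M - mat z) = 0 \<and> trace (adjugate (M - mat z)) = 0}) \<in> sets borel"
    by auto
  also have "(\<Union>n. {M :: complex^'n^'n. \<exists>z\<in>cball 0 (real n). det (M - mat z) = 0 \<and> trace (adjugate (M - mat z)) = 0}) = {M. degenerate M}"
    unfolding degenerate_def using real_arch_simple by fastforce
  finally show ?thesis .
qed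

abbreviation charpoly :: "complex^'n^'n \<Rightarrow> complex poly" where
  "charpoly M \<equiv> det_pencil M (- mat 1)"

lemma poly_charpoly: "poly (charpoly M) z = det (M - mat z)"
  by (simp add: poly_det_pencil matrix_mul_uminus_right)

lemma poly_pderiv_charpoly: "poly (pderiv (charpoly M)) z = - trace (adjugate (M - mat z))"
proof -
  have "has_entry_derivative (\<lambda>z. M - mat z) (0 - mat 1) z"
    by (intro has_entry_derivative_diff has_entry_derivative_const has_entry_derivative_mat) (auto intro!: derivative_eq_intros)
  from DERIV_det[OF this]
  have "((\<lambda>z. det (M - mat z)) has_field_derivative - trace (adjugate (M - mat z))) (at z)"
    by (simp add: matrix_mul_uminus_right trace_def sum_negf)
  moreover have "((\<lambda>z. det (M - mat z)) has_field_derivative poly (pderiv (charpoly M)) z) (at z)"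
    using poly_DERIV[of "charpoly M" z] by (simp add: poly_charpoly)
  ultimately show ?thesis by (rule DERIV_unique[rotated])
qed

lemma degenerate_iff: "degenerate M \<longleftrightarrow> (\<exists>z. poly (charpoly M) z = 0 \<and> poly (pderiv (charpoly M)) z = 0)"
  by (simp add: degenerate_def poly_charpoly poly_pderiv_charpoly)

text \<open>The polynomial \<open>s\<^sup>N \<chi>(1 / s) = det (s M - 1)\<close> does not vanish at \<open>s = 0\<close>, so comparing orders of
  vanishing at zero with the reflected polynomial \<open>s\<^sup>d \<chi>(1 / s)\<close> gives \<open>d = N\<close>.\<close>

lemma degree_charpoly: "degree (charpoly M) = CARD('n)" for M :: "complex^'n^'n"
proof -
  let ?p = "charpoly M" and ?q = "det_pencil (- mat 1) M" and ?N = "CARD('n)"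
  have det_mat: "det (mat s :: complex^'n^'n) = s ^ ?N" for s
    by (subst det_diagonal) (auto simp: mat_def)
  have "- mat 1 = (mat (- 1) :: complex^'n^'n)" by (simp add: vec_eq_iff mat_def)
  then have q0: "poly ?q 0 \<noteq> 0" by (simp add: poly_det_pencil det_mat)
  then have q: "?q \<noteq> 0" by auto
  have key: "s ^ ?N * poly ?p (inverse s) = poly ?q s" if "s \<noteq> 0" for s
  proof -
    have "mat s ** (M - mat (inverse s)) = - mat 1 + mat s ** M"
      using that by (simp add: matrix_mul_diff_right mat_mult_mat)
    then have "det (mat s :: complex^'n^'n) * det (M - mat (inverse s)) = det (- mat 1 + mat s ** M)"
      by (metis det_mul)
    then show ?thesis unfolding poly_charpoly by (simp add: det_mat poly_det_pencil)
  qed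
  have p: "?p \<noteq> 0"
  proof
    assume 0: "?p = 0"
    have "poly ?q s = 0" if "s \<noteq> 0" for s using key[OF that] 0 by simp
    then have "poly ([:0, 1:] * ?q) s = poly 0 s" for s by (cases "s = 0") auto
    then have "[:0, 1:] * ?q = 0" using poly_eq_poly_eq_iff by blast
    then show False using q by simp
  qed
  (* the extra factor s makes the identity hold at s = 0 as well *)
  have "poly ([:0, 1:] * (monom 1 ?N * reflect_poly ?p)) s = poly ([:0, 1:] * (monom 1 (degree ?p) * ?q)) s" for s
    by (cases "s = 0") (auto simp: poly_monom poly_reflect_poly_nz key[symmetric])
  then have "[:0, 1:] * (monom 1 ?N * reflect_poly ?p) = [:0, 1:] * (monom 1 (degree ?p) * ?q)"
    using poly_eq_poly_eq_iff by blast
  then have e: "monom 1 ?N * reflect_poly ?p = monom 1 (degree ?p) * ?q" by simp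
  have "order 0 (monom 1 ?N * reflect_poly ?p) = ?N"
    using p by (subst order_mult) (auto simp: order_0_monom intro!: order_0I)
  moreover have "order 0 (monom 1 (degree ?p) * ?q) = degree ?p"
    using q q0 by (subst order_mult) (auto simp: order_0_monom intro!: order_0I)
  ultimately show ?thesis using e by simp
qed

lemma simple_spectrum_if_not_degenerate:
  fixes M :: "complex^'n^'n"
  assumes "\<not> degenerate M"
  shows "simple_spectrum M"
proof -
  let ?p = "charpoly M"
  have sf: "rsquarefree ?p" using assms by (simp add: degenerate_iff rsquarefree_roots)
  then have p0: "?p \<noteq> 0" by (simp add: rsquarefree_def)
  from sf have "smult (lead_coeff ?p) (\<Prod>z|poly ?p z = 0. [:-z, 1:]) = ?p"
    by (rule complex_poly_decompose_rsquarefree)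
  then have "degree (smult (lead_coeff ?p) (\<Prod>z|poly ?p z = 0. [:-z, 1:])) = degree ?p" by simp
  then have "degree (\<Prod>z|poly ?p z = 0. [:-z, 1:]) = degree ?p"
    using p0 by simp
  moreover have "degree (\<Prod>z|poly ?p z = 0. [:-z, 1:]) = (\<Sum>z|poly ?p z = 0. 1)"
    by (subst degree_prod_sum_eq) auto
  moreover have "{z. poly ?p z = 0} = eigenvalues M"
    by (auto simp: poly_charpoly eigenvalues_iff_det)
  ultimately show ?thesis by (simp add: simple_spectrum_def degree_charpoly)
qed

section \<open>Lines of matrices meet the degenerate ones in finitely many points\<close>

definition polynomial_fun :: "(complex \<Rightarrow> complex) \<Rightarrow> bool" where
  "polynomial_fun f \<longleftrightarrow> (\<exists>p. \<forall>s. f s = poly p s)"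

lemma polynomial_fun_const: "polynomial_fun (\<lambda>_. c)"
  unfolding polynomial_fun_def by (rule exI[of _ "[:c:]"]) simp

lemma polynomial_fun_mult:
  assumes "polynomial_fun f" "polynomial_fun g"
  shows "polynomial_fun (\<lambda>s. f s * g s)"
proof -
  obtain p q where "\<And>s. f s = poly p s" "\<And>s. g s = poly q s" using assms by (auto simp: polynomial_fun_def)
  then show ?thesis unfolding polynomial_fun_def by (intro exI[of _ "p * q"]) simp
qed

lemma polynomial_fun_add:
  assumes "polynomial_fun f" "polynomial_fun g"
  shows "polynomial_fun (\<lambda>s. f s + g s)"
proof -
  obtain p q where "\<And>s. f s = poly p s" "\<And>s. g s = poly q s" using assms by (auto simp: polynomial_fun_def)
  then show ?thesis unfolding polynomial_fun_def by (intro exI[of _ "p + q"]) simp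
qed

lemma polynomial_fun_sum:
  assumes "\<And>i. i \<in> I \<Longrightarrow> polynomial_fun (f i)"
  shows "polynomial_fun (\<lambda>s. \<Sum>i\<in>I. f i s)"
  using assms by (induction I rule: infinite_finite_induct) (auto intro: polynomial_fun_add polynomial_fun_const)

lemma polynomial_fun_prod:
  assumes "\<And>i. i \<in> I \<Longrightarrow> polynomial_fun (f i)"
  shows "polynomial_fun (\<lambda>s. \<Prod>i\<in>I. f i s)"
  using assms by (induction I rule: infinite_finite_induct) (auto intro: polynomial_fun_mult polynomial_fun_const)

lemma polynomial_fun_det:
  assumes "\<And>i j. polynomial_fun (\<lambda>s. A s $ i $ j)"
  shows "polynomial_fun (\<lambda>s. det (A s))"
  unfolding det_def by (intro polynomial_fun_sum polynomial_fun_mult polynomial_fun_const polynomial_fun_prod assms)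

lemma polynomial_fun_matrix_mult:
  assumes "\<And>i j. polynomial_fun (\<lambda>s. A s $ i $ j)" "\<And>i j. polynomial_fun (\<lambda>s. B s $ i $ j)"
  shows "polynomial_fun (\<lambda>s. (A s ** B s) $ i $ j)"
  unfolding matrix_matrix_mult_def by (simp, intro polynomial_fun_sum polynomial_fun_mult assms)

lemma finite_zeros_polynomial_fun:
  assumes "polynomial_fun f" "f a \<noteq> 0"
  shows "finite {s. f s = 0}"
proof -
  obtain p where p: "\<And>s. f s = poly p s" using assms(1) by (auto simp: polynomial_fun_def)
  then have "p \<noteq> 0" using assms(2) by auto
  then show ?thesis using poly_roots_finite[of p] by (simp add: p)
qed

fun matrix_power :: "'a::comm_semiring_1^'n^'n \<Rightarrow> nat \<Rightarrow> 'a^'n^'n" where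
  "matrix_power A 0 = mat 1"
| "matrix_power A (Suc k) = A ** matrix_power A k"

definition poly_matrix :: "complex poly \<Rightarrow> complex^'n^'n \<Rightarrow> complex^'n^'n" where
  "poly_matrix p A = (\<Sum>k\<le>degree p. mat (coeff p k) ** matrix_power A k)"

lemma matrix_power_eigenvector:
  fixes A :: "'a::field^'n^'n"
  assumes "A *v v = z *s v"
  shows "matrix_power A k *v v = (z ^ k) *s v"
proof (induction k)
  case (Suc k)
  have "matrix_power A (Suc k) *v v = A *v (matrix_power A k *v v)" by (simp add: matrix_vector_mul_assoc)
  also have "\<dots> = (z ^ k) *s (A *v v)" by (simp add: Suc vector_scalar_commute)
  finally show ?case by (simp add: assms vector_smult_assoc mult.commute)
qed simp

lemma sum_matrix_vector_mult: "(\<Sum>k\<in>K. A k) *v v = (\<Sum>k\<in>K. A k *v v)" for v :: "'a::comm_ring_1^'n"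
  by (induction K rule: infinite_finite_induct) (simp_all add: matrix_vector_mult_add_rdistrib)

lemma poly_matrix_eigenvector:
  assumes "A *v v = z *s v"
  shows "poly_matrix p A *v v = poly p z *s v"
proof -
  have "poly_matrix p A *v v = (\<Sum>k\<le>degree p. (coeff p k * z ^ k) *s v)"
    unfolding poly_matrix_def sum_matrix_vector_mult
    by (intro sum.cong refl) (simp add: matrix_power_eigenvector[OF assms] mat_mult_vector vector_smult_assoc flip: matrix_vector_mul_assoc)
  also have "\<dots> = poly p z *s v"
    by (simp add: poly_altdef vec_eq_iff sum_distrib_right)
  finally show ?thesis .
qed

text \<open>An eigenvector for a multiple root \<open>z\<close> of \<open>\<chi>\<close> is sent to \<open>\<chi>'(z) = 0\<close> times itself by \<open>\<chi>'(M)\<close>.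
  Up to sign the determinant of \<open>\<chi>'(M)\<close> is the discriminant of \<open>\<chi>\<close>.\<close>

lemma det_discriminant_matrix_degenerate:
  assumes "degenerate M"
  shows "det (poly_matrix (pderiv (charpoly M)) M) = 0"
proof -
  obtain z where z: "poly (charpoly M) z = 0" "poly (pderiv (charpoly M)) z = 0"
    using assms by (auto simp: degenerate_iff)
  then have "z \<in> eigenvalues M" by (simp add: poly_charpoly eigenvalues_iff_det)
  then obtain v where v: "v \<noteq> 0" "M *v v = z *s v" by (auto simp: eigenvalues_def eigenvector_def)
  have "poly_matrix (pderiv (charpoly M)) M *v v = 0"
    using poly_matrix_eigenvector[OF v(2)] z(2) by simp
  then have "\<not> invertible (poly_matrix (pderiv (charpoly M)) M)"
    using v(1) by (auto simp: invertible_left_inverse matrix_left_invertible_ker)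
  then show ?thesis by (simp add: invertible_det_nz)
qed


definition polynomial_coeffs :: "(complex \<Rightarrow> complex poly) \<Rightarrow> bool" where
  "polynomial_coeffs F \<longleftrightarrow> (\<forall>k. polynomial_fun (\<lambda>s. coeff (F s) k))"

lemma polynomial_coeffs_const: "polynomial_coeffs (\<lambda>_. p)"
  by (simp add: polynomial_coeffs_def polynomial_fun_const)

lemma polynomial_coeffs_add:
  "polynomial_coeffs F \<Longrightarrow> polynomial_coeffs G \<Longrightarrow> polynomial_coeffs (\<lambda>s. F s + G s)"
  by (simp add: polynomial_coeffs_def polynomial_fun_add)

lemma polynomial_coeffs_mult:
  "polynomial_coeffs F \<Longrightarrow> polynomial_coeffs G \<Longrightarrow> polynomial_coeffs (\<lambda>s. F s * G s)"
  unfolding polynomial_coeffs_def coeff_mult by (intro allI polynomial_fun_sum polynomial_fun_mult) auto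

lemma polynomial_coeffs_sum:
  assumes "\<And>i. i \<in> I \<Longrightarrow> polynomial_coeffs (F i)"
  shows "polynomial_coeffs (\<lambda>s. \<Sum>i\<in>I. F i s)"
  using assms by (induction I rule: infinite_finite_induct) (auto intro: polynomial_coeffs_add polynomial_coeffs_const)

lemma polynomial_coeffs_prod:
  assumes "\<And>i. i \<in> I \<Longrightarrow> polynomial_coeffs (F i)"
  shows "polynomial_coeffs (\<lambda>s. \<Prod>i\<in>I. F i s)"
  using assms by (induction I rule: infinite_finite_induct) (auto intro: polynomial_coeffs_mult polynomial_coeffs_const)

lemma polynomial_coeffs_linear:
  assumes "polynomial_fun f" "polynomial_fun g"
  shows "polynomial_coeffs (\<lambda>s. [:f s, g s:])"
  unfolding polynomial_coeffs_def
proof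
  fix k
  consider "k = 0" | "k = 1" | m where "k = Suc (Suc m)" by (metis One_nat_def not0_implies_Suc)
  then show "polynomial_fun (\<lambda>s. coeff [:f s, g s:] k)"
    by cases (use assms in \<open>auto simp: polynomial_fun_const\<close>)
qed

lemma polynomial_coeffs_charpoly:
  assumes "\<And>i j. polynomial_fun (\<lambda>s. A s $ i $ j)"
  shows "polynomial_coeffs (\<lambda>s. charpoly (A s))"
  unfolding det_pencil_def det_def
  by (simp, intro polynomial_coeffs_sum polynomial_coeffs_mult polynomial_coeffs_const polynomial_coeffs_prod
      polynomial_coeffs_linear assms polynomial_fun_const)

lemma polynomial_fun_matrix_power:
  assumes "\<And>i j. polynomial_fun (\<lambda>s. A s $ i $ j)"
  shows "polynomial_fun (\<lambda>s. matrix_power (A s) k $ i $ j)"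
proof (induction k arbitrary: i j)
  case 0
  show ?case by (simp add: polynomial_fun_const)
next
  case (Suc k)
  show ?case unfolding matrix_power.simps by (intro polynomial_fun_matrix_mult assms Suc)
qed

lemma polynomial_fun_discriminant:
  fixes A :: "complex \<Rightarrow> complex^'n^'n"
  assumes A: "\<And>i j. polynomial_fun (\<lambda>s. A s $ i $ j)"
  shows "polynomial_fun (\<lambda>s. det (poly_matrix (pderiv (charpoly (A s))) (A s)))"
proof (rule polynomial_fun_det)
  fix i j
  have "poly_matrix (pderiv (charpoly (A s))) (A s) $ i $ j
     = (\<Sum>k\<le>CARD('n) - 1. of_nat (Suc k) * coeff (charpoly (A s)) (Suc k) * matrix_power (A s) k $ i $ j)" for s
    by (simp add: poly_matrix_def degree_pderiv degree_charpoly coeff_pderiv)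
  moreover have "polynomial_fun (\<lambda>s. coeff (charpoly (A s)) k)" for k
    using polynomial_coeffs_charpoly[OF A] by (simp add: polynomial_coeffs_def)
  ultimately show "polynomial_fun (\<lambda>s. poly_matrix (pderiv (charpoly (A s))) (A s) $ i $ j)"
    by (simp only:) (intro polynomial_fun_sum polynomial_fun_mult polynomial_fun_const polynomial_fun_matrix_power A)
qed

lemma matrix_vector_axis_nth: "(A *v axis i 1) $ j = A $ j $ i" for A :: "'a::comm_semiring_1^'n^'m"
proof -
  have "(\<Sum>k\<in>UNIV. A $ j $ k * (if k = i then 1 else 0)) = (\<Sum>k\<in>UNIV. if k = i then A $ j $ i else 0)"
    by (intro sum.cong) auto
  then show ?thesis by (simp add: matrix_vector_mult_def axis_def)
qed

text \<open>For a diagonal matrix the matrix \<open>\<chi>'(D)\<close> is diagonal, with the values of \<open>\<chi>'\<close> at the simple roots of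
  \<open>\<chi>\<close> as entries.\<close>

lemma discriminant_diag_nonzero:
  fixes d :: "'n::finite \<Rightarrow> complex"
  assumes "inj d"
  shows "det (poly_matrix (pderiv (charpoly (diag_matrix d))) (diag_matrix d)) \<noteq> 0"
proof -
  let ?D = "diag_matrix d" and ?q = "pderiv (charpoly (diag_matrix d))"
  have "?D *v axis i 1 = d i *s axis i 1" for i
    by (simp add: vec_eq_iff matrix_vector_axis_nth) (simp add: diag_matrix_def axis_def)
  then have "poly_matrix ?q ?D *v axis i 1 = poly ?q (d i) *s axis i 1" for i
    by (rule poly_matrix_eigenvector)
  then have "poly_matrix ?q ?D $ j $ i = (poly ?q (d i) *s axis i 1) $ j" for i j
    by (metis matrix_vector_axis_nth)
  then have "poly_matrix ?q ?D = diag_matrix (\<lambda>i. poly ?q (d i))"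
    by (simp add: vec_eq_iff diag_matrix_def axis_def)
  then have "det (poly_matrix ?q ?D) = (\<Prod>i\<in>UNIV. poly ?q (d i))"
    by (simp add: det_diag_matrix)
  moreover have "poly ?q (d i) \<noteq> 0" for i
  proof -
    have "?D - mat (d i) = diag_matrix (\<lambda>k. d k - d i)"
      by (simp add: vec_eq_iff diag_matrix_def mat_def)
    then have "poly ?q (d i) = - (\<Sum>k\<in>UNIV. \<Prod>l\<in>UNIV - {k}. d l - d i)"
      by (simp add: poly_pderiv_charpoly adjugate_diag_matrix trace_def) (simp add: diag_matrix_def)
    also have "(\<Sum>k\<in>UNIV. \<Prod>l\<in>UNIV - {k}. d l - d i) = (\<Sum>k\<in>{i}. \<Prod>l\<in>UNIV - {k}. d l - d i)"
      by (rule sum.mono_neutral_right) (auto intro!: prod_zero)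
    finally show ?thesis using assms by (auto simp: inj_eq)
  qed
  ultimately show ?thesis by simp
qed

lemma degenerate_scale:
  fixes X :: "complex^'n^'n"
  assumes "degenerate X"
  shows "degenerate (mat s ** X)"
proof -
  obtain z where z: "det (X - mat z) = 0" "trace (adjugate (X - mat z)) = 0"
    using assms by (auto simp: degenerate_def)
  have e: "mat s ** X - mat (s * z) = mat s ** (X - mat z)"
    by (simp add: matrix_mul_diff_right mat_mult_mat)
  have "mat s = (diag_matrix (\<lambda>_. s) :: complex^'n^'n)" "diag_matrix (\<lambda>_. s ^ (CARD('n) - 1)) = (mat (s ^ (CARD('n) - 1)) :: complex^'n^'n)"
    by (simp_all add: vec_eq_iff mat_def diag_matrix_def)
  then have "adjugate (mat s :: complex^'n^'n) = mat (s ^ (CARD('n) - 1))"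
    by (simp add: adjugate_diag_matrix card_Diff_singleton)
  then have "trace (adjugate (mat s ** (X - mat z))) = 0"
    using z(2) by (simp add: adjugate_mult mat_mult_commute trace_mat_mult)
  moreover have "det (mat s ** (X - mat z)) = 0" using z(1) by (simp add: det_mul)
  ultimately show ?thesis unfolding degenerate_def by (intro exI[of _ "s * z"]) (simp add: e)
qed

text \<open>Multiplying by \<open>s = 1 / c\<close> turns the line into \<open>s M + D\<close> and keeps degeneracy. The discriminant is a
  polynomial in \<open>s\<close> that does not vanish at \<open>s = 0\<close>.\<close>

lemma finite_degenerate_on_line:
  fixes M :: "complex^'n^'n"
  assumes "inj d"
  shows "finite {c. degenerate (M + mat c ** diag_matrix d)}"
proof -
  let ?D = "diag_matrix d"
  define A where "A s = mat s ** M + ?D" for s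
  let ?R = "\<lambda>s. det (poly_matrix (pderiv (charpoly (A s))) (A s))"
  have "polynomial_fun (\<lambda>s. A s $ i $ j)" for i j
  proof -
    show ?thesis
      unfolding polynomial_fun_def by (rule exI[of _ "[:?D $ i $ j, M $ i $ j:]"]) (simp add: A_def)
  qed
  then have "polynomial_fun ?R" by (rule polynomial_fun_discriminant)
  moreover have "?R 0 \<noteq> 0" using discriminant_diag_nonzero[OF assms] by (simp add: A_def)
  ultimately have "finite {s. ?R s = 0}" by (rule finite_zeros_polynomial_fun)
  then have "finite (insert 0 (inverse ` {s. ?R s = 0}))" by simp
  moreover have "{c. degenerate (M + mat c ** ?D)} \<subseteq> insert 0 (inverse ` {s. ?R s = 0})"
  proof
    fix c assume "c \<in> {c. degenerate (M + mat c ** ?D)}"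
    then have dg: "degenerate (mat (inverse c) ** (M + mat c ** ?D))" by (intro degenerate_scale) simp
    show "c \<in> insert 0 (inverse ` {s. ?R s = 0})"
    proof (cases "c = 0")
      case False
      then have "mat (inverse c) ** (M + mat c ** ?D) = A (inverse c)"
        by (simp add: A_def vec_eq_iff algebra_simps)
      then have "?R (inverse c) = 0" using dg det_discriminant_matrix_degenerate by metis
      then show ?thesis by (intro insertI2 image_eqI[of _ _ "inverse c"]) simp_all
    qed simp
  qed
  ultimately show ?thesis by (rule rev_finite_subset)
qed

section \<open>The law of the matrix Brownian motion\<close>

text \<open>The image of a real coordinate direction under the linear map that assembles the noise matrix; the
  left summand of the index type stands for real parts and the right one for imaginary parts.\<close>

definition matrix_unit :: "('n \<times> 'n) + ('n \<times> 'n) \<Rightarrow> complex^'n^'n" where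
  "matrix_unit i = (\<chi> a b. case i of Inl p \<Rightarrow> (if p = (a, b) then 1 / of_real (sqrt (2 * real CARD('n))) else 0)
     | Inr p \<Rightarrow> (if p = (a, b) then \<i> / of_real (sqrt (2 * real CARD('n))) else 0))"

lemma sum_matrix_unit:
  "(\<Sum>i\<in>UNIV. x i *\<^sub>R matrix_unit i) $ a $ b = Complex (x (Inl (a, b))) (x (Inr (a, b))) / of_real (sqrt (2 * real CARD('n)))"
  for a b :: "'n::finite"
proof -
  let ?r = "of_real (sqrt (2 * real CARD('n))) :: complex"
  have "(\<Sum>i\<in>UNIV. x i *\<^sub>R matrix_unit i) $ a $ b = (\<Sum>i\<in>UNIV. x i *\<^sub>R matrix_unit i $ a $ b)" by simp
  also have "\<dots> = (\<Sum>p\<in>UNIV. x (Inl p) *\<^sub>R matrix_unit (Inl p) $ a $ b) + (\<Sum>p\<in>UNIV. x (Inr p) *\<^sub>R matrix_unit (Inr p) $ a $ b)"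
    by (simp add: UNIV_Plus_UNIV[symmetric] sum.Plus del: UNIV_Plus_UNIV)
  also have "(\<Sum>p\<in>UNIV. x (Inl p) *\<^sub>R matrix_unit (Inl p) $ a $ b) = (\<Sum>p\<in>UNIV. if p = (a, b) then x (Inl (a, b)) / ?r else 0)"
    by (intro sum.cong refl) (auto simp: matrix_unit_def scaleR_conv_of_real)
  also have "(\<Sum>p\<in>UNIV. x (Inr p) *\<^sub>R matrix_unit (Inr p) $ a $ b) = (\<Sum>p\<in>UNIV. if p = (a, b) then x (Inr (a, b)) * \<i> / ?r else 0)"
    by (intro sum.cong refl) (auto simp: matrix_unit_def scaleR_conv_of_real)
  finally show ?thesis by (simp add: complex_eq_iff add_divide_distrib[symmetric] Complex_eq mult.commute)
qed

text \<open>The entries at time \<open>t\<close> are independent Gaussian variables, so their joint law is absolutely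
  continuous and \<open>AE_PiM_lborel_avoids\<close> applies in the complex direction \<open>D\<close>.\<close>

lemma AE_matrix_bm_avoids:
  fixes M0 :: "complex^'n^'n" and D :: "complex^'n^'n"
  assumes P: "prob_space P" and fam: "indep_brownian_family P BR BI" and t: "t > 0"
    and B: "B \<in> sets borel" and null: "\<And>M. AE c in lborel. M + mat c ** D \<notin> B"
  shows "AE \<omega> in P. matrix_bm M0 BR BI t \<omega> \<notin> B"
proof -
  interpret prob_space P by (rule P)
  let ?r = "sqrt (2 * real CARD('n))"
  let ?X = "case_sum (\<lambda>(j, k). BR j k) (\<lambda>(j, k). BI j k) :: ('n \<times> 'n) + ('n \<times> 'n) \<Rightarrow> real \<Rightarrow> 'a \<Rightarrow> real"
  (* only the laws of increments are prescribed, so the increment from time 0 is used *)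
  define Z where "Z i \<omega> = ?X i t \<omega> - ?X i 0 \<omega>" for i \<omega>
  have bm: "std_brownian_motion P (?X i)" for i
    using fam by (auto simp: indep_brownian_family_def split: sum.split)
  have ind0: "indep_vars (\<lambda>_. Pi\<^sub>M {0..} (\<lambda>_. borel)) (\<lambda>i \<omega>. \<lambda>s\<in>{0..}. ?X i s \<omega>) UNIV"
    using fam by (simp add: indep_brownian_family_def indep_processes_def)
  have "indep_vars (\<lambda>_. borel) (\<lambda>i \<omega>. (\<lambda>s\<in>{0..}. ?X i s \<omega>) t - (\<lambda>s\<in>{0..}. ?X i s \<omega>) 0) UNIV"
    using t by (intro indep_vars_compose2[OF ind0]) (auto intro!: borel_measurable_diff measurable_component_singleton)
  then have ind: "indep_vars (\<lambda>_. borel) Z UNIV"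
    using t by (simp add: Z_def[abs_def])
  have dist: "distributed P lborel (Z i) (\<lambda>x. ennreal (normal_density 0 (sqrt (t - 0)) x))" for i
    using bm[of i] t unfolding std_brownian_motion_def Z_def[abs_def] by blast
  define y where "y c i = (case i of Inl (a, b) \<Rightarrow> Re (c * D $ a $ b) * ?r | Inr (a, b) \<Rightarrow> Im (c * D $ a $ b) * ?r)" for c i
  have r: "?r \<noteq> 0" by simp
  have yD: "(\<Sum>i\<in>UNIV. y c i *\<^sub>R matrix_unit i) = mat c ** D" for c
  proof -
    have W: "Complex (Re w * ?r) (Im w * ?r) / of_real ?r = w" for w
      using r by (simp add: complex_eq_iff Re_divide_of_real Im_divide_of_real)
    show ?thesis
      by (simp only: vec_eq_iff sum_matrix_unit y_def sum.case prod.case mat_mult_nth W simp_thms)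
  qed
  have ym: "(\<lambda>c. y c i) \<in> borel_measurable borel" for i
    by (cases i) (auto simp: y_def intro!: borel_measurable_continuous_onI continuous_intros)
  have "AE x in (\<Pi>\<^sub>M i\<in>UNIV. lborel). M0 + (\<Sum>i\<in>UNIV. x i *\<^sub>R matrix_unit i) \<notin> B"
    by (rule AE_PiM_lborel_avoids[where y=y and E=matrix_unit, OF B ym]) (simp only: yD null)
  moreover have "{x \<in> space (\<Pi>\<^sub>M i\<in>UNIV. lborel). M0 + (\<Sum>i\<in>UNIV. x i *\<^sub>R matrix_unit i) \<notin> B} \<in> sets (\<Pi>\<^sub>M i\<in>UNIV. lborel)"
    using B by measurable
  ultimately have "AE \<omega> in P. M0 + (\<Sum>i\<in>UNIV. Z i \<omega> *\<^sub>R matrix_unit i) \<notin> B"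
    by (rule AE_indep_densities[OF P ind dist])
  moreover have "AE \<omega> in P. \<forall>i. ?X i 0 \<omega> = 0"
    using bm by (subst AE_all_countable) (auto simp: std_brownian_motion_def)
  ultimately show ?thesis
  proof eventually_elim
    case (elim \<omega>)
    have "Z i \<omega> = ?X i t \<omega>" for i using elim(2) by (simp add: Z_def)
    then have "M0 + (\<Sum>i\<in>UNIV. Z i \<omega> *\<^sub>R matrix_unit i) = matrix_bm M0 BR BI t \<omega>"
      by (simp add: vec_eq_iff sum_matrix_unit matrix_bm_def del: sum_component)
    then show ?case using elim(1) by simp
  qed
qed

lemma AE_matrix_bm_simple_spectrum:
  fixes M0 :: "complex^'n^'n"
  assumes P: "prob_space P" and fam: "indep_brownian_family P BR BI" and t: "t > 0"
  shows "AE \<omega> in P. simple_spectrum (matrix_bm M0 BR BI t \<omega>)"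
proof -
  obtain d0 :: "'n \<Rightarrow> nat" where "inj d0"
    using finite_imp_inj_to_nat_seg[of "UNIV :: 'n set"] by auto
  then have d: "inj (\<lambda>i. of_nat (d0 i) :: complex)" by (simp add: inj_def)
  have "AE \<omega> in P. matrix_bm M0 BR BI t \<omega> \<notin> {M. degenerate M}"
  proof (rule AE_matrix_bm_avoids[OF P fam t borel_degenerate])
    fix M :: "complex^'n^'n"
    have "AE c in lborel. c \<notin> {c. degenerate (M + mat c ** diag_matrix (\<lambda>i. of_nat (d0 i)))}"
      by (rule AE_not_in) (rule finite_imp_null_set_lborel[OF finite_degenerate_on_line[OF d]])
    then show "AE c in lborel. M + mat c ** diag_matrix (\<lambda>i. of_nat (d0 i)) \<notin> {M. degenerate M}" by simp
  qed
  then show ?thesis by eventually_elim (simp add: simple_spectrum_if_not_degenerate)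
qed

text \<open>Enclose the exceptional points in an intersection of a decreasing sequence of open sets that is
  still null; the matrices with an eigenvalue there form a Borel set. Along \<open>M + c\<close> the eigenvalues
  are shifted by \<open>c\<close>, so the bad \<open>c\<close> lie in finitely many translates of a null set.\<close>

lemma AE_matrix_bm_eigenvalues_avoid:
  fixes M0 :: "complex^'n^'n"
  assumes P: "prob_space P" and fam: "indep_brownian_family P BR BI" and t: "t > 0"
    and Q: "AE z in lborel. Q z"
  shows "AE \<omega> in P. \<forall>z\<in>eigenvalues (matrix_bm M0 BR BI t \<omega>). Q z"
proof -
  obtain N where N: "{z \<in> space lborel. \<not> Q z} \<subseteq> N" "N \<in> null_sets lborel"
    using Q by (auto elim: AE_E simp: null_sets_def)
  then have "negligible N"
    by (simp add: negligible_iff_null_sets null_sets_completionI)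
  then obtain U where U: "\<And>n::nat. open (U n)" "\<And>n. N \<subseteq> U n" "decseq U" "negligible (\<Inter>n. U n)"
    by (rule decreasing_open_null_cover) (rule that)
  define B where "B = (\<Inter>n. {M :: complex^'n^'n. \<exists>z\<in>U n. det (M - mat z) = 0})"
  have B: "B \<in> sets borel" unfolding B_def by (intro sets.countable_INT) (auto intro: borel_eigenvalue_in_open[OF U(1)])
  have "AE \<omega> in P. matrix_bm M0 BR BI t \<omega> \<notin> B"
  proof (rule AE_matrix_bm_avoids[OF P fam t B])
    fix M :: "complex^'n^'n"
    have "negligible ((\<lambda>u. u - z) ` (\<Inter>n. U n))" for z
      using negligible_translation[OF U(4), of "- z"] by simp
    then have "negligible (\<Union>z\<in>eigenvalues M. (\<lambda>u. u - z) ` (\<Inter>n. U n))"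
      by (intro negligible_Union) (auto simp: finite_eigenvalues)
    then have "AE c in lborel. c \<notin> (\<Union>z\<in>eigenvalues M. (\<lambda>u. u - z) ` (\<Inter>n. U n))"
      by (rule AE_lborel_not_in_negligible)
    then show "AE c in lborel. M + mat c ** mat 1 \<notin> B"
    proof eventually_elim
      case (elim c)
      show ?case
      proof
        assume "M + mat c ** mat 1 \<in> B"
        then have "\<exists>z\<in>U n. det (M + mat c ** mat 1 - mat z) = 0" for n by (auto simp: B_def)
        then obtain u where u: "u \<in> (\<Inter>n. U n)" "det (M + mat c ** mat 1 - mat u) = 0"
          using eigenvalue_in_decreasing_Inter[OF U(3)] by blast
        have e: "M + mat c - mat u = M - mat (u - c)" by (simp add: vec_eq_iff) (simp add: mat_def)
        have "u - c \<in> eigenvalues M" using u(2) unfolding eigenvalues_iff_det matrix_mul_rid e .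
        then have "c \<in> (\<Union>z\<in>eigenvalues M. (\<lambda>u. u - z) ` (\<Inter>n. U n))"
          by (intro UN_I[of "u - c"] image_eqI[of _ _ u] u(1)) simp_all
        then show False using elim by blast
      qed
    qed
  qed
  then show ?thesis
  proof eventually_elim
    case (elim \<omega>)
    show ?case
    proof (rule ccontr)
      assume "\<not> ?thesis"
      then obtain z where z: "z \<in> eigenvalues (matrix_bm M0 BR BI t \<omega>)" "\<not> Q z" by blast
      then have "z \<in> U n" for n using N(1) U(2) by auto
      then have "matrix_bm M0 BR BI t \<omega> \<in> B" using z(1) by (auto simp: B_def eigenvalues_iff_det)
      then show False using elim by blast
    qed
  qed
qed

section \<open>Almost sure convergence\<close>

theorem proposition1p5:
  fixes P :: "'w measure"
    and M0 :: "complex^'n^'n"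
    and BR BI :: "'n \<Rightarrow> 'n \<Rightarrow> real \<Rightarrow> 'w \<Rightarrow> real"
    and L :: "real \<Rightarrow> 'w \<Rightarrow> 'n \<Rightarrow> complex"
    and S :: "real \<Rightarrow> 'w \<Rightarrow> complex^'n^'n"
    and \<phi> :: "complex \<Rightarrow> complex"
    and t :: real
  assumes "prob_space P"
    and "indep_brownian_family P BR BI"
    and "simple_spectrum M0"
    and "\<And>s \<omega>. s \<ge> 0 \<Longrightarrow> \<omega> \<in> space P \<Longrightarrow> simple_spectrum (matrix_bm M0 BR BI s \<omega>)
           \<Longrightarrow> eigensystem (matrix_bm M0 BR BI s \<omega>) (L s \<omega>) (S s \<omega>)"
    and "\<phi> \<in> B_c"
    and "t \<ge> 0"
    and "t = 0 \<longrightarrow> (\<forall>l\<in>eigenvalues M0. isCont \<phi> l)"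
  shows "AE \<omega> in P.
      ((\<lambda>w. \<integral>z. \<phi> z \<partial>(mu_Lambda (matrix_bm M0 BR BI t \<omega>) w))
         \<longlongrightarrow> (\<integral>z. \<phi> z \<partial>(Xi_measure (L t \<omega>)))) (at 0) \<and>
      ((\<lambda>w. \<integral>z. \<phi> z \<partial>(mu_O (matrix_bm M0 BR BI t \<omega>) w))
         \<longlongrightarrow> (\<integral>z. \<phi> z \<partial>(Theta_measure (S t \<omega>) (L t \<omega>)))) (at 0)"
proof -
  let ?M = "matrix_bm M0 BR BI t"
  have m: "\<phi> \<in> borel_measurable borel" using assms(5) by (simp add: B_c_def)
  obtain C where C: "\<And>z. cmod (\<phi> z) \<le> C"
    using assms(5) unfolding B_c_def bounded_iff by auto
  have "AE \<omega> in P. simple_spectrum (?M \<omega>) \<and> (\<forall>z\<in>eigenvalues (?M \<omega>). lebesgue_point \<phi> z)"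
  proof (cases "t = 0")
    case True
    have "AE \<omega> in P. BR j k 0 \<omega> = 0 \<and> BI j k 0 \<omega> = 0" for j k
      using assms(2) by (auto simp: indep_brownian_family_def std_brownian_motion_def)
    then have "AE \<omega> in P. \<forall>j k. BR j k 0 \<omega> = 0 \<and> BI j k 0 \<omega> = 0"
      by (simp add: AE_all_countable)
    then show ?thesis
    proof eventually_elim
      case (elim \<omega>)
      have "?M \<omega> = M0" using elim True by (simp add: matrix_bm_def vec_eq_iff Complex_eq_0)
      then show ?case using assms(3,7) True isCont_imp_lebesgue_point[OF m C] by simp
    qed
  next
    case False
    then have t: "t > 0" using assms(6) by simp
    have "AE \<omega> in P. simple_spectrum (?M \<omega>)"
      by (rule AE_matrix_bm_simple_spectrum[OF assms(1,2) t])
    moreover have "AE \<omega> in P. \<forall>z\<in>eigenvalues (?M \<omega>). lebesgue_point \<phi> z"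
      by (rule AE_matrix_bm_eigenvalues_avoid[OF assms(1,2) t AE_lebesgue_point[OF m C]])
    ultimately show ?thesis by eventually_elim simp
  qed
  then show ?thesis
    using AE_space
  proof eventually_elim
    case (elim \<omega>)
    then have es: "eigensystem (?M \<omega>) (L t \<omega>) (S t \<omega>)" using assms(4,6) by blast
    then have "L t \<omega> j \<in> eigenvalues (?M \<omega>)" for j
      by (auto simp: eigensystem_def bij_betw_def)
    then show ?case
      using concentration_for_fixed_matrix[OF es assms(5)] elim by blast
  qed
qed

end
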